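(* Let $X$ be a random vector in $\mathbb{R}^d$. Let $b\in\mathbb{R}^d$ and let $\nu$ be a Lévy measure with $\int_{\|u\|\le1}\|u\|\nu(du)<+\infty$ and with polar decomposition $$\nu(du)=\mathbf 1_{(0,+\infty)}(r)\mathbf 1_{\mathbb{S}^{d-1}}(x)\frac{k_x(r)}{r}\,dr\,\sigma(dx),$$ where $\sigma$ is a finite positive measure on $\mathbb{S}^{d-1}$ and where $k_x(r)$ is a nonnegative continuous function decreasing in $r\in(0,+\infty)$, continuous in $x\in\mathbb{S}^{d-1}$, and such that $$\lim_{\varepsilon\to0^+}\varepsilon k_x(\varepsilon)=0,\quad \lim_{R\to+\infty}k_x(R)=0,\quad x\in\mathbb{S}^{d-1},\qquad \int_0^{+\infty}(1\wedge r)\max_{x\in\mathbb{S}^{d-1}}k_x(r)\,\frac{dr}{r}<+\infty.$$ Moreover, assume that for all sequences $(x_n)_{n\ge1}$ in $\mathbb{S}^{d-1}$ converging to $x\in\mathbb{S}^{d-1}$, $$\lim_{n\to+\infty}\lim_{R\to+\infty}V_a^R(k_{x_n}-k_x)=0,\quad a>0.$$ Let $\tilde\nu$ be the positive measure on $\mathbb{R}^d$ defined by $\tilde\nu(du)=\mathbf 1_{(0,+\infty)}(r)\mathbf 1_{\mathbb{S}^{d-1}}(x)(-dk_x(r))\sigma(dx)$, and assume $\int_{\mathbb{R}^d}(1\wedge\|u\|)\tilde\nu(du)<+\infty$. Set $b_0=b-\int_{\|u\|\le1}u\,\nu(du)$. Then $$\mathbb{E}\langle X;\nabla f(X)\rangle=\mathbb{E}\langle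 b_0;\nabla f(X)\rangle+\mathbb{E}\int_{\mathbb{R}^d}\big(f(X+u)-f(X)\big)\tilde\nu(du)$$ holds for all $f\in\mathcal{S}(\mathbb{R}^d)$ if and only if $X$ is self-decomposable with parameter $b$, $\Sigma=0$ and Lévy measure $\nu$.
   Context: $\|\cdot\|$, $\langle\cdot;\cdot\rangle$ are the Euclidean norm and inner product on $\mathbb{R}^d$; $\mathbb{S}^{d-1}$ is the Euclidean unit sphere; $\mathcal{S}(\mathbb{R}^d)$ is the Schwartz space of real-valued functions. A Lévy measure is a positive Borel measure $\nu$ on $\mathbb{R}^d$ with $\nu(\{0\})=0$ and $\int(1\wedge\|u\|^2)\nu(du)<+\infty$. Polar decompositions are in coordinates $u=rx$, $r>0$, $x\in\mathbb{S}^{d-1}$. "Decreasing" means non-increasing, and $-dk_x(r)$ is the positive Lebesgue–Stieltjes measure on $(0,+\infty)$ associated with the decreasing function $r\mapsto k_x(r)$. $V_a^R(g)=\sup\sum_{i=1}^n|g(x_i)-g(x_{i-1})|$ (supremum over all subdivisions $a=x_0<\dots<x_n=R$) is the variation of $g$ on $[a,R]$. "$X$ is self-decomposable with parameter $b$, $\Sigma=0$ and Lévy measure $\nu$" means that $X$ has characteristic function $\varphi(\xi)=\exp\big(i\langle b;\xi\rangle+\int_{\mathbb{R}^d}(e^{i\langle\xi;u\rangle}-1-i\langle\xi;u\rangle\mathbf 1_{\|u\|\le1})\nu(du)\big)$, where $\nu$ has the polar decomposition $\nu(du)=\mathbf 1_{(0,+\infty)}(r)\mathbf 1_{\mathbb{S}^{d-1}}(x)\frac{k_x(r)}{r}\,dr\,\sigma(dx)$,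 with $\sigma$ a finite positive measure on $\mathbb{S}^{d-1}$ and $k_x(r)\ge0$ decreasing in $r$ and measurable in $x$. *)

theory Defs
  imports "HOL-Probability.Probability"
begin

subsection \<open>Schwartz functions and gradients\<close>

fun iterated_partial :: "'a::euclidean_space list \<Rightarrow> ('a \<Rightarrow> real) \<Rightarrow> 'a \<Rightarrow> real" where
  "iterated_partial [] f = f"
| "iterated_partial (i # is) f = (\<lambda>x. frechet_derivative (iterated_partial is f) (at x) i)"

text \<open>
  Differentiability of all iterated partial derivatives is the same as smoothness; the lists over
  \<open>Basis\<close> play the role of multi-indices.
\<close>

definition schwartz :: "('a::euclidean_space \<Rightarrow> real) \<Rightarrow> bool" where
  "schwartz f \<longleftrightarrow>
     (\<forall>is \<in> lists Basis.
        (\<forall>x. iterated_partial is f differentiable (at x)) \<and>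
        (\<forall>m. bounded (range (\<lambda>x. norm x ^ m * iterated_partial is f x))))"

definition grad :: "('a::euclidean_space \<Rightarrow> real) \<Rightarrow> 'a \<Rightarrow> 'a" where
  "grad f x = (\<Sum>i\<in>Basis. frechet_derivative f (at x) i *\<^sub>R i)"

subsection \<open>Variation and Lebesgue--Stieltjes measures\<close>

definition variation :: "real \<Rightarrow> real \<Rightarrow> (real \<Rightarrow> real) \<Rightarrow> ennreal" where
  "variation a R g =
     Sup {ennreal (\<Sum>i<n. \<bar>g (t (Suc i)) - g (t i)\<bar>) | n t.
            t 0 = a \<and> t n = R \<and> (\<forall>i<n. t i < t (Suc i))}"

text \<open>
  The measure \<open>- dh\<close> on \<open>(0, \<infinity>)\<close>, for \<open>h\<close> continuous and decreasing there. Since \<open>h\<close> may be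
  unbounded near \<open>0\<close>, it is obtained from the Stieltjes measure of the increasing function
  \<open>t \<mapsto> - h (exp t)\<close> on the whole real line by the change of variable \<open>r = exp t\<close>.
\<close>

definition neg_stieltjes :: "(real \<Rightarrow> real) \<Rightarrow> real measure" where
  "neg_stieltjes h = distr (interval_measure (\<lambda>t. - h (exp t))) borel exp"

lemma emeasure_neg_stieltjes_Ioc:
  assumes anti: "antimono_on {0<..} h" and cont: "continuous_on {0<..} h"
    and ab: "0 < a" "a \<le> b"
  shows "emeasure (neg_stieltjes h) {a<..b} = ennreal (h a - h b)"
proof -
  have "continuous_on UNIV (\<lambda>t::real. - h (exp t))"
    by (intro continuous_on_minus continuous_on_compose2[OF cont] continuous_intros) auto
  then have rc: "continuous (at_right t) (\<lambda>t::real. - h (exp t))" for t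
    by (auto simp: continuous_on_eq_continuous_within intro: continuous_within_subset)
  have mono: "- h (exp s) \<le> - h (exp t)" if "s \<le> t" for s t :: real
    using monotone_onD[OF anti, of "exp s" "exp t"] that by simp
  have "exp -` {a<..b} = {ln a<..ln b}"
  proof (intro set_eqI)
    fix t
    have "a < exp t \<longleftrightarrow> ln a < t"
      using exp_less_cancel_iff[of "ln a" t] ab by simp
    moreover have "exp t \<le> b \<longleftrightarrow> t \<le> ln b"
      using exp_le_cancel_iff[of t "ln b"] ab by simp
    ultimately show "t \<in> exp -` {a<..b} \<longleftrightarrow> t \<in> {ln a<..ln b}"
      by simp
  qed
  then have "emeasure (neg_stieltjes h) {a<..b}
      = emeasure (interval_measure (\<lambda>t. - h (exp t))) {ln a<..ln b}"
    by (simp add: neg_stieltjes_def emeasure_distr)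
  also have "\<dots> = ennreal (h a - h b)"
    using ab by (subst emeasure_interval_measure_Ioc[OF _ mono rc]) auto
  finally show ?thesis .
qed

lemma emeasure_neg_stieltjes_nonpos: "emeasure (neg_stieltjes h) {..0} = 0"
proof -
  have "exp -` {..0::real} = ({} :: real set)"
    by (auto simp: not_le)
  then show ?thesis
    by (simp add: neg_stieltjes_def emeasure_distr)
qed

subsection \<open>Levy measures, polar decompositions and self-decomposability\<close>

definition levy_measure :: "'a::euclidean_space measure \<Rightarrow> bool" where
  "levy_measure \<nu> \<longleftrightarrow>
     sets \<nu> = sets borel \<and> emeasure \<nu> {0} = 0 \<and>
     (\<integral>\<^sup>+u. ennreal (min 1 ((norm u)\<^sup>2)) \<partial>\<nu>) < \<infinity>"

definition finite_sphere_measure :: "'a::euclidean_space measure \<Rightarrow> bool" where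
  "finite_sphere_measure \<sigma> \<longleftrightarrow>
     finite_measure \<sigma> \<and> sets \<sigma> = sets (restrict_space borel (sphere 0 1))"

text \<open>
  \<open>polar_decomposition \<mu> \<sigma> \<kappa>\<close> says that
  \<open>\<mu>(du) = 1\<^bsub>(0,\<infinity>)\<^esub>(r) 1\<^bsub>S\<^esub>(x) \<kappa>\<^sub>x(dr) \<sigma>(dx)\<close> in the coordinates \<open>u = r x\<close>.
  This determines \<open>\<mu>\<close>.
\<close>

definition polar_decomposition ::
  "'a::euclidean_space measure \<Rightarrow> 'a measure \<Rightarrow> ('a \<Rightarrow> real measure) \<Rightarrow> bool" where
  "polar_decomposition \<mu> \<sigma> \<kappa> \<longleftrightarrow>
     sets \<mu> = sets borel \<and>
     (\<forall>A\<in>sets borel.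
        emeasure \<mu> A = (\<integral>\<^sup>+x. emeasure (\<kappa> x) {r. 0 < r \<and> r *\<^sub>R x \<in> A} \<partial>\<sigma>))"

text \<open>The measure \<open>h(r)/r dr\<close> on \<open>(0, \<infinity>)\<close>.\<close>

definition over_r_measure :: "(real \<Rightarrow> real) \<Rightarrow> real measure" where
  "over_r_measure h = density lborel (\<lambda>r. ennreal (h r / r) * indicator {0<..} r)"

definition self_decomposable ::
  "'w measure \<Rightarrow> ('w \<Rightarrow> 'a::euclidean_space) \<Rightarrow> 'a \<Rightarrow> 'a measure \<Rightarrow> bool" where
  \<comment> \<open>with parameter \<open>b\<close>, \<open>\<Sigma> = 0\<close> and Levy measure \<open>\<nu>\<close>\<close>
  "self_decomposable M X b \<nu> \<longleftrightarrow>
     levy_measure \<nu> \<and>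
     (\<exists>\<sigma> k. finite_sphere_measure \<sigma> \<and>
        (\<forall>x\<in>sphere 0 1. \<forall>r>0. 0 \<le> k x r) \<and>
        (\<forall>x\<in>sphere 0 1. antimono_on {0<..} (k x)) \<and>
        (\<forall>r>0. (\<lambda>x. k x r) \<in> borel_measurable \<sigma>) \<and>
        polar_decomposition \<nu> \<sigma> (\<lambda>x. over_r_measure (k x))) \<and>
     (\<forall>\<xi>. (CLINT \<omega>|M. iexp (\<xi> \<bullet> X \<omega>)) =
        exp (\<i> * complex_of_real (b \<bullet> \<xi>) +
             (CLINT u|\<nu>. iexp (\<xi> \<bullet> u) - 1
                - \<i> * complex_of_real ((\<xi> \<bullet> u) * indicator (cball 0 1) u))))"

end

theory Submission
  imports Defs
begin

text \<open>
  Since \<open>k x r\<close> is the \<open>- dk\<^sub>x\<close>-mass of \<open>(r, \<infinity>)\<close>, the measure \<open>\<nu>\<close> is the image of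
  \<open>\<nu>'(du) ds/s\<close> on \<open>0 < s < 1\<close> under \<open>(u, s) \<mapsto> s u\<close>. Hence, along a ray, the exponent
  \<open>\<psi>\<close> of the self-decomposable law satisfies
  \<open>t d/dt \<psi>(t \<xi>) = \<i> t (b\<^sub>0 \<bullet> \<xi>) + \<integral> (exp (\<i> t (\<xi> \<bullet> u)) - 1) \<nu>'(du)\<close>, and the integral
  identity for \<open>f(x) = exp (\<i> t (\<xi> \<bullet> x))\<close> is formally the same equation for the logarithm of the
  characteristic function of \<open>X\<close>. These \<open>f\<close> are not Schwartz functions and \<open>X\<close> need not have
  moments. In one direction one multiplies \<open>f\<close> by \<open>exp (- \<epsilon> |x|\<^sup>2)\<close>; the error terms have bounds
  that do not depend on \<open>t\<close> and vanish with \<open>\<epsilon>\<close>. In the other direction one mollifies a Schwartz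
  function with a Gaussian of width \<open>\<delta>\<close>: the result \<open>h\<close> is a superposition of characters, since
  the Gaussian is its own Fourier transform, and differentiating \<open>t \<mapsto> E h(t X)\<close> at \<open>t = 1\<close> in
  two ways gives the identity for \<open>h\<close>; then \<open>\<delta> \<rightarrow> 0\<close>.
\<close>

subsection \<open>Differentiation under the integral sign\<close>

text \<open>In place of moments of \<open>X\<close> the proof uses that
  \<open>norm x * norm (grad f x)\<close> is bounded for Schwartz \<open>f\<close>. As
  \<open>phi\<close> is not known to be differentiable, the limit in \<epsilon> is taken in the
  increments over \<open>{s..1}\<close> of the damped characteristic function times
  \<open>exp (- psi)\<close>, not in the differential equation itself. The integrating factor also
  avoids logarithms, so possible zeros of \<open>phi\<close> do no harm. The error is uniform in t
  by a cancellation: once the jump exponent is subtracted, only increments of the Gaussian times a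
  unimodular factor remain, and the frequency disappears from the modulus. The lower end s > 0 keeps
  away from the singular factor 1/t in the derivative of \<open>psi\<close>; letting s tend to 0
  fixes the constant. In the converse direction the frequencies are averaged over the standard
  Gaussian, a probability measure, with a bounded amplitude. Fubini and the first Gaussian moment
  then do the work of Fourier inversion of \<open>f\<close>. On the side of the jumps everything is
  measured against the single weight \<open>min 1 (norm u)\<close>.\<close>

lemma norm_integral_le:
  fixes f :: "'b \<Rightarrow> 'c::{banach, second_countable_topology}"
  assumes "integrable M w" "\<And>x. x \<in> space M \<Longrightarrow> norm (f x) \<le> w x"
  shows "norm (integral\<^sup>L M f) \<le> integral\<^sup>L M w"
proof -
  have "(LINT x|M. norm (f x)) \<le> integral\<^sup>L M w"
    using assms by (intro integral_mono') (auto intro: order_trans[OF norm_ge_zero])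
  \<comment> \<open>A non-integrable \<open>f\<close> has integral 0 by convention, so the norm
    bound applies to it as well and no integrability goal for \<open>f\<close> arises.\<close>
  then show ?thesis
    by (rule order_trans[OF integral_norm_bound])
qed

text \<open>Difference quotients allow the derivative to be tested along sequences, the form in
  which dominated convergence applies.\<close>

lemma has_vector_derivative_iff_tendsto:
  "(f has_vector_derivative D) (at t) \<longleftrightarrow>
   ((\<lambda>h. (f (t + h) - f t) /\<^sub>R h) \<longlongrightarrow> D) (at 0)"
proof -
  have "norm (f (t + h) - f t - h *\<^sub>R D) / norm h = norm ((f (t + h) - f t) /\<^sub>R h - D)"
    if "h \<noteq> 0" for h
  proof -
    have "f (t + h) - f t - h *\<^sub>R D = h *\<^sub>R ((f (t + h) - f t) /\<^sub>R h - D)"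
      using that by (simp add: scaleR_right_diff_distrib)
    then show ?thesis
      using that by simp
  qed
  then have "((\<lambda>h. norm (f (t + h) - f t - h *\<^sub>R D) / norm h) \<longlongrightarrow> 0) (at 0)
    \<longleftrightarrow> ((\<lambda>h. norm ((f (t + h) - f t) /\<^sub>R h - D)) \<longlongrightarrow> 0) (at 0)"
    by (intro filterlim_cong) (auto simp: eventually_at_filter)
  then show ?thesis
    by (simp add: has_vector_derivative_def has_derivative_at bounded_linear_scaleR_left
        tendsto_norm_zero_iff LIM_zero_iff)
qed

text \<open>Dominated convergence for difference quotients: the mean value inequality on the convex
  set \<open>S\<close> turns the bound \<open>w\<close> on the derivative into a bound on the
  quotients. Later uses only have to find \<open>S\<close> and \<open>w\<close>.\<close>

lemma has_vector_derivative_Bochner_integral: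
  fixes f f' :: "real \<Rightarrow> 'b \<Rightarrow> 'c::{banach, second_countable_topology}"
  assumes S: "open S" "convex S" "t \<in> S"
    and int: "\<And>s. s \<in> S \<Longrightarrow> integrable M (f s)"
    and deriv: "\<And>s x. s \<in> S \<Longrightarrow> x \<in> space M \<Longrightarrow>
      ((\<lambda>s. f s x) has_vector_derivative f' s x) (at s)"
    and meas: "f' t \<in> borel_measurable M"
    and bound: "\<And>s x. s \<in> S \<Longrightarrow> x \<in> space M \<Longrightarrow> norm (f' s x) \<le> w x"
    and w: "integrable M w"
  shows "((\<lambda>s. integral\<^sup>L M (f s)) has_vector_derivative integral\<^sup>L M (f' t)) (at t)"
proof -
  have "((\<lambda>h. (integral\<^sup>L M (f (t + h)) - integral\<^sup>L M (f t)) /\<^sub>R h) \<longlongrightarrow> integral\<^sup>L M (f' t)) (at 0)"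
    unfolding tendsto_at_iff_sequentially
  proof (intro allI impI)
    fix \<eta> :: "nat \<Rightarrow> real"
    assume \<eta>0: "\<forall>i. \<eta> i \<in> UNIV - {0}" and \<eta>: "\<eta> \<longlonglongrightarrow> 0"
    have "(\<lambda>n. t + \<eta> n) \<longlonglongrightarrow> t + 0"
      by (intro tendsto_intros \<eta>)
    \<comment> \<open>Only a tail of the sequence lies in the open set \<open>S\<close>; the
      sequence is shifted by \<open>n0\<close>, and \<open>LIMSEQ_offset\<close> undoes the
      shift.\<close>
    then have "eventually (\<lambda>n. t + \<eta> n \<in> S) sequentially"
      using S by (intro topological_tendstoD) auto
    then obtain n0 where n0: "\<And>n. n \<ge> n0 \<Longrightarrow> t + \<eta> n \<in> S"
      by (auto simp: eventually_sequentially)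
    have "(\<lambda>n. integral\<^sup>L M (\<lambda>x. (f (t + \<eta> (n + n0)) x - f t x) /\<^sub>R \<eta> (n + n0)))
      \<longlonglongrightarrow> integral\<^sup>L M (f' t)"
    proof (rule integral_dominated_convergence[OF meas _ w])
      show "(\<lambda>x. (f (t + \<eta> (n + n0)) x - f t x) /\<^sub>R \<eta> (n + n0)) \<in> borel_measurable M" for n
        using int[OF n0[of "n + n0"]] int[OF S(3)] by auto
      show "AE x in M. (\<lambda>n. (f (t + \<eta> (n + n0)) x - f t x) /\<^sub>R \<eta> (n + n0)) \<longlonglongrightarrow> f' t x"
      proof (rule AE_I2)
        fix x assume "x \<in> space M"
        then have "((\<lambda>h. (f (t + h) x - f t x) /\<^sub>R h) \<longlongrightarrow> f' t x) (at 0)"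
          using deriv[OF S(3)] by (simp add: has_vector_derivative_iff_tendsto)
        then have "(\<lambda>n. (f (t + \<eta> n) x - f t x) /\<^sub>R \<eta> n) \<longlonglongrightarrow> f' t x"
          using \<eta>0 \<eta> unfolding tendsto_at_iff_sequentially comp_def by blast
        then show "(\<lambda>n. (f (t + \<eta> (n + n0)) x - f t x) /\<^sub>R \<eta> (n + n0)) \<longlonglongrightarrow> f' t x"
          by (rule LIMSEQ_ignore_initial_segment)
      qed
      show "AE x in M. norm ((f (t + \<eta> (n + n0)) x - f t x) /\<^sub>R \<eta> (n + n0)) \<le> w x" for n
      proof (rule AE_I2)
        fix x assume x: "x \<in> space M"
        have "norm (f (t + \<eta> (n + n0)) x - f t x) \<le> w x * norm (t + \<eta> (n + n0) - t)"
        proof (rule differentiable_bound[OF S(2)])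
          show "((\<lambda>s. f s x) has_derivative (\<lambda>h. h *\<^sub>R f' s x)) (at s within S)" if "s \<in> S" for s
            using has_vector_derivative_at_within[OF deriv[OF that x]]
            unfolding has_vector_derivative_def .
          show "onorm (\<lambda>h. h *\<^sub>R f' s x) \<le> w x" if "s \<in> S" for s
          proof (rule onorm_le)
            show "norm (h *\<^sub>R f' s x) \<le> w x * norm h" for h
              using mult_right_mono[OF bound[OF that x], of "norm h"] by (simp add: mult.commute)
          qed
        qed (use n0 S in auto)
        then have "norm (f (t + \<eta> (n + n0)) x - f t x) / \<bar>\<eta> (n + n0)\<bar> \<le> w x"
          using \<eta>0 by (subst pos_divide_le_eq) auto
        moreover have "norm ((f (t + \<eta> (n + n0)) x - f t x) /\<^sub>R \<eta> (n + n0))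
            = norm (f (t + \<eta> (n + n0)) x - f t x) / \<bar>\<eta> (n + n0)\<bar>"
          unfolding norm_scaleR abs_inverse divide_inverse by (rule mult.commute)
        ultimately show "norm ((f (t + \<eta> (n + n0)) x - f t x) /\<^sub>R \<eta> (n + n0)) \<le> w x"
          by simp
      qed
    qed
    moreover have "integral\<^sup>L M (\<lambda>x. (f (t + \<eta> (n + n0)) x - f t x) /\<^sub>R \<eta> (n + n0))
       = (integral\<^sup>L M (f (t + \<eta> (n + n0))) - integral\<^sup>L M (f t)) /\<^sub>R \<eta> (n + n0)" for n
      using int[OF n0[of "n + n0"]] int[OF S(3)] by simp
    ultimately have "(\<lambda>n. (integral\<^sup>L M (f (t + \<eta> (n + n0))) - integral\<^sup>L M (f t)) /\<^sub>R \<eta> (n + n0))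
        \<longlonglongrightarrow> integral\<^sup>L M (f' t)"
      by (simp only:)
    then show "((\<lambda>h. (integral\<^sup>L M (f (t + h)) - integral\<^sup>L M (f t)) /\<^sub>R h) \<circ> \<eta>)
        \<longlonglongrightarrow> integral\<^sup>L M (f' t)"
      unfolding comp_def by (rule LIMSEQ_offset[where k = n0])
  qed
  then show ?thesis
    by (simp add: has_vector_derivative_iff_tendsto)
qed

subsection \<open>Schwartz functions and modulated Gaussians\<close>

text \<open>The mean value bound handles small \<open>u\<close>, the supremum bound large
  \<open>u\<close>. Adding the two constants lets one factor serve both cases, in front of the
  weight that is integrable against both jump measures.\<close>

lemma norm_diff_le_min:
  fixes f :: "'a::euclidean_space \<Rightarrow> 'b::real_normed_vector"
  assumes deriv: "\<And>x. (f has_derivative D x) (at x)"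
    and D: "\<And>x v. norm (D x v) \<le> B * norm v" and f: "\<And>x. norm (f x) \<le> A"
  shows "norm (f (x + u) - f x) \<le> (2 * A + B) * min 1 (norm u)"
proof -
  have A: "0 \<le> A"
    using norm_ge_zero f by (rule order_trans)
  have "onorm (D x) \<le> B" for x
    by (rule onorm_le) (rule D)
  then have 1: "norm (f (x + u) - f x) \<le> B * norm (x + u - x)"
    by (intro differentiable_bound[of UNIV f D]) (use deriv in auto)
  have 2: "norm (f (x + u) - f x) \<le> 2 * A"
    using norm_triangle_ineq4[of "f (x + u)" "f x"] f[of "x + u"] f[of x] by linarith
  show ?thesis
  proof (cases "norm u \<le> 1")
    case True
    have "B * norm u \<le> (2 * A + B) * norm u"
      using A by (intro mult_right_mono) auto
    with True 1 show ?thesis by simp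
  next
    case False
    then have "0 < norm u" by linarith
    moreover have "0 \<le> B * norm u"
      by (rule order_trans[OF norm_ge_zero D])
    ultimately have "0 \<le> B"
      by (simp add: zero_le_mult_iff)
    with False 2 show ?thesis by simp
  qed
qed

text \<open>The seminorms of orders 0 and \<open>m\<close> together control the weight
  \<open>(1 + norm x) ^ m\<close>: it is at most \<open>2 ^ m\<close> in the unit ball and at most
  \<open>(2 * norm x) ^ m\<close> outside.\<close>

lemma schwartz_iterated_bound:
  assumes "schwartz f" "is \<in> lists Basis"
  obtains C where "0 \<le> C" "\<And>x. (1 + norm x) ^ m * \<bar>iterated_partial is f x\<bar> \<le> C"
proof -
  let ?h = "iterated_partial is f"
  have "bounded (range (\<lambda>x. norm x ^ 0 * ?h x))" "bounded (range (\<lambda>x. norm x ^ m * ?h x))"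
    using assms unfolding schwartz_def by blast+
  then obtain A B where A: "\<And>x. \<bar>?h x\<bar> \<le> A" and B: "\<And>x. norm x ^ m * \<bar>?h x\<bar> \<le> B"
    by (auto simp: bounded_iff abs_mult)
  have AB: "0 \<le> A" "0 \<le> B"
    using A[of 0] B[of 0] by (auto intro: order_trans[rotated])
  have "(1 + norm x) ^ m * \<bar>?h x\<bar> \<le> 2 ^ m * (A + B)" for x
  proof (cases "norm x \<le> 1")
    case True
    then have "(1 + norm x) ^ m * \<bar>?h x\<bar> \<le> 2 ^ m * A"
      by (intro mult_mono power_mono A) auto
    also have "\<dots> \<le> 2 ^ m * (A + B)" using AB by simp
    finally show ?thesis .
  next
    case False
    then have "(1 + norm x) ^ m * \<bar>?h x\<bar> \<le> (2 * norm x) ^ m * \<bar>?h x\<bar>"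
      by (intro mult_right_mono power_mono) auto
    also have "\<dots> = 2 ^ m * (norm x ^ m * \<bar>?h x\<bar>)"
      by (simp add: power_mult_distrib)
    also have "\<dots> \<le> 2 ^ m * (A + B)"
      using B[of x] AB by (intro mult_left_mono) auto
    finally show ?thesis .
  qed
  with AB show ?thesis
    by (intro that[of "2 ^ m * (A + B)"]) auto
qed

lemma schwartz_bound:
  assumes "schwartz f"
  obtains C where "0 \<le> C" "\<And>x. (1 + norm x) ^ m * \<bar>f x\<bar> \<le> C"
  using schwartz_iterated_bound[OF assms, of "[]"] by auto

lemma schwartz_has_derivative:
  assumes "schwartz f"
  shows "(f has_derivative (\<lambda>v. grad f x \<bullet> v)) (at x)"
proof -
  have "f differentiable (at x)"
    using assms unfolding schwartz_def by (auto dest!: bspec[of _ _ "[]"])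
  then have D: "(f has_derivative frechet_derivative f (at x)) (at x)"
    by (simp add: frechet_derivative_works)
  then interpret bounded_linear "frechet_derivative f (at x)"
    by (rule has_derivative_bounded_linear)
  have "frechet_derivative f (at x) v = grad f x \<bullet> v" for v
  proof -
    have "frechet_derivative f (at x) v = frechet_derivative f (at x) (\<Sum>i\<in>Basis. (v \<bullet> i) *\<^sub>R i)"
      by (simp add: euclidean_representation)
    also have "\<dots> = grad f x \<bullet> v"
      by (simp add: sum scale grad_def inner_sum_right inner_commute[of _ v] mult.commute)
    finally show ?thesis .
  qed
  then have "frechet_derivative f (at x) = (\<lambda>v. grad f x \<bullet> v)" by auto
  with D show ?thesis by simp
qed

lemma grad_eqI:
  assumes "(f has_derivative (\<lambda>v. w \<bullet> v)) (at x)"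
  shows "grad f x = w"
proof -
  have "frechet_derivative f (at x) i = w \<bullet> i" for i
    using fun_cong[OF frechet_derivative_at[OF assms], of i] by simp
  then show ?thesis by (simp add: grad_def euclidean_representation)
qed

lemma schwartz_grad_bound:
  assumes "schwartz f"
  obtains C where "0 \<le> C" "\<And>x. (1 + norm x) ^ m * norm (grad f x) \<le> C"
proof -
  have "\<exists>C. 0 \<le> C \<and> (\<forall>x. (1 + norm x) ^ m * \<bar>frechet_derivative f (at x) i\<bar> \<le> C)"
    if "i \<in> Basis" for i
    by (rule schwartz_iterated_bound[OF assms, of "[i]" m]) (use that in auto)
  then obtain C where C: "\<And>i. i \<in> Basis \<Longrightarrow> 0 \<le> C i"
    "\<And>i x. i \<in> Basis \<Longrightarrow> (1 + norm x) ^ m * \<bar>frechet_derivative f (at x) i\<bar> \<le> C i"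
    by metis
  have "(1 + norm x) ^ m * norm (grad f x) \<le> sum C Basis" for x
  proof -
    have "norm (grad f x) \<le> (\<Sum>i\<in>Basis. \<bar>frechet_derivative f (at x) i\<bar>)"
      unfolding grad_def by (intro order_trans[OF norm_sum]) simp
    then have "(1 + norm x) ^ m * norm (grad f x)
      \<le> (\<Sum>i\<in>Basis. (1 + norm x) ^ m * \<bar>frechet_derivative f (at x) i\<bar>)"
      unfolding sum_distrib_left[symmetric] by (intro mult_left_mono) auto
    also have "\<dots> \<le> sum C Basis"
      by (intro sum_mono C)
    finally show ?thesis .
  qed
  then show ?thesis
    by (intro that[of "sum C Basis"]) (auto intro: sum_nonneg C)
qed

lemma schwartz_continuous:
  assumes "schwartz f"
  shows "continuous_on UNIV f" "continuous_on UNIV (grad f)"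
proof -
  have "continuous_on UNIV (iterated_partial is f)" if "is \<in> lists Basis" for "is"
    using assms that unfolding schwartz_def
    by (intro differentiable_imp_continuous_on) (auto simp: differentiable_on_def)
  from this[of "[]"] this[of "[_]"] show "continuous_on UNIV f" "continuous_on UNIV (grad f)"
    unfolding grad_def by (auto intro!: continuous_intros)
qed

text \<open>Collects the constants used for test functions. The bound on
  \<open>norm x * norm (grad f x)\<close> is the one that makes \<open>X \<bullet> grad f X\<close>
  a bounded random variable.\<close>

lemma schwartz_bounds:
  assumes f: "schwartz f"
  obtains A C where "0 \<le> A" "0 \<le> C" "\<And>x. \<bar>f x\<bar> \<le> A" "\<And>x. norm (grad f x) \<le> C"
    "\<And>x. norm x * norm (grad f x) \<le> C"
    "\<And>x u. \<bar>f (x + u) - f x\<bar> \<le> (2 * A + C) * min 1 (norm u)"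
proof -
  obtain C where C: "0 \<le> C" "\<And>x. (1 + norm x) ^ 1 * norm (grad f x) \<le> C"
    using schwartz_grad_bound[OF f, of 1] by blast
  obtain A where A: "0 \<le> A" "\<And>x. (1 + norm x) ^ 0 * \<bar>f x\<bar> \<le> A"
    using schwartz_bound[OF f, of 0] by blast
  have grad: "norm (grad f x) \<le> C" "norm x * norm (grad f x) \<le> C" for x
  proof -
    have "0 \<le> norm (grad f x)" "0 \<le> norm x * norm (grad f x)" by simp_all
    with C(2)[of x] show "norm (grad f x) \<le> C" "norm x * norm (grad f x) \<le> C"
      unfolding power_one_right distrib_right mult_1 by linarith+
  qed
  have "norm (f (x + u) - f x) \<le> (2 * A + C) * min 1 (norm u)" for x u
  proof (rule norm_diff_le_min)
    show "(f has_derivative (\<lambda>v. grad f x \<bullet> v)) (at x)" for x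
      by (rule schwartz_has_derivative[OF f])
    show "norm (grad f x \<bullet> v) \<le> C * norm v" for x v
      using Cauchy_Schwarz_ineq2[of "grad f x" v] mult_right_mono[OF grad(1)[of x], of "norm v"]
      by simp
    show "norm (f x) \<le> A" for x using A(2)[of x] by simp
  qed
  with A C grad show ?thesis by (intro that[of A C]) auto
qed

section \<open>Polynomials and trigonometric functions damped by a Gaussian\<close>

lemma power_le_exp:
  fixes y :: real
  assumes "0 \<le> y"
  shows "y ^ n \<le> real n ^ n * exp y"
proof (cases "n = 0")
  case False
  \<comment> \<open>Dividing by \<open>n\<close> first makes the right side exactly
    \<open>exp y\<close>; this is the origin of the constant \<open>n ^ n\<close>.\<close>
  have "(y / n) ^ n \<le> exp (y / n) ^ n"
  proof (rule power_mono)
    show "y / n \<le> exp (y / n)"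
      using exp_ge_add_one_self[of "y / n"] by linarith
  qed (use assms in simp)
  also have "\<dots> = exp y"
    using False by (simp add: exp_of_nat_mult[symmetric])
  finally show ?thesis
    using False by (simp add: power_divide field_simps)
qed (use assms in simp)

lemma power_gauss_bounded:
  assumes "0 < \<epsilon>"
  obtains C where "0 \<le> C" "\<And>x::'a::real_inner. (1 + norm x) ^ n * exp (- \<epsilon> * (x \<bullet> x)) \<le> C"
proof -
  \<comment> \<open>\<open>4 ^ n\<close> comes from
    \<open>1 + norm x \<le> 4 * max 1 (x \<bullet> x)\<close>. The two summands account for
    \<open>1\<close> and \<open>(x \<bullet> x) ^ n\<close>, the latter by
    \<open>power_le_exp\<close> at \<open>\<epsilon> * (x \<bullet> x)\<close>.\<close>
  define C where "C = 4 ^ n * (1 + real n ^ n / \<epsilon> ^ n)"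
  have "(1 + norm x) ^ n * exp (- \<epsilon> * (x \<bullet> x)) \<le> C" for x :: 'a
  proof -
    have "1 + norm x \<le> 2 * max 1 (norm x)" by auto
    also have "norm x \<le> max 1 (x \<bullet> x)"
    proof (cases "norm x \<le> 1")
      case False
      then have "norm x * 1 \<le> norm x * norm x"
        by (intro mult_left_mono) auto
      then show ?thesis
        by (simp add: power2_norm_eq_inner[symmetric] power2_eq_square)
    qed simp
    also have "2 * max 1 (max 1 (x \<bullet> x)) \<le> 4 * max 1 (x \<bullet> x)" by (simp add: max_def)
    finally have "(1 + norm x) ^ n \<le> (4 * max 1 (x \<bullet> x)) ^ n"
      by (intro power_mono) auto
    also have "\<dots> = 4 ^ n * max 1 (x \<bullet> x) ^ n"
      by (simp add: power_mult_distrib)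
    also have "max 1 (x \<bullet> x) ^ n \<le> 1 + (x \<bullet> x) ^ n"
      by (cases "x \<bullet> x \<le> 1") (auto simp: max_def)
    finally have 1: "(1 + norm x) ^ n \<le> 4 ^ n * (1 + (x \<bullet> x) ^ n)" by simp
    have "(\<epsilon> * (x \<bullet> x)) ^ n \<le> real n ^ n * exp (\<epsilon> * (x \<bullet> x))"
      using assms by (intro power_le_exp) auto
    then have "(x \<bullet> x) ^ n \<le> real n ^ n / \<epsilon> ^ n * exp (\<epsilon> * (x \<bullet> x))"
      using assms by (simp add: power_mult_distrib field_simps)
    moreover have "1 \<le> exp (\<epsilon> * (x \<bullet> x))"
      using assms by simp
    ultimately have "1 + (x \<bullet> x) ^ n \<le> (1 + real n ^ n / \<epsilon> ^ n) * exp (\<epsilon> * (x \<bullet> x))"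
      unfolding distrib_right by linarith
    then have "4 ^ n * (1 + (x \<bullet> x) ^ n) \<le> C * exp (\<epsilon> * (x \<bullet> x))"
      unfolding C_def by (simp add: mult.assoc)
    with 1 have "(1 + norm x) ^ n \<le> C * exp (\<epsilon> * (x \<bullet> x))" by linarith
    then show ?thesis by (simp add: exp_minus field_simps)
  qed
  moreover have "0 \<le> C" unfolding C_def using assms by simp
  ultimately show ?thesis by (rule that[rotated])
qed

text \<open>The span, closed under differentiation, of polynomials times a modulated Gaussian.\<close>

inductive gauss_trig :: "real \<Rightarrow> 'a \<Rightarrow> ('a::euclidean_space \<Rightarrow> real) \<Rightarrow> bool" for \<epsilon> \<xi> where
  cos: "gauss_trig \<epsilon> \<xi> (\<lambda>x. cos (\<xi> \<bullet> x) * exp (- \<epsilon> * (x \<bullet> x)))"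
| sin: "gauss_trig \<epsilon> \<xi> (\<lambda>x. sin (\<xi> \<bullet> x) * exp (- \<epsilon> * (x \<bullet> x)))"
| add: "gauss_trig \<epsilon> \<xi> f \<Longrightarrow> gauss_trig \<epsilon> \<xi> g \<Longrightarrow> gauss_trig \<epsilon> \<xi> (\<lambda>x. f x + g x)"
| scale: "gauss_trig \<epsilon> \<xi> f \<Longrightarrow> gauss_trig \<epsilon> \<xi> (\<lambda>x. c * f x)"
| mult: "gauss_trig \<epsilon> \<xi> f \<Longrightarrow> gauss_trig \<epsilon> \<xi> (\<lambda>x. (x \<bullet> j) * f x)"

text \<open>Differentiating one of the two generators gives a multiple of the other and a coordinate
  factor times itself, which explains the closure rules of the class. The directional derivative is
  a member once the direction \<open>v\<close> is fixed.\<close>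

lemma gauss_trig_derivative:
  assumes "gauss_trig \<epsilon> \<xi> f"
  shows "\<exists>D. (\<forall>x. (f has_derivative D x) (at x)) \<and> (\<forall>v. gauss_trig \<epsilon> \<xi> (\<lambda>x. D x v))"
  using assms
proof induction
  case cos
  have D: "((\<lambda>x. cos (\<xi> \<bullet> x) * exp (- \<epsilon> * (x \<bullet> x))) has_derivative
     (\<lambda>v. (- (\<xi> \<bullet> v)) * (sin (\<xi> \<bullet> x) * exp (- \<epsilon> * (x \<bullet> x)))
        + (- 2 * \<epsilon>) * ((x \<bullet> v) * (cos (\<xi> \<bullet> x) * exp (- \<epsilon> * (x \<bullet> x)))))) (at x)" for x
    by (auto intro!: derivative_eq_intros simp: inner_commute algebra_simps)
  show ?case
    by (intro exI conjI allI, rule D)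
       (intro gauss_trig.add gauss_trig.scale gauss_trig.mult gauss_trig.cos gauss_trig.sin)
next
  case sin
  have D: "((\<lambda>x. sin (\<xi> \<bullet> x) * exp (- \<epsilon> * (x \<bullet> x))) has_derivative
     (\<lambda>v. (\<xi> \<bullet> v) * (cos (\<xi> \<bullet> x) * exp (- \<epsilon> * (x \<bullet> x)))
        + (- 2 * \<epsilon>) * ((x \<bullet> v) * (sin (\<xi> \<bullet> x) * exp (- \<epsilon> * (x \<bullet> x)))))) (at x)" for x
    by (auto intro!: derivative_eq_intros simp: inner_commute algebra_simps)
  show ?case
    by (intro exI conjI allI, rule D)
       (intro gauss_trig.add gauss_trig.scale gauss_trig.mult gauss_trig.cos gauss_trig.sin)
next
  case (add f g)
  then obtain D E where "\<And>x. (f has_derivative D x) (at x)" "\<And>v. gauss_trig \<epsilon> \<xi> (\<lambda>x. D x v)"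
    "\<And>x. (g has_derivative E x) (at x)" "\<And>v. gauss_trig \<epsilon> \<xi> (\<lambda>x. E x v)" by metis
  then show ?case
    by (intro exI[of _ "\<lambda>x v. D x v + E x v"]) (auto intro: has_derivative_add gauss_trig.add)
next
  case (scale f c)
  then obtain D where "\<And>x. (f has_derivative D x) (at x)" "\<And>v. gauss_trig \<epsilon> \<xi> (\<lambda>x. D x v)"
    by metis
  then show ?case
    by (intro exI[of _ "\<lambda>x v. c * D x v"]) (auto intro: has_derivative_mult_right gauss_trig.scale)
next
  case (mult f j)
  then obtain D where D: "\<And>x. (f has_derivative D x) (at x)" "\<And>v. gauss_trig \<epsilon> \<xi> (\<lambda>x. D x v)"
    by metis
  have "((\<lambda>x. (x \<bullet> j) * f x) has_derivative (\<lambda>v. (x \<bullet> j) * D x v + (v \<bullet> j) * f x)) (at x)" for x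
    by (auto intro!: derivative_eq_intros D(1))
  with D(2) mult(1) show ?case
    by (intro exI[of _ "\<lambda>x v. (x \<bullet> j) * D x v + (v \<bullet> j) * f x"])
      (auto intro!: gauss_trig.add[OF gauss_trig.mult gauss_trig.scale])
qed

text \<open>The degree is tracked crudely: sums add degrees, each coordinate factor costs one. Any
  polynomial degree is beaten by the Gaussian through \<open>power_gauss_bounded\<close>.\<close>

lemma gauss_trig_bound:
  assumes "gauss_trig \<epsilon> \<xi> f"
  shows "\<exists>C n. \<forall>x. \<bar>f x\<bar> \<le> C * ((1 + norm x) ^ n * exp (- \<epsilon> * (x \<bullet> x)))"
  using assms
proof induction
  case cos
  show ?case
    by (intro exI[of _ 1] exI[of _ 0]) (auto simp: abs_mult mult_left_le_one_le)
next
  case sin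
  show ?case
    by (intro exI[of _ 1] exI[of _ 0]) (auto simp: abs_mult mult_left_le_one_le)
next
  case (add f g)
  then obtain C m D n where
    f: "\<And>x. \<bar>f x\<bar> \<le> C * ((1 + norm x) ^ m * exp (- \<epsilon> * (x \<bullet> x)))" and
    g: "\<And>x. \<bar>g x\<bar> \<le> D * ((1 + norm x) ^ n * exp (- \<epsilon> * (x \<bullet> x)))" by metis
  \<comment> \<open>At the origin the weight and the Gaussian both equal 1, so the bounds force
    nonnegative constants.\<close>
  have CD: "0 \<le> C" "0 \<le> D"
    using f[of 0] g[of 0] by auto
  have "\<bar>f x + g x\<bar> \<le> (C + D) * ((1 + norm x) ^ (m + n) * exp (- \<epsilon> * (x \<bullet> x)))" for x
  proof -
    have "C * ((1 + norm x) ^ m * exp (- \<epsilon> * (x \<bullet> x)))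
        \<le> C * ((1 + norm x) ^ (m + n) * exp (- \<epsilon> * (x \<bullet> x)))"
      "D * ((1 + norm x) ^ n * exp (- \<epsilon> * (x \<bullet> x)))
        \<le> D * ((1 + norm x) ^ (m + n) * exp (- \<epsilon> * (x \<bullet> x)))"
      using CD by (auto intro!: mult_left_mono mult_right_mono power_increasing)
    with f[of x] g[of x] show ?thesis
      by (simp only: distrib_right)
  qed
  then show ?case by blast
next
  case (scale f c)
  then obtain C m where f: "\<And>x. \<bar>f x\<bar> \<le> C * ((1 + norm x) ^ m * exp (- \<epsilon> * (x \<bullet> x)))"
    by metis
  have "\<bar>c * f x\<bar> \<le> (\<bar>c\<bar> * C) * ((1 + norm x) ^ m * exp (- \<epsilon> * (x \<bullet> x)))" for x
    using mult_left_mono[OF f[of x], of "\<bar>c\<bar>"] by (simp add: abs_mult mult.assoc)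
  then show ?case by blast
next
  case (mult f j)
  then obtain C m where f: "\<And>x. \<bar>f x\<bar> \<le> C * ((1 + norm x) ^ m * exp (- \<epsilon> * (x \<bullet> x)))"
    by metis
  have "\<bar>(x \<bullet> j) * f x\<bar> \<le> (norm j * C) * ((1 + norm x) ^ Suc m * exp (- \<epsilon> * (x \<bullet> x)))" for x
  proof -
    have "\<bar>x \<bullet> j\<bar> \<le> norm x * norm j" by (rule Cauchy_Schwarz_ineq2)
    also have "\<dots> \<le> (1 + norm x) * norm j" by (intro mult_right_mono) auto
    finally have "\<bar>(x \<bullet> j) * f x\<bar>
        \<le> ((1 + norm x) * norm j) * (C * ((1 + norm x) ^ m * exp (- \<epsilon> * (x \<bullet> x))))"
      unfolding abs_mult by (intro mult_mono f) auto
    then show ?thesis by (simp add: ac_simps)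
  qed
  then show ?case by blast
qed

text \<open>All iterated partial derivatives stay in the class, so one decay estimate for its
  members covers every seminorm.\<close>

lemma gauss_trig_schwartz:
  assumes "0 < \<epsilon>" "gauss_trig \<epsilon> \<xi> f"
  shows "schwartz f"
proof -
  have "gauss_trig \<epsilon> \<xi> (iterated_partial is f)" for "is"
  proof (induction "is")
    case (Cons i "is")
    then obtain D where D: "\<And>x. (iterated_partial is f has_derivative D x) (at x)"
      and D': "\<And>v. gauss_trig \<epsilon> \<xi> (\<lambda>x. D x v)"
      using gauss_trig_derivative by metis
    show ?case
      using D'[of i] by (simp add: frechet_derivative_at[OF D, symmetric])
  qed (use assms in simp)
  moreover have "h differentiable (at x)" if "gauss_trig \<epsilon> \<xi> h" for h x
    using gauss_trig_derivative[OF that] by (auto simp: differentiable_def)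
  moreover have "bounded (range (\<lambda>x. norm x ^ m * h x))" if "gauss_trig \<epsilon> \<xi> h" for h m
  proof -
    from gauss_trig_bound[OF that] obtain C n where
      C: "\<And>x. \<bar>h x\<bar> \<le> C * ((1 + norm x) ^ n * exp (- \<epsilon> * (x \<bullet> x)))" by metis
    have C0: "0 \<le> C" using C[of 0] by auto
    obtain B where B: "\<And>x::'a. (1 + norm x) ^ (m + n) * exp (- \<epsilon> * (x \<bullet> x)) \<le> B"
      using power_gauss_bounded[OF assms(1)] by metis
    have "norm (norm x ^ m * h x) \<le> C * B" for x
    proof -
      have "norm (norm x ^ m * h x)
          \<le> (1 + norm x) ^ m * (C * ((1 + norm x) ^ n * exp (- \<epsilon> * (x \<bullet> x))))"
        unfolding real_norm_def abs_mult power_abs abs_norm_cancel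
        by (intro mult_mono C) (auto intro: power_mono)
      also have "\<dots> = C * ((1 + norm x) ^ (m + n) * exp (- \<epsilon> * (x \<bullet> x)))"
        by (simp add: power_add)
      also have "\<dots> \<le> C * B"
        using C0 B by (intro mult_left_mono)
      finally show ?thesis .
    qed
    then show ?thesis by (auto simp: bounded_iff)
  qed
  ultimately show ?thesis unfolding schwartz_def by blast
qed

subsection \<open>The standard Gaussian measure and the exponential integral\<close>

text \<open>The comparison function is the product of
  \<open>1 / (1 + (x \<bullet> b)\<^sup>2)\<close> over the basis, integrable by Fubini in
  coordinates. Each of the \<open>DIM('a)\<close> factors \<open>1 + (x \<bullet> b)\<^sup>2\<close>
  is at most \<open>(1 + norm x)\<^sup>2\<close>, hence the exponent.\<close>

lemma integrable_lborel_decay: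
  fixes f :: "'a::euclidean_space \<Rightarrow> 'b::{banach, second_countable_topology}"
  assumes [measurable]: "f \<in> borel_measurable borel"
    and bound: "\<And>x. (1 + norm x) ^ (2 * DIM('a)) * norm (f x) \<le> C"
  shows "integrable lborel f"
proof -
  interpret product_sigma_finite "\<lambda>_::'a. lborel :: real measure" ..
  have "set_integrable lborel (einterval (-\<infinity>) \<infinity>) (\<lambda>x. inverse (1 + x\<^sup>2))"
    by (rule integrable_inverse_1_plus_square)
  then have "integrable (\<Pi>\<^sub>M b\<in>(Basis::'a set). lborel) (\<lambda>x. \<Prod>b\<in>Basis. inverse (1 + (x b)\<^sup>2) :: real)"
    by (intro product_integrable_prod) (auto simp: set_integrable_def)
  then have *: "integrable lborel (\<lambda>x::'a. \<Prod>b\<in>Basis. inverse (1 + (x \<bullet> b)\<^sup>2))"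
    by (subst lborel_eq) (simp add: integrable_distr_eq)
  show ?thesis
  proof (rule Bochner_Integration.integrable_bound)
    show "integrable lborel (\<lambda>x::'a. C * (\<Prod>b\<in>Basis. inverse (1 + (x \<bullet> b)\<^sup>2)))"
      using * by simp
    show "AE x in lborel. norm (f x) \<le> norm (C * (\<Prod>b\<in>Basis. inverse (1 + (x \<bullet> b)\<^sup>2)))"
    proof (rule AE_I2)
      fix x :: 'a
      let ?P = "\<Prod>b\<in>Basis. (1 + (x \<bullet> b)\<^sup>2)"
      have P: "0 < ?P" by (intro prod_pos) (auto intro: add_pos_nonneg)
      have "?P \<le> (\<Prod>b\<in>(Basis::'a set). (1 + norm x)\<^sup>2)"
      proof (intro prod_mono conjI)
        fix b :: 'a assume "b \<in> Basis"
        then have "(x \<bullet> b)\<^sup>2 \<le> (norm x)\<^sup>2"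
          using Basis_le_norm[of b x] by (simp add: abs_le_square_iff[symmetric])
        then show "1 + (x \<bullet> b)\<^sup>2 \<le> (1 + norm x)\<^sup>2"
          by (simp add: power2_sum) (use norm_ge_zero[of x] in linarith)
      qed auto
      then have "?P * norm (f x) \<le> (1 + norm x) ^ (2 * DIM('a)) * norm (f x)"
        by (intro mult_right_mono) (auto simp: power_mult)
      then have "?P * norm (f x) \<le> C"
        using bound[of x] by linarith
      then have "norm (f x) \<le> C * inverse ?P"
        using P by (simp add: field_simps)
      then show "norm (f x) \<le> norm (C * (\<Prod>b\<in>Basis. inverse (1 + (x \<bullet> b)\<^sup>2)))"
        by (simp add: prod_inversef[symmetric])
    qed
  qed simp
qed

text \<open>Independent coordinates make the characteristic function factor. This measure lives on
  frequencies; the mollifying kernel is its characteristic function.\<close>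

definition std_gauss :: "'a::euclidean_space measure" where
  "std_gauss = distr (\<Pi>\<^sub>M b\<in>Basis. std_normal_distribution) borel (\<lambda>f. \<Sum>b\<in>Basis. f b *\<^sub>R b)"

lemma sets_std_gauss [measurable_cong, simp]: "sets std_gauss = sets borel"
  and space_std_gauss [simp]: "space std_gauss = UNIV"
  by (simp_all add: std_gauss_def)

lemma prob_space_std_gauss: "prob_space (std_gauss :: 'a::euclidean_space measure)"
proof -
  interpret N: real_distribution std_normal_distribution
    by (rule real_dist_normal_dist)
  interpret product_prob_space "\<lambda>_::'a. std_normal_distribution" ..
  show ?thesis
    unfolding std_gauss_def
    by (intro prob_space.prob_space_distr prob_space_PiM N.prob_space_axioms) measurable
qed

text \<open>Fubini reduces the claim to one coordinate. Read from right to left, it expresses the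
  Gaussian kernel as an average of characters.\<close>

lemma char_std_gauss:
  fixes x :: "'a::euclidean_space"
  shows "(CLINT z|std_gauss. iexp (z \<bullet> x)) = complex_of_real (exp (- (x \<bullet> x) / 2))"
proof -
  interpret N: real_distribution std_normal_distribution
    by (rule real_dist_normal_dist)
  interpret product_prob_space "\<lambda>_::'a. std_normal_distribution" ..
  have "(CLINT z|std_gauss. iexp (z \<bullet> x))
    = (CLINT f|(\<Pi>\<^sub>M b\<in>Basis. std_normal_distribution). iexp ((\<Sum>b\<in>Basis. f b *\<^sub>R b) \<bullet> x))"
    unfolding std_gauss_def by (subst integral_distr) auto
  also have "\<dots> = (CLINT f|(\<Pi>\<^sub>M b\<in>Basis. std_normal_distribution).
      (\<Prod>b\<in>Basis. iexp (f b * (b \<bullet> x))))"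
    by (simp add: inner_sum_left sum_distrib_left exp_sum)
  also have "\<dots> = (\<Prod>b\<in>Basis. CLINT t|std_normal_distribution. iexp (t * (b \<bullet> x)))"
    by (intro product_integral_prod N.integrable_const_bound[where B=1]) auto
  also have "\<dots> = (\<Prod>b\<in>Basis. complex_of_real (exp (- (b \<bullet> x)\<^sup>2 / 2)))"
    using fun_cong[OF char_std_normal_distribution, of "_ \<bullet> x"]
    by (simp only: char_def mult.commute[of _ "_ \<bullet> x"])
  also have "\<dots> = complex_of_real (exp (\<Sum>b\<in>Basis. - (b \<bullet> x)\<^sup>2 / 2))"
    by (simp add: exp_sum)
  also have "(\<Sum>b\<in>Basis. - (b \<bullet> x)\<^sup>2 / 2) = - (x \<bullet> x) / 2"
    by (subst (2) euclidean_inner)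
       (simp add: sum_divide_distrib sum_negf inner_commute power2_eq_square)
  finally show ?thesis .
qed

text \<open>Differentiating a character brings down one factor of the frequency; this moment
  dominates the differentiated integrals.\<close>

lemma integrable_std_gauss_norm: "integrable (std_gauss :: 'a::euclidean_space measure) norm"
proof -
  interpret N: real_distribution std_normal_distribution
    by (rule real_dist_normal_dist)
  interpret product_prob_space "\<lambda>_::'a. std_normal_distribution" ..
  have "integrable (\<Pi>\<^sub>M b\<in>(Basis::'a set). std_normal_distribution) (\<lambda>f. \<bar>f b\<bar>)"
    if b: "b \<in> Basis" for b :: 'a
  proof -
    have "integrable (distr (\<Pi>\<^sub>M b\<in>(Basis::'a set). std_normal_distribution)
        std_normal_distribution (\<lambda>f. f b)) abs"
      using integrable_std_normal_distribution_moment[of 1] b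
      by (subst distr_PiM_component) (auto intro: N.prob_space_axioms)
    moreover have "(\<lambda>f. f b) \<in> (\<Pi>\<^sub>M b\<in>(Basis::'a set). std_normal_distribution)
        \<rightarrow>\<^sub>M std_normal_distribution"
      using b by (rule measurable_component_singleton)
    ultimately show ?thesis
      by (simp add: integrable_distr_eq)
  qed
  then have "integrable (\<Pi>\<^sub>M b\<in>(Basis::'a set). std_normal_distribution) (\<lambda>f. \<Sum>b\<in>Basis. \<bar>f b\<bar>)"
    by (intro Bochner_Integration.integrable_sum)
  then have "integrable std_gauss (\<lambda>z::'a. \<Sum>b\<in>Basis. \<bar>z \<bullet> b\<bar>)"
    unfolding std_gauss_def
    by (subst integrable_distr_eq) simp_all
  then show ?thesis
    by (rule Bochner_Integration.integrable_bound) (auto simp: norm_le_l1 intro!: AE_I2)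
qed

text \<open>\<open>expint z\<close> is the integral of \<open>(exp (\<i>w) - 1) / w\<close> from \<open>0\<close> to \<open>z\<close>.\<close>

definition expint :: "real \<Rightarrow> complex" where
  "expint z = (CLINT s|lborel. indicator {0<..<1} s *\<^sub>R ((iexp (s * z) - 1) / s))"

lemma norm_iexp_diff_one_le: "norm (iexp y - 1) \<le> \<bar>y\<bar>"
  using iexp_approx1[of y 0] by (simp add: norm_minus_commute)

lemma norm_iexp_diff_one_le_2: "norm (iexp y - 1) \<le> 2"
  using norm_triangle_ineq4[of "iexp y" 1] by simp

lemma has_vector_derivative_iexp:
  assumes "(g has_real_derivative g') (at t within A)"
  shows "((\<lambda>t. iexp (g t)) has_vector_derivative \<i> * g' * iexp (g t)) (at t within A)"
proof -
  have "((\<lambda>t. complex_of_real (g t)) has_vector_derivative of_real g') (at t within A)"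
    using assms by (intro has_vector_derivative_of_real) (simp add: has_real_derivative_iff_has_vector_derivative)
  moreover have "((\<lambda>w. exp (\<i> * w)) has_field_derivative \<i> * exp (\<i> * w)) (at w within B)" for w B
    by (auto intro!: derivative_eq_intros)
  ultimately have "((\<lambda>w. exp (\<i> * w)) \<circ> (\<lambda>t. complex_of_real (g t)) has_vector_derivative
      of_real g' * (\<i> * iexp (g t))) (at t within A)"
    by (rule field_vector_diff_chain_within)
  then show ?thesis
    by (simp add: comp_def ac_simps)
qed

lemma integrable_expint:
  "integrable lborel (\<lambda>s. indicator {0<..<1} s *\<^sub>R ((iexp (s * z) - 1) / complex_of_real s))"
proof (rule Bochner_Integration.integrable_bound)
  show "integrable lborel (\<lambda>s::real. indicator {0<..<1} s *\<^sub>R \<bar>z\<bar> :: real)"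
    by (intro integrable_scaleR_left integrable_real_indicator) auto
  have "norm (indicator {0<..<1} s *\<^sub>R ((iexp (s * z) - 1) / complex_of_real s))
      \<le> norm (indicator {0<..<1} s *\<^sub>R \<bar>z\<bar> :: real)" for s
    using norm_iexp_diff_one_le[of "s * z"]
    by (auto simp: norm_divide abs_mult field_simps split: split_indicator)
  then show "AE s in lborel. norm (indicator {0<..<1} s *\<^sub>R ((iexp (s * z) - 1) / complex_of_real s))
      \<le> norm (indicator {0<..<1} s *\<^sub>R \<bar>z\<bar> :: real)"
    by simp
qed simp

text \<open>Differentiation under the integral cancels the denominator \<open>s\<close>. Multiplying
  by \<open>z\<close> then makes the integrand the derivative of \<open>iexp (s * z)\<close> in
  \<open>s\<close>. The product form of the claim remains valid at \<open>z = 0\<close>.\<close>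

lemma expint_has_vector_derivative:
  "\<exists>D. (expint has_vector_derivative D) (at z) \<and> of_real z * D = iexp z - 1"
proof -
  define D where "D = (CLINT s|lborel. indicator {0<..<1} s *\<^sub>R (\<i> * iexp (s * z)))"
  have D: "(expint has_vector_derivative D) (at z)"
    unfolding expint_def[abs_def] D_def
  proof (rule has_vector_derivative_Bochner_integral[where S = UNIV
        and f = "\<lambda>z s. indicator {0<..<1} s *\<^sub>R ((iexp (s * z) - 1) / complex_of_real s)"
        and f' = "\<lambda>z s. indicator {0<..<1} s *\<^sub>R (\<i> * iexp (s * z))"
        and w = "indicator {0<..<1}"])
    show "((\<lambda>z. indicator {0<..<1} s *\<^sub>R ((iexp (s * z) - 1) / complex_of_real s)) has_vector_derivative
        indicator {0<..<1} s *\<^sub>R (\<i> * iexp (s * z))) (at z)" for z s :: real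
    proof (cases "s \<in> {0<..<1}")
      case True
      then have "((\<lambda>z. (iexp (s * z) - 1) / complex_of_real s) has_vector_derivative
        (\<i> * s * iexp (s * z)) / s) (at z)"
        using has_vector_derivative_iexp[of "\<lambda>z. s * z" s z UNIV]
        by (intro has_vector_derivative_divide) (auto simp: has_vector_derivative_diff_const intro!: derivative_eq_intros)
      with True show ?thesis by simp
    qed simp
    show "norm (indicator {0<..<1} s *\<^sub>R (\<i> * iexp (s * z))) \<le> indicator {0<..<1} s" for z s :: real
      by (simp add: norm_mult)
  qed (use integrable_expint in auto)
  have "of_real z * D = iexp z - 1"
  proof -
    have "of_real z * D = (CLINT s|lborel. of_real z * (indicator {0<..<1} s *\<^sub>R (\<i> * iexp (s * z))))"
      unfolding D_def by (rule integral_mult_right_zero[symmetric])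
    \<comment> \<open>The end points are null; the closed interval is the form that the fundamental
      theorem of calculus expects.\<close>
    also have "\<dots> = (CLINT s|lborel. indicator {0..1} s *\<^sub>R (\<i> * z * iexp (s * z)))"
    proof (rule integral_cong_AE)
      have "AE s in lborel. s \<noteq> 0 \<and> s \<noteq> (1::real)"
        using AE_lborel_singleton[of 0] AE_lborel_singleton[of 1] by auto
      then show "AE s in lborel. of_real z * (indicator {0<..<1} s *\<^sub>R (\<i> * iexp (s * z)))
          = indicator {0..1} s *\<^sub>R (\<i> * z * iexp (s * z))"
        by eventually_elim (auto split: split_indicator)
    qed auto
    also have "\<dots> = iexp (1 * z) - iexp (0 * z)"
      by (intro integral_FTC_atLeastAtMost has_vector_derivative_iexp)
         (auto intro!: derivative_eq_intros continuous_intros)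
    finally show ?thesis by simp
  qed
  with D show ?thesis by blast
qed

subsection \<open>Polar decompositions\<close>

lemma sets_neg_stieltjes [measurable_cong, simp]: "sets (neg_stieltjes h) = sets borel"
  and space_neg_stieltjes [simp]: "space (neg_stieltjes h) = UNIV"
  by (simp_all add: neg_stieltjes_def)

lemma AE_neg_stieltjes_pos: "AE r in neg_stieltjes h. 0 < r"
  by (rule AE_I[of _ _ "{..0}"]) (auto simp: emeasure_neg_stieltjes_nonpos not_less)

text \<open>\<open>h\<close> may be unbounded at 0, so the total mass can be infinite. Intervals
  \<open>{a<..b}\<close> with \<open>0 < a\<close> have the finite mass \<open>h a - h b\<close>,
  and the nonpositive reals are null.\<close>

lemma sigma_finite_neg_stieltjes:
  assumes "antimono_on {0<..} h" "continuous_on {0<..} h"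
  shows "sigma_finite_measure (neg_stieltjes h)"
proof
  let ?I = "\<lambda>n::nat. {inverse (Suc n)<..real (Suc n)}"
  have "x \<in> {..0} \<or> (\<exists>n. x \<in> ?I n)" for x :: real
  proof (cases "x \<le> 0")
    case False
    then obtain m where m: "inverse (Suc m) < x"
      using reals_Archimedean[of x] by auto
    obtain n where n: "x \<le> real n"
      using real_arch_simple by blast
    have "inverse (Suc (m + n)) \<le> inverse (real (Suc m))"
      by (intro le_imp_inverse_le) auto
    then have "inverse (real (Suc (m + n))) < x"
      using m by (rule order.strict_trans1)
    with n have "x \<in> ?I (m + n)" by simp
    then show ?thesis by blast
  qed simp
  then have "\<Union>(insert {..0} (range ?I)) = UNIV"
    by blast
  moreover have "emeasure (neg_stieltjes h) (?I n) \<noteq> \<infinity>" for n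
  proof -
    have "inverse (real (Suc n)) \<le> 1" by (simp add: inverse_le_1_iff)
    also have "1 \<le> real (Suc n)" by simp
    finally show ?thesis
      by (subst emeasure_neg_stieltjes_Ioc) (auto simp: assms)
  qed
  ultimately show "\<exists>A. countable A \<and> A \<subseteq> sets (neg_stieltjes h) \<and> \<Union>A = space (neg_stieltjes h)
      \<and> (\<forall>a\<in>A. emeasure (neg_stieltjes h) a \<noteq> \<infinity>)"
    by (intro exI[of _ "insert {..0} (range ?I)"]) (auto simp: emeasure_neg_stieltjes_nonpos)
qed

text \<open>Continuity from below along \<open>{r<..r + n}\<close>; the vanishing of
  \<open>h\<close> at infinity turns the difference of two values into \<open>h r\<close>.\<close>

lemma emeasure_neg_stieltjes_Ioi:
  assumes anti: "antimono_on {0<..} h" and cont: "continuous_on {0<..} h"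
    and lim: "(h \<longlongrightarrow> 0) at_top" and r: "0 < r"
  shows "emeasure (neg_stieltjes h) {r<..} = ennreal (h r)"
proof -
  have "(\<lambda>n. emeasure (neg_stieltjes h) {r<..r + real n}) \<longlonglongrightarrow>
      emeasure (neg_stieltjes h) (\<Union>n. {r<..r + real n})"
    by (rule Lim_emeasure_incseq) (auto simp: incseq_def)
  also have "(\<Union>n. {r<..r + real n}) = {r<..}"
  proof -
    have "\<exists>n. x \<le> r + real n" for x
      using real_arch_simple[of "x - r"] by (auto simp: algebra_simps)
    then show ?thesis by auto
  qed
  also have "(\<lambda>n. emeasure (neg_stieltjes h) {r<..r + real n}) = (\<lambda>n. ennreal (h r - h (r + real n)))"
    using r by (intro ext emeasure_neg_stieltjes_Ioc anti cont) auto
  finally have 1: "(\<lambda>n. ennreal (h r - h (r + real n))) \<longlonglongrightarrow> emeasure (neg_stieltjes h) {r<..}" .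
  have "filterlim (\<lambda>n. r + real n) at_top sequentially"
    by (intro filterlim_tendsto_add_at_top[OF tendsto_const] filterlim_real_sequentially)
  then have "(\<lambda>n. h (r + real n)) \<longlonglongrightarrow> 0"
    by (rule filterlim_compose[OF lim])
  then have "(\<lambda>n. ennreal (h r - h (r + real n))) \<longlonglongrightarrow> ennreal (h r - 0)"
    by (intro tendsto_intros)
  then show ?thesis
    using LIMSEQ_unique[OF 1] by simp
qed

lemma space_sphere_measure:
  "sets \<sigma> = sets (restrict_space borel (sphere 0 1)) \<Longrightarrow> space \<sigma> = sphere 0 1"
  by (drule sets_eq_imp_space_eq) (simp add: space_restrict_space)

lemma borel_measurable_sphere_continuous:
  assumes "sets \<sigma> = sets (restrict_space borel (sphere 0 1))" "continuous_on (sphere 0 1) h"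
  shows "h \<in> borel_measurable \<sigma>"
  using borel_measurable_continuous_on_restrict[OF assms(2)]
  by (simp cong: measurable_cong_sets add: assms(1))

section \<open>Measurable dependence of the Stieltjes measures on the direction\<close>

context
  fixes \<sigma> :: "'a::euclidean_space measure" and k :: "'a \<Rightarrow> real \<Rightarrow> real"
  assumes sets_\<sigma>: "sets \<sigma> = sets (restrict_space borel (sphere 0 1))"
    and k_nonneg: "\<And>x r. x \<in> sphere 0 1 \<Longrightarrow> 0 < r \<Longrightarrow> 0 \<le> k x r"
    and k_cont: "\<And>x. x \<in> sphere 0 1 \<Longrightarrow> continuous_on {0<..} (k x)"
    and k_anti: "\<And>x. x \<in> sphere 0 1 \<Longrightarrow> antimono_on {0<..} (k x)"
    and k_cont_sphere: "\<And>r. 0 < r \<Longrightarrow> continuous_on (sphere 0 1) (\<lambda>x. k x r)"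
begin

lemmas space_\<sigma> = space_sphere_measure[OF sets_\<sigma>]

text \<open>Rescaled restrictions of \<open>neg_stieltjes (k x)\<close> to compact intervals are sub-probability
  kernels, to which the measurability theory of kernels applies.\<close>

lemma measurable_nn_integral_neg_stieltjes:
  assumes g: "(\<lambda>(x, r). g x r) \<in> borel_measurable (\<sigma> \<Otimes>\<^sub>M borel)"
  shows "(\<lambda>x. \<integral>\<^sup>+r. g x r \<partial>neg_stieltjes (k x)) \<in> borel_measurable \<sigma>"
proof -
  \<comment> \<open>These intervals exhaust the open half-line and keep away from 0, where
    \<open>k x\<close> may be unbounded.\<close>
  define l u :: "nat \<Rightarrow> real" where "l n = inverse (Suc n)" and "u n = real (Suc n)" for n
  have lu: "0 < l n" "l n \<le> u n" for n
  proof -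
    show "0 < l n" by (simp add: l_def)
    have "l n \<le> 1" "1 \<le> u n" by (auto simp: l_def u_def inverse_le_1_iff)
    then show "l n \<le> u n" by linarith
  qed
  \<comment> \<open>The mass of \<open>{l n<..u n}\<close> is at most \<open>k x (l n)\<close>,
    which is bounded over all directions because the sphere is compact. Dividing by this bound
    yields mass at most 1.\<close>
  have "\<exists>C>0. \<forall>x\<in>sphere 0 1. k x (l n) \<le> C" for n
  proof -
    have "bounded ((\<lambda>x. k x (l n)) ` sphere 0 1)"
      by (intro compact_imp_bounded compact_continuous_image k_cont_sphere lu) simp
    then show ?thesis
      unfolding bounded_pos by (force simp: abs_le_iff)
  qed
  then obtain C where C: "\<And>n. 0 < C n" "\<And>n x. x \<in> sphere 0 1 \<Longrightarrow> k x (l n) \<le> C n"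
    by metis
  define K where "K n x = density (neg_stieltjes (k x))
      (\<lambda>r. ennreal (inverse (C n)) * indicator {l n<..u n} r)" for n x
  have K_Ioc: "emeasure (K n x) {a<..b} = (if max a (l n) \<le> min b (u n)
      then ennreal (inverse (C n)) * ennreal (k x (max a (l n)) - k x (min b (u n))) else 0)"
    if "x \<in> sphere 0 1" for n x a b
  proof -
    have "emeasure (K n x) {a<..b}
        = (\<integral>\<^sup>+r. ennreal (inverse (C n)) * indicator {max a (l n)<..min b (u n)} r \<partial>neg_stieltjes (k x))"
      unfolding K_def
      by (subst emeasure_density) (auto intro!: nn_integral_cong split: split_indicator)
    also have "\<dots> = ennreal (inverse (C n)) * emeasure (neg_stieltjes (k x)) {max a (l n)<..min b (u n)}"
      by (subst nn_integral_cmult_indicator) auto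
    also have "\<dots> = (if max a (l n) \<le> min b (u n)
      then ennreal (inverse (C n)) * ennreal (k x (max a (l n)) - k x (min b (u n))) else 0)"
      using that lu(1)[of n] by (auto simp: emeasure_neg_stieltjes_Ioc k_anti k_cont simp del: max.absorb1 max_less_iff_conj min_less_iff_conj intro: max.strict_coboundedI2)
    finally show ?thesis .
  qed
  have K_UNIV: "emeasure (K n x) UNIV = ennreal (inverse (C n)) * ennreal (k x (l n) - k x (u n))"
    if "x \<in> sphere 0 1" for n x
  proof -
    have "emeasure (K n x) UNIV
        = (\<integral>\<^sup>+r. ennreal (inverse (C n)) * indicator {l n<..u n} r \<partial>neg_stieltjes (k x))"
      unfolding K_def by (subst emeasure_density) auto
    then show ?thesis
      using that lu[of n]
      by (subst (asm) nn_integral_cmult_indicator) (auto simp: emeasure_neg_stieltjes_Ioc k_anti k_cont)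
  qed
  \<comment> \<open>Half-open intervals are stable under intersection and generate the Borel sets,
    so measurability in \<open>x\<close> is checked on them, where the mass is a difference of
    continuous functions of \<open>x\<close>.\<close>
  have K: "K n \<in> \<sigma> \<rightarrow>\<^sub>M subprob_algebra borel" for n
  proof (rule measurable_subprob_algebra_generated)
    show "sets borel = sigma_sets UNIV (range (\<lambda>(a, b). {a<..b::real}))"
      by (simp add: borel_sigma_sets_Ioc)
    show "Int_stable (range (\<lambda>(a, b). {a<..b::real}))"
      by (auto simp: Int_stable_def Int_greaterThanAtMost)
    fix x assume x: "x \<in> space \<sigma>"
    have "ennreal (inverse (C n)) * ennreal (k x (l n) - k x (u n)) \<le> 1"
    proof -
      have "inverse (C n) * (k x (l n) - k x (u n)) \<le> inverse (C n) * C n"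
        using C(1)[of n] C(2)[where x = x and n = n] k_nonneg[of x "u n"] lu[of n] x
        by (intro mult_left_mono) (auto simp: space_\<sigma>)
      also have "\<dots> = 1" using C(1)[of n] by simp
      finally have "ennreal (inverse (C n) * (k x (l n) - k x (u n))) \<le> 1"
        by simp
      then show ?thesis
        using C(1)[of n] by (subst ennreal_mult'[symmetric]) auto
    qed
    then show "subprob_space (K n x)"
      using x by (intro subprob_spaceI) (auto simp: K_UNIV space_\<sigma> K_def[abs_def] K_UNIV[unfolded K_def])
    show "sets (K n x) = sets borel"
      by (simp add: K_def)
  next
    have *: "(\<lambda>x. ennreal (inverse (C n)) * ennreal (k x r - k x s)) \<in> borel_measurable \<sigma>"
      if "0 < r" "0 < s" for r s
      using that by (intro borel_measurable_times_ennreal measurable_compose[OF _ measurable_ennreal]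
          borel_measurable_diff borel_measurable_sphere_continuous[OF sets_\<sigma> k_cont_sphere]) auto
    show "(\<lambda>x. emeasure (K n x) UNIV) \<in> borel_measurable \<sigma>"
      using * lu[of n] by (subst measurable_cong[OF K_UNIV]) (auto simp: space_\<sigma> intro: order_less_le_trans)
    fix A assume "A \<in> range (\<lambda>(a, b). {a<..b::real})"
    then obtain a b where A: "A = {a<..b}" by auto
    show "(\<lambda>x. emeasure (K n x) A) \<in> borel_measurable \<sigma>"
    proof (cases "max a (l n) \<le> min b (u n)")
      case True
      moreover have "0 < max a (l n)" using lu(1)[of n] by auto
      ultimately have "(\<lambda>x. ennreal (inverse (C n)) * ennreal (k x (max a (l n)) - k x (min b (u n)))) \<in> borel_measurable \<sigma>"
        by (intro *) linarith+
      then show ?thesis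
        unfolding A using True by (subst measurable_cong[OF K_Ioc]) (auto simp: space_\<sigma>)
    next
      case False
      then show ?thesis
        unfolding A by (subst measurable_cong[OF K_Ioc]) (auto simp: space_\<sigma>)
    qed
  qed auto
  have [measurable]: "(\<lambda>r. g x r) \<in> borel_measurable borel" if "x \<in> space \<sigma>" for x
    using measurable_compose[OF measurable_Pair1'[OF that] g] by simp
  \<comment> \<open>Undoing the scaling by \<open>C n\<close> and letting the intervals grow
    recovers the full integral by monotone convergence; the points \<open>r \<le> 0\<close>, which
    all intervals miss, are null.\<close>
  have "(\<integral>\<^sup>+r. g x r \<partial>neg_stieltjes (k x)) = (SUP n. ennreal (C n) * (\<integral>\<^sup>+r. g x r \<partial>K n x))"
    if x: "x \<in> space \<sigma>" for x
  proof -
    note [measurable] = \<open>\<And>x. x \<in> space \<sigma> \<Longrightarrow> g x \<in> borel_measurable borel\<close>[OF x]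
    have "(\<integral>\<^sup>+r. g x r \<partial>neg_stieltjes (k x))
        = (\<integral>\<^sup>+r. (SUP n. g x r * indicator {l n<..u n} r) \<partial>neg_stieltjes (k x))"
    proof (rule nn_integral_cong_AE)
      show "AE r in neg_stieltjes (k x). g x r = (SUP n. g x r * indicator {l n<..u n} r)"
        using AE_neg_stieltjes_pos
      proof eventually_elim
        case (elim r)
        then obtain m where m: "inverse (Suc m) < r"
          using reals_Archimedean[of r] by auto
        obtain n where n: "r \<le> real n"
          using real_arch_simple by blast
        have "inverse (Suc (m + n)) \<le> inverse (real (Suc m))"
          by (intro le_imp_inverse_le) auto
        then have "inverse (real (Suc (m + n))) < r"
          using m by (rule order.strict_trans1)
        with n have "r \<in> {l (m + n)<..u (m + n)}" by (simp add: l_def u_def)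
        then have "g x r \<le> (SUP n. g x r * indicator {l n<..u n} r)"
          by (intro SUP_upper2[of "m + n"]) auto
        moreover have "(SUP n. g x r * indicator {l n<..u n} r) \<le> g x r"
          by (intro SUP_least) (auto split: split_indicator)
        ultimately show ?case by (rule antisym)
      qed
    qed
    also have "\<dots> = (SUP n. \<integral>\<^sup>+r. g x r * indicator {l n<..u n} r \<partial>neg_stieltjes (k x))"
    proof (rule nn_integral_monotone_convergence_SUP)
      have "{l m<..u m} \<subseteq> {l n<..u n}" if "m \<le> n" for m n
      proof -
        have "l n \<le> l m" "u m \<le> u n"
          using that by (auto simp: l_def u_def)
        then show ?thesis by auto
      qed
      then have "indicator {l m<..u m} r \<le> (indicator {l n<..u n} r :: ennreal)" if "m \<le> n" for m n r
        using subsetD[OF \<open>\<And>m n. m \<le> n \<Longrightarrow> {l m<..u m} \<subseteq> {l n<..u n}\<close>[OF that], of r]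
        by (simp split: split_indicator)
      then show "incseq (\<lambda>n r. g x r * indicator {l n<..u n} r)"
        by (auto simp: incseq_def le_fun_def intro: mult_left_mono)
    qed auto
    also have "(\<lambda>n. \<integral>\<^sup>+r. g x r * indicator {l n<..u n} r \<partial>neg_stieltjes (k x))
        = (\<lambda>n. ennreal (C n) * (\<integral>\<^sup>+r. g x r \<partial>K n x))"
    proof
      fix n
      have "ennreal (C n) * ennreal (inverse (C n)) = 1"
        using C(1)[of n] by (subst ennreal_mult'[symmetric]) auto
      then have "(\<integral>\<^sup>+r. g x r * indicator {l n<..u n} r \<partial>neg_stieltjes (k x))
        = (\<integral>\<^sup>+r. ennreal (C n) * (ennreal (inverse (C n)) * indicator {l n<..u n} r * g x r) \<partial>neg_stieltjes (k x))"
        by (intro nn_integral_cong) (auto simp: mult.assoc[symmetric] split: split_indicator)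
      also have "\<dots> = ennreal (C n) * (\<integral>\<^sup>+r. g x r \<partial>K n x)"
        unfolding K_def by (subst nn_integral_cmult) (auto simp: nn_integral_density)
      finally show "(\<integral>\<^sup>+r. g x r * indicator {l n<..u n} r \<partial>neg_stieltjes (k x))
        = ennreal (C n) * (\<integral>\<^sup>+r. g x r \<partial>K n x)" .
    qed
    finally show ?thesis .
  qed
  moreover have "(\<lambda>x. SUP n. ennreal (C n) * (\<integral>\<^sup>+r. g x r \<partial>K n x)) \<in> borel_measurable \<sigma>"
    using nn_integral_measurable_subprob_algebra2[OF g K] by measurable
  ultimately show ?thesis
    by (subst measurable_cong) auto
qed

text \<open>The polar decomposition is given on sets only; induction over nonnegative Borel
  functions extends it to integrals. The outer integral is additive and monotonically continuous
  because the inner one is measurable in the direction.\<close>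

lemma nn_integral_polar_neg_stieltjes:
  assumes polar: "polar_decomposition \<mu> \<sigma> (\<lambda>x. neg_stieltjes (k x))"
    and f: "f \<in> borel_measurable borel"
  shows "(\<integral>\<^sup>+u. f u \<partial>\<mu>) = (\<integral>\<^sup>+x. \<integral>\<^sup>+r. f (r *\<^sub>R x) \<partial>neg_stieltjes (k x) \<partial>\<sigma>)"
proof -
  have sets_\<mu> [measurable_cong]: "sets \<mu> = sets borel"
    using polar by (simp add: polar_decomposition_def)
  have id_\<sigma>: "(\<lambda>x. x) \<in> \<sigma> \<rightarrow>\<^sub>M borel"
    by (simp cong: measurable_cong_sets add: sets_\<sigma> measurable_restrict_space1)
  have meas [measurable]: "(\<lambda>x. \<integral>\<^sup>+r. h (r *\<^sub>R x) \<partial>neg_stieltjes (k x)) \<in> borel_measurable \<sigma>"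
    if [measurable]: "h \<in> borel_measurable borel" for h :: "'a \<Rightarrow> ennreal"
  proof (rule measurable_nn_integral_neg_stieltjes)
    note id_\<sigma> [measurable]
    show "(\<lambda>(x, r). h (r *\<^sub>R x)) \<in> borel_measurable (\<sigma> \<Otimes>\<^sub>M borel)"
      by measurable
  qed
  from f show ?thesis
  proof (induction rule: borel_measurable_induct)
    case (cong f g)
    then show ?case by (simp add: fun_eq_iff[of f g, symmetric])
  next
    case (set A)
    have "emeasure (neg_stieltjes (k x)) {r. 0 < r \<and> r *\<^sub>R x \<in> A}
        = (\<integral>\<^sup>+r. indicator A (r *\<^sub>R x) \<partial>neg_stieltjes (k x))" for x
    proof -
      have "{r. 0 < r \<and> r *\<^sub>R x \<in> A} \<in> sets borel"
        using set by measurable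
      then have "emeasure (neg_stieltjes (k x)) {r. 0 < r \<and> r *\<^sub>R x \<in> A}
        = (\<integral>\<^sup>+r. indicator {r. 0 < r \<and> r *\<^sub>R x \<in> A} r \<partial>neg_stieltjes (k x))"
        by simp
      also have "\<dots> = (\<integral>\<^sup>+r. indicator A (r *\<^sub>R x) \<partial>neg_stieltjes (k x))"
      proof (rule nn_integral_cong_AE)
        show "AE r in neg_stieltjes (k x).
            indicator {r. 0 < r \<and> r *\<^sub>R x \<in> A} r = (indicator A (r *\<^sub>R x) :: ennreal)"
          using AE_neg_stieltjes_pos by eventually_elim (simp split: split_indicator)
      qed
      finally show ?thesis .
    qed
    with set polar show ?case
      by (simp add: polar_decomposition_def)
  next
    case (mult f c)
    note [measurable] = mult(2)
    have "(\<integral>\<^sup>+x. \<integral>\<^sup>+r. c * f (r *\<^sub>R x) \<partial>neg_stieltjes (k x) \<partial>\<sigma>)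
        = (\<integral>\<^sup>+x. c * (\<integral>\<^sup>+r. f (r *\<^sub>R x) \<partial>neg_stieltjes (k x)) \<partial>\<sigma>)"
      by (intro nn_integral_cong nn_integral_cmult) measurable
    moreover have "(\<integral>\<^sup>+u. c * f u \<partial>\<mu>) = c * (\<integral>\<^sup>+u. f u \<partial>\<mu>)"
      by (rule nn_integral_cmult) measurable
    moreover have "(\<integral>\<^sup>+x. c * (\<integral>\<^sup>+r. f (r *\<^sub>R x) \<partial>neg_stieltjes (k x)) \<partial>\<sigma>)
        = c * (\<integral>\<^sup>+x. \<integral>\<^sup>+r. f (r *\<^sub>R x) \<partial>neg_stieltjes (k x) \<partial>\<sigma>)"
      by (rule nn_integral_cmult) measurable
    ultimately show ?case
      using mult.IH by simp
  next
    case (add f g)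
    note [measurable] = add(1,3)
    have "(\<integral>\<^sup>+x. \<integral>\<^sup>+r. f (r *\<^sub>R x) + g (r *\<^sub>R x) \<partial>neg_stieltjes (k x) \<partial>\<sigma>)
        = (\<integral>\<^sup>+x. (\<integral>\<^sup>+r. f (r *\<^sub>R x) \<partial>neg_stieltjes (k x))
            + (\<integral>\<^sup>+r. g (r *\<^sub>R x) \<partial>neg_stieltjes (k x)) \<partial>\<sigma>)"
      by (intro nn_integral_cong nn_integral_add) measurable
    then show ?case
      using add by (simp add: nn_integral_add)
  next
    case (seq F)
    note [measurable] = seq(1)
    have inc: "incseq (\<lambda>i r. F i (r *\<^sub>R x))" for x
      using \<open>incseq F\<close> by (auto simp: incseq_def le_fun_def)
    have "(\<integral>\<^sup>+u. (SUP i. F i) u \<partial>\<mu>) = (SUP i. \<integral>\<^sup>+u. F i u \<partial>\<mu>)"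
      unfolding SUP_apply by (rule nn_integral_monotone_convergence_SUP[OF \<open>incseq F\<close>]) simp
    also have "\<dots> = (SUP i. \<integral>\<^sup>+x. \<integral>\<^sup>+r. F i (r *\<^sub>R x) \<partial>neg_stieltjes (k x) \<partial>\<sigma>)"
      using seq by simp
    also have "\<dots> = (\<integral>\<^sup>+x. (SUP i. \<integral>\<^sup>+r. F i (r *\<^sub>R x) \<partial>neg_stieltjes (k x)) \<partial>\<sigma>)"
      using inc by (intro nn_integral_monotone_convergence_SUP[symmetric])
        (auto simp: incseq_def le_fun_def intro!: nn_integral_mono)
    also have "\<dots> = (\<integral>\<^sup>+x. \<integral>\<^sup>+r. (SUP i. F i) (r *\<^sub>R x) \<partial>neg_stieltjes (k x) \<partial>\<sigma>)"
      unfolding SUP_apply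
      by (intro nn_integral_cong nn_integral_monotone_convergence_SUP[symmetric] inc) simp
    finally show ?case
      using \<open>f = (SUP i. F i)\<close> by simp
  qed
qed

end

text \<open>The density \<open>ds/s\<close> is invariant under dilations, which lets one measure
  serve all radii. Its mass near 0 is infinite, so Fubini rests on sigma-finiteness.\<close>

definition log_unit :: "real measure" where
  "log_unit = density lborel (\<lambda>s. ennreal (indicator {0<..<1} s / s))"

lemma sets_log_unit [measurable_cong, simp]: "sets log_unit = sets borel"
  and space_log_unit [simp]: "space log_unit = UNIV"
  by (simp_all add: log_unit_def)

lemma sigma_finite_log_unit: "sigma_finite_measure log_unit"
  unfolding log_unit_def
  by (subst sigma_finite_measure.sigma_finite_iff_density_finite[OF sigma_finite_lborel]) auto

text \<open>Layer-cake formula on a ray: \<open>h r\<close> is the mass of all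
  \<open>\<rho> > r\<close>. Exchanging the integrals leaves \<open>dr/r\<close> on
  \<open>(0, \<rho>)\<close>, and \<open>r = \<rho> s\<close> turns it into \<open>ds/s\<close> on
  \<open>(0, 1)\<close> for every \<open>\<rho>\<close>.\<close>

lemma emeasure_over_r_measure_radial:
  fixes A :: "'a::euclidean_space set"
  assumes anti: "antimono_on {0<..} h" and cont: "continuous_on {0<..} h"
    and lim: "(h \<longlongrightarrow> 0) at_top" and [measurable]: "A \<in> sets borel"
  shows "emeasure (over_r_measure h) {r. 0 < r \<and> r *\<^sub>R x \<in> A}
    = (\<integral>\<^sup>+\<rho>. \<integral>\<^sup>+s. indicator A (s *\<^sub>R \<rho> *\<^sub>R x) \<partial>log_unit \<partial>neg_stieltjes h)"
proof -
  interpret N: sigma_finite_measure "neg_stieltjes h"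
    by (rule sigma_finite_neg_stieltjes[OF anti cont])
  interpret pair_sigma_finite lborel "neg_stieltjes h" ..
  let ?g = "\<lambda>r \<rho>. indicator {0<..} r * ((if r < \<rho> then ennreal (1 / r) else 0) * indicator A (r *\<^sub>R x)) :: ennreal"
  \<comment> \<open>Continuity of \<open>h\<close> is given on the open half-line only, so
    measurability is derived for the function cut off there.\<close>
  have "(\<lambda>r. indicator {0<..} r *\<^sub>R h r) \<in> borel_measurable borel"
    by (intro borel_measurable_continuous_on_indicator cont) auto
  then have "(\<lambda>r. ennreal (indicator {0<..} r *\<^sub>R h r / r) * indicator {0<..} r) \<in> borel_measurable borel"
    by measurable
  also have "(\<lambda>r. ennreal (indicator {0<..} r *\<^sub>R h r / r) * indicator {0<..} r)
      = (\<lambda>r. ennreal (h r / r) * indicator {0<..} r)"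
    by (auto split: split_indicator)
  finally have [measurable]: "(\<lambda>r. ennreal (h r / r) * indicator {0<..} r) \<in> borel_measurable borel" .
  have "{r. 0 < r \<and> r *\<^sub>R x \<in> A} \<in> sets borel"
    by measurable
  then have "emeasure (over_r_measure h) {r. 0 < r \<and> r *\<^sub>R x \<in> A}
      = (\<integral>\<^sup>+r. ennreal (h r / r) * indicator {0<..} r * indicator {r. 0 < r \<and> r *\<^sub>R x \<in> A} r \<partial>lborel)"
    unfolding over_r_measure_def by (subst emeasure_density) auto
  also have "\<dots> = (\<integral>\<^sup>+r. \<integral>\<^sup>+\<rho>. ?g r \<rho> \<partial>neg_stieltjes h \<partial>lborel)"
  proof (rule nn_integral_cong)
    fix r :: real
    show "ennreal (h r / r) * indicator {0<..} r * indicator {r. 0 < r \<and> r *\<^sub>R x \<in> A} r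
        = (\<integral>\<^sup>+\<rho>. ?g r \<rho> \<partial>neg_stieltjes h)"
    proof (cases "0 < r \<and> r *\<^sub>R x \<in> A")
      case True
      then have "(\<integral>\<^sup>+\<rho>. ?g r \<rho> \<partial>neg_stieltjes h) = (\<integral>\<^sup>+\<rho>. ennreal (1 / r) * indicator {r<..} \<rho> \<partial>neg_stieltjes h)"
        by (intro nn_integral_cong) (simp split: split_indicator)
      also have "\<dots> = ennreal (1 / r) * ennreal (h r)"
        using True by (simp add: nn_integral_cmult_indicator emeasure_neg_stieltjes_Ioi[OF anti cont lim])
      also have "\<dots> = ennreal (h r / r)"
        using True by (subst ennreal_mult'[symmetric]) auto
      finally show ?thesis using True by simp
    next
      case False
      then have "?g r \<rho> = 0" for \<rho>
        by (auto split: split_indicator)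
      with False show ?thesis by auto
    qed
  qed
  also have "\<dots> = (\<integral>\<^sup>+\<rho>. \<integral>\<^sup>+r. ?g r \<rho> \<partial>lborel \<partial>neg_stieltjes h)"
    by (rule Fubini'[symmetric]) measurable
  also have "\<dots> = (\<integral>\<^sup>+\<rho>. \<integral>\<^sup>+s. indicator A (s *\<^sub>R \<rho> *\<^sub>R x) \<partial>log_unit \<partial>neg_stieltjes h)"
  proof (rule nn_integral_cong_AE)
    show "AE \<rho> in neg_stieltjes h. (\<integral>\<^sup>+r. ?g r \<rho> \<partial>lborel)
        = (\<integral>\<^sup>+s. indicator A (s *\<^sub>R \<rho> *\<^sub>R x) \<partial>log_unit)"
      using AE_neg_stieltjes_pos
    proof eventually_elim
      case (elim \<rho>)
      \<comment> \<open>Affine substitution with offset 0 and slope \<open>\<rho>\<close>; the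
        Jacobian cancels the factor \<open>1 / \<rho>\<close> in \<open>1 / r\<close>.\<close>
      then have "(\<integral>\<^sup>+r. ?g r \<rho> \<partial>lborel) = ennreal \<bar>\<rho>\<bar> * (\<integral>\<^sup>+s. ?g (0 + \<rho> * s) \<rho> \<partial>lborel)"
        by (intro nn_integral_real_affine) measurable
      also have "\<dots> = (\<integral>\<^sup>+s. ennreal \<bar>\<rho>\<bar> * ?g (0 + \<rho> * s) \<rho> \<partial>lborel)"
        by (intro nn_integral_cmult[symmetric]) measurable
      also have "\<dots> = (\<integral>\<^sup>+s. ennreal (indicator {0<..<1} s / s) * indicator A (s *\<^sub>R \<rho> *\<^sub>R x) \<partial>lborel)"
      proof (rule nn_integral_cong)
        fix s :: real
        have "ennreal \<rho> * ennreal (1 / (\<rho> * s)) = ennreal (1 / s)" if "0 < s"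
          using elim that by (subst ennreal_mult'[symmetric]) auto
        then show "ennreal \<bar>\<rho>\<bar> * ?g (0 + \<rho> * s) \<rho>
            = ennreal (indicator {0<..<1} s / s) * indicator A (s *\<^sub>R \<rho> *\<^sub>R x)"
          using elim by (auto simp: zero_less_mult_iff mult.commute split: split_indicator)
      qed
      also have "\<dots> = (\<integral>\<^sup>+s. indicator A (s *\<^sub>R \<rho> *\<^sub>R x) \<partial>log_unit)"
        unfolding log_unit_def by (subst nn_integral_density) measurable
      finally show ?case .
    qed
  qed
  finally show ?thesis .
qed

text \<open>The radial identity holds on each ray, and its inner integral depends only on the point
  \<open>\<rho> x\<close>. The polar formula for \<open>\<nu>'\<close> therefore reassembles the
  rays.\<close>

lemma polar_decomposition_eq_distr:
  fixes \<nu> \<nu>' \<sigma> :: "'a::euclidean_space measure" and k :: "'a \<Rightarrow> real \<Rightarrow> real"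
  assumes sets_\<sigma>: "sets \<sigma> = sets (restrict_space borel (sphere 0 1))"
    and k_nonneg: "\<And>x r. x \<in> sphere 0 1 \<Longrightarrow> 0 < r \<Longrightarrow> 0 \<le> k x r"
    and k_cont: "\<And>x. x \<in> sphere 0 1 \<Longrightarrow> continuous_on {0<..} (k x)"
    and k_anti: "\<And>x. x \<in> sphere 0 1 \<Longrightarrow> antimono_on {0<..} (k x)"
    and k_cont_sphere: "\<And>r. 0 < r \<Longrightarrow> continuous_on (sphere 0 1) (\<lambda>x. k x r)"
    and k_lim: "\<And>x. x \<in> sphere 0 1 \<Longrightarrow> (k x \<longlongrightarrow> 0) at_top"
    and \<nu>: "polar_decomposition \<nu> \<sigma> (\<lambda>x. over_r_measure (k x))"
    and \<nu>': "polar_decomposition \<nu>' \<sigma> (\<lambda>x. neg_stieltjes (k x))"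
  shows "\<nu> = distr (\<nu>' \<Otimes>\<^sub>M log_unit) borel (\<lambda>(u, s). s *\<^sub>R u)"
proof (rule measure_eqI)
  have sets_\<nu>' [measurable_cong]: "sets \<nu>' = sets borel"
    using \<nu>' by (simp add: polar_decomposition_def)
  have sets_\<nu>: "sets \<nu> = sets borel"
    using \<nu> by (simp add: polar_decomposition_def)
  interpret L: sigma_finite_measure log_unit
    by (rule sigma_finite_log_unit)
  show "sets \<nu> = sets (distr (\<nu>' \<Otimes>\<^sub>M log_unit) borel (\<lambda>(u, s). s *\<^sub>R u))"
    by (simp add: sets_\<nu>)
  fix A assume "A \<in> sets \<nu>"
  then have A [measurable]: "A \<in> sets borel" by (simp add: sets_\<nu>)
  note sp = space_sphere_measure[OF sets_\<sigma>]
  have "emeasure \<nu> A = (\<integral>\<^sup>+x. emeasure (over_r_measure (k x)) {r. 0 < r \<and> r *\<^sub>R x \<in> A} \<partial>\<sigma>)"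
    using \<nu> A unfolding polar_decomposition_def by blast
  also have "\<dots> = (\<integral>\<^sup>+x. \<integral>\<^sup>+\<rho>. \<integral>\<^sup>+s. indicator A (s *\<^sub>R \<rho> *\<^sub>R x) \<partial>log_unit \<partial>neg_stieltjes (k x) \<partial>\<sigma>)"
    by (intro nn_integral_cong emeasure_over_r_measure_radial k_anti k_cont k_lim A) (simp_all add: sp)
  also have "\<dots> = (\<integral>\<^sup>+u. \<integral>\<^sup>+s. indicator A (s *\<^sub>R u) \<partial>log_unit \<partial>\<nu>')"
    by (rule nn_integral_polar_neg_stieltjes[OF sets_\<sigma> k_nonneg k_cont k_anti k_cont_sphere \<nu>', symmetric])
       (auto intro!: L.borel_measurable_nn_integral)
  also have "\<dots> = (\<integral>\<^sup>+p. indicator A (snd p *\<^sub>R fst p) \<partial>(\<nu>' \<Otimes>\<^sub>M log_unit))"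
    by (subst L.nn_integral_fst[symmetric]) auto
  also have "\<dots> = emeasure (distr (\<nu>' \<Otimes>\<^sub>M log_unit) borel (\<lambda>(u, s). s *\<^sub>R u)) A"
    by (subst nn_integral_indicator[symmetric], simp, subst nn_integral_distr) (auto simp: case_prod_beta)
  finally show "emeasure \<nu> A = emeasure (distr (\<nu>' \<Otimes>\<^sub>M log_unit) borel (\<lambda>(u, s). s *\<^sub>R u)) A" .
qed

subsection \<open>From the integral identity to the characteristic function\<close>

text \<open>The setting once polar coordinates have been eliminated: they survive only in the image
  representation of \<open>\<nu>\<close>. The name refers to Ornstein-Uhlenbeck type processes,
  whose stationary laws are the self-decomposable ones.\<close>

locale ou_pair = prob_space M for M :: "'w measure" +
  fixes X :: "'w \<Rightarrow> 'a::euclidean_space" and b\<^sub>0 :: 'a and \<nu> \<nu>' :: "'a measure"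
  assumes X [measurable]: "X \<in> borel_measurable M"
    and sets_\<nu>' [measurable_cong]: "sets \<nu>' = sets borel"
    and sigma_finite_\<nu>': "sigma_finite_measure \<nu>'"
    and integrable_\<nu>'_min: "integrable \<nu>' (\<lambda>u. min 1 (norm u))"
    and \<nu>_eq: "\<nu> = distr (\<nu>' \<Otimes>\<^sub>M log_unit) borel (\<lambda>(u, s). s *\<^sub>R u)"
    and integrable_\<nu>_min: "integrable \<nu> (\<lambda>u. min 1 (norm u))"
begin

sublocale \<nu>': sigma_finite_measure \<nu>'
  by (rule sigma_finite_\<nu>')

lemma sets_\<nu> [measurable_cong]: "sets \<nu> = sets borel"
  by (simp add: \<nu>_eq)

text \<open>The jump part of the exponent of the background driving Levy process.\<close>

definition jump :: "'a \<Rightarrow> complex" where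
  "jump \<xi> = (CLINT u|\<nu>'. iexp (\<xi> \<bullet> u) - 1)"

definition phi :: "'a \<Rightarrow> complex" where
  "phi \<xi> = (CLINT \<omega>|M. iexp (\<xi> \<bullet> X \<omega>))"

text \<open>The exponent of the target law with the compensator absorbed into the drift; this is
  possible because small jumps are integrable.\<close>

definition psi :: "'a \<Rightarrow> complex" where
  "psi \<xi> = \<i> * (b\<^sub>0 \<bullet> \<xi>) + (CLINT u|\<nu>. iexp (\<xi> \<bullet> u) - 1)"

definition K\<^sub>0 :: real where
  "K\<^sub>0 = (LINT u|\<nu>'. min 1 (norm u))"

text \<open>One majorant gives both integrability and a bound by a multiple of
  \<open>K\<^sub>0\<close>; all integrals over \<open>\<nu>'\<close> of bounded Lipschitz increments
  are handled this way.\<close>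

lemma integrable_\<nu>':
  fixes f :: "'a \<Rightarrow> 'c::{banach, second_countable_topology}"
  assumes [measurable]: "f \<in> borel_measurable borel" and "\<And>u. norm (f u) \<le> C * min 1 (norm u)"
  shows "integrable \<nu>' f" and "norm (integral\<^sup>L \<nu>' f) \<le> C * K\<^sub>0"
proof -
  show "integrable \<nu>' f"
  proof (rule Bochner_Integration.integrable_bound)
    show "integrable \<nu>' (\<lambda>u. C * min 1 (norm u))"
      using integrable_\<nu>'_min by simp
    show "AE u in \<nu>'. norm (f u) \<le> norm (C * min 1 (norm u))"
      using assms(2) by (intro AE_I2) (auto intro: order_trans[OF _ abs_ge_self])
  qed measurable
  have "norm (integral\<^sup>L \<nu>' f) \<le> (LINT u|\<nu>'. C * min 1 (norm u))"
    using assms(2) integrable_\<nu>'_min by (intro norm_integral_le) auto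
  then show "norm (integral\<^sup>L \<nu>' f) \<le> C * K\<^sub>0"
    by (simp add: K\<^sub>0_def)
qed

lemma integrable_M:
  fixes f :: "'w \<Rightarrow> 'c::{banach, second_countable_topology}"
  assumes "f \<in> borel_measurable M" "\<And>\<omega>. norm (f \<omega>) \<le> C"
  shows "integrable M f"
  using assms by (intro integrable_const_bound[where B = C]) auto

lemma norm_iexp_diff_le:
  "norm (iexp (\<xi> \<bullet> (x + u)) - iexp (\<xi> \<bullet> x)) \<le> (2 + norm \<xi>) * min 1 (norm u)" for x u \<xi> :: 'a
proof -
  have "norm (iexp (\<xi> \<bullet> (x + u)) - iexp (\<xi> \<bullet> x)) = norm (iexp (\<xi> \<bullet> x) * (iexp (\<xi> \<bullet> u) - 1))"
    by (simp add: inner_add_right exp_add[symmetric] algebra_simps)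
  also have "\<dots> = norm (iexp (\<xi> \<bullet> u) - 1)"
    by (simp add: norm_mult)
  also have "\<dots> \<le> (2 + norm \<xi>) * min 1 (norm u)"
  proof (cases "norm u \<le> 1")
    case True
    have "norm (iexp (\<xi> \<bullet> u) - 1) \<le> \<bar>\<xi> \<bullet> u\<bar>"
      by (rule norm_iexp_diff_one_le)
    also have "\<dots> \<le> norm \<xi> * norm u"
      by (rule Cauchy_Schwarz_ineq2)
    also have "\<dots> \<le> (2 + norm \<xi>) * norm u"
      by (intro mult_right_mono) auto
    finally show ?thesis using True by simp
  next
    case False
    have "norm (iexp (\<xi> \<bullet> u) - 1) \<le> 2 + norm \<xi>"
      by (rule order_trans[OF norm_iexp_diff_one_le_2]) simp
    with False show ?thesis by simp
  qed
  finally show ?thesis .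
qed

lemma norm_iexp_diff_one_le_min: "norm (iexp (\<xi> \<bullet> u) - 1) \<le> (2 + norm \<xi>) * min 1 (norm u)" for u \<xi> :: 'a
  using norm_iexp_diff_le[of \<xi> 0 u] by simp

lemma integrable_jump: "integrable \<nu>' (\<lambda>u. iexp (\<xi> \<bullet> u) - 1)"
  and norm_jump_le: "norm (jump \<xi>) \<le> (2 + norm \<xi>) * K\<^sub>0"
  unfolding jump_def by (rule integrable_\<nu>'[OF _ norm_iexp_diff_one_le_min]; simp)+

lemma K\<^sub>0_nonneg: "0 \<le> K\<^sub>0"
  unfolding K\<^sub>0_def by simp

lemma norm_phi_le: "norm (phi \<xi>) \<le> 1"
  unfolding phi_def
  using norm_integral_le[of M "\<lambda>_. 1" "\<lambda>\<omega>. iexp (\<xi> \<bullet> X \<omega>)"] by (simp add: prob_space)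

lemma integral_log_unit: "(CLINT s|log_unit. iexp (s * z) - 1) = expint z"
  unfolding log_unit_def expint_def
  by (subst integral_density) (auto intro!: Bochner_Integration.integral_cong simp: scaleR_conv_of_real split: split_indicator)

lemma integrable_\<nu>_iexp: "integrable \<nu> (\<lambda>u. iexp (\<xi> \<bullet> u) - 1)"
proof (rule Bochner_Integration.integrable_bound)
  show "integrable \<nu> (\<lambda>u. (2 + norm \<xi>) * min 1 (norm u))"
    using integrable_\<nu>_min by simp
  show "AE u in \<nu>. norm (iexp (\<xi> \<bullet> u) - 1) \<le> norm ((2 + norm \<xi>) * min 1 (norm u))"
    by (intro AE_I2 order_trans[OF norm_iexp_diff_one_le_min]) (simp only: real_norm_def abs_ge_self)
qed measurable

text \<open>Integrability over the product is inherited from \<open>\<nu>\<close> through the image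
  representation. Fubini then integrates out \<open>s\<close>, and the integral over
  \<open>log_unit\<close> is \<open>expint\<close>.\<close>

lemma integrable_expint_\<nu>': "integrable \<nu>' (\<lambda>u. expint (\<xi> \<bullet> u))"
  and psi_eq: "psi \<xi> = \<i> * (b\<^sub>0 \<bullet> \<xi>) + (CLINT u|\<nu>'. expint (\<xi> \<bullet> u))"
proof -
  interpret L: sigma_finite_measure log_unit
    by (rule sigma_finite_log_unit)
  interpret pair_sigma_finite \<nu>' log_unit ..
  have "integrable (\<nu>' \<Otimes>\<^sub>M log_unit) (\<lambda>p. iexp (\<xi> \<bullet> (case p of (u, s) \<Rightarrow> s *\<^sub>R u)) - 1)"
    using integrable_\<nu>_iexp[of \<xi>] unfolding \<nu>_eq
    by (subst (asm) integrable_distr_eq) measurable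
  then have int: "integrable (\<nu>' \<Otimes>\<^sub>M log_unit) (\<lambda>p. iexp (snd p * (\<xi> \<bullet> fst p)) - 1)"
    by (simp add: case_prod_beta)
  show "integrable \<nu>' (\<lambda>u. expint (\<xi> \<bullet> u))"
    using integrable_fst'[OF int] by (simp only: fst_conv snd_conv integral_log_unit)
  have "(CLINT u|\<nu>. iexp (\<xi> \<bullet> u) - 1)
      = (CLINT p|\<nu>' \<Otimes>\<^sub>M log_unit. iexp (\<xi> \<bullet> (case p of (u, s) \<Rightarrow> s *\<^sub>R u)) - 1)"
    unfolding \<nu>_eq by (rule integral_distr) measurable
  also have "\<dots> = (CLINT p|\<nu>' \<Otimes>\<^sub>M log_unit. iexp (snd p * (\<xi> \<bullet> fst p)) - 1)"
    by (simp add: case_prod_beta)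
  also have "\<dots> = (CLINT u|\<nu>'. expint (\<xi> \<bullet> u))"
    using integral_fst'[OF int, symmetric] by (simp only: fst_conv snd_conv integral_log_unit)
  finally show "psi \<xi> = \<i> * (b\<^sub>0 \<bullet> \<xi>) + (CLINT u|\<nu>'. expint (\<xi> \<bullet> u))"
    by (simp add: psi_def)
qed

text \<open>The derivative of \<open>expint (t * y)\<close> in \<open>t\<close> is
  \<open>(iexp (t * y) - 1) / t\<close>, so differentiation removes the integral over
  \<open>s\<close> and leaves the exponent \<open>jump\<close>.\<close>

lemma psi_has_vector_derivative:
  assumes "0 < t"
  shows "((\<lambda>t. psi (t *\<^sub>R \<xi>)) has_vector_derivative \<i> * (b\<^sub>0 \<bullet> \<xi>) + jump (t *\<^sub>R \<xi>) / t) (at t)"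
proof -
  have meas [measurable]: "expint \<in> borel_measurable borel"
    using expint_has_vector_derivative
    by (intro borel_measurable_continuous_onI continuous_at_imp_continuous_on ballI)
       (blast intro: has_vector_derivative_continuous)
  have deriv: "((\<lambda>t. expint (t * y)) has_vector_derivative (iexp (s * y) - 1) / s) (at s)"
    if "0 < s" for s y :: real
  proof -
    obtain D :: complex where D: "(expint has_vector_derivative D) (at (s * y))"
      "of_real (s * y) * D = iexp (s * y) - 1"
      using expint_has_vector_derivative[of "s * y"] by blast
    have "((\<lambda>t. t * y) has_vector_derivative y) (at s)"
      by (auto intro!: derivative_eq_intros simp: has_real_derivative_iff_has_vector_derivative[symmetric])
    from vector_diff_chain_at[OF this D(1)]
    have "((\<lambda>t. expint (t * y)) has_vector_derivative y *\<^sub>R D) (at s)"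
      by (simp add: comp_def)
    moreover have "y *\<^sub>R D = (iexp (s * y) - 1) / s"
      unfolding D(2)[symmetric] using that by (simp add: scaleR_conv_of_real)
    ultimately show ?thesis by simp
  qed
  have "((\<lambda>t. CLINT u|\<nu>'. expint (t * (\<xi> \<bullet> u))) has_vector_derivative
      (CLINT u|\<nu>'. (iexp (t * (\<xi> \<bullet> u)) - 1) / t)) (at t)"
  \<comment> \<open>For \<open>s > t / 2\<close> the factor \<open>2 / s\<close> is at most
    \<open>4 / t\<close>, which gives the constant in \<open>w\<close>.\<close>
  proof (rule has_vector_derivative_Bochner_integral[where S = "{t / 2<..}"
        and f = "\<lambda>t u. expint (t * (\<xi> \<bullet> u))" and f' = "\<lambda>t u. (iexp (t * (\<xi> \<bullet> u)) - 1) / complex_of_real t"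
        and w = "\<lambda>u. (4 / t + norm \<xi>) * min 1 (norm u)"])
    show "integrable \<nu>' (\<lambda>u. expint (s * (\<xi> \<bullet> u)))" for s
      using integrable_expint_\<nu>'[of "s *\<^sub>R \<xi>"] by simp
    fix s u assume s: "s \<in> {t / 2<..}"
    then have "0 < s" using assms by auto
    then show "((\<lambda>s. expint (s * (\<xi> \<bullet> u))) has_vector_derivative
        (iexp (s * (\<xi> \<bullet> u)) - 1) / complex_of_real s) (at s)"
      by (rule deriv)
    have "norm (iexp (s * (\<xi> \<bullet> u)) - 1) \<le> (2 + norm (s *\<^sub>R \<xi>)) * min 1 (norm u)"
      using norm_iexp_diff_one_le_min[of "s *\<^sub>R \<xi>" u] by simp
    then have "norm ((iexp (s * (\<xi> \<bullet> u)) - 1) / complex_of_real s)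
        \<le> (2 + norm (s *\<^sub>R \<xi>)) * min 1 (norm u) / s"
      using \<open>0 < s\<close> by (simp add: norm_divide divide_right_mono)
    also have "\<dots> = (2 / s + norm \<xi>) * min 1 (norm u)"
      using \<open>0 < s\<close> by (simp add: field_simps)
    also have "\<dots> \<le> (4 / t + norm \<xi>) * min 1 (norm u)"
      using s \<open>0 < s\<close> assms by (intro mult_right_mono add_right_mono) (auto simp: field_simps)
    finally show "norm ((iexp (s * (\<xi> \<bullet> u)) - 1) / complex_of_real s)
        \<le> (4 / t + norm \<xi>) * min 1 (norm u)" .
  qed (use assms integrable_\<nu>'_min in auto)
  moreover have jump: "(CLINT u|\<nu>'. (iexp (t * (\<xi> \<bullet> u)) - 1) / t) = jump (t *\<^sub>R \<xi>) / t"
    by (simp add: jump_def)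
  moreover have "((\<lambda>t. \<i> * of_real (t * (b\<^sub>0 \<bullet> \<xi>))) has_vector_derivative \<i> * (b\<^sub>0 \<bullet> \<xi>)) (at t)"
    by (intro has_vector_derivative_mult_right has_vector_derivative_of_real)
       (auto intro!: derivative_eq_intros simp: has_real_derivative_iff_has_vector_derivative[symmetric])
  ultimately have "((\<lambda>t. \<i> * of_real (t * (b\<^sub>0 \<bullet> \<xi>)) + (CLINT u|\<nu>'. expint (t * (\<xi> \<bullet> u))))
      has_vector_derivative \<i> * (b\<^sub>0 \<bullet> \<xi>) + jump (t *\<^sub>R \<xi>) / t) (at t)"
    unfolding jump by (intro has_vector_derivative_add)
  then show ?thesis
    by (simp add: psi_eq[abs_def])
qed

text \<open>The initial values at the origin of the ray, needed to identify the constant in the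
  differential equation.\<close>

lemma tendsto_phi_psi_0:
  assumes "s \<longlonglongrightarrow> 0"
  shows "(\<lambda>n. phi (s n *\<^sub>R \<xi>)) \<longlonglongrightarrow> 1" "(\<lambda>n. psi (s n *\<^sub>R \<xi>)) \<longlonglongrightarrow> 0"
proof -
  have "(\<lambda>n. phi (s n *\<^sub>R \<xi>)) \<longlonglongrightarrow> (CLINT \<omega>|M. 1)"
    unfolding phi_def
  proof (rule integral_dominated_convergence[where w = "\<lambda>_. 1"])
    have "(\<lambda>n. iexp ((s n *\<^sub>R \<xi>) \<bullet> X \<omega>)) \<longlonglongrightarrow> iexp ((0 *\<^sub>R \<xi>) \<bullet> X \<omega>)" for \<omega>
      by (intro tendsto_intros assms)
    then show "AE \<omega> in M. (\<lambda>n. iexp ((s n *\<^sub>R \<xi>) \<bullet> X \<omega>)) \<longlonglongrightarrow> 1" by simp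
  qed auto
  then show "(\<lambda>n. phi (s n *\<^sub>R \<xi>)) \<longlonglongrightarrow> 1"
    by (simp add: prob_space)
  obtain B where B: "\<And>n. norm (s n) \<le> B"
    using convergent_imp_Bseq[OF convergentI[OF assms]] by (auto simp: Bseq_def)
  have "(\<lambda>n. CLINT u|\<nu>. iexp ((s n *\<^sub>R \<xi>) \<bullet> u) - 1) \<longlonglongrightarrow> (CLINT u|\<nu>. 0)"
  proof (rule integral_dominated_convergence[where w = "\<lambda>u. (2 + B * norm \<xi>) * min 1 (norm u)"])
    have "(\<lambda>n. iexp ((s n *\<^sub>R \<xi>) \<bullet> u) - 1) \<longlonglongrightarrow> iexp ((0 *\<^sub>R \<xi>) \<bullet> u) - 1" for u
      by (intro tendsto_intros assms)
    then show "AE u in \<nu>. (\<lambda>n. iexp ((s n *\<^sub>R \<xi>) \<bullet> u) - 1) \<longlonglongrightarrow> 0" by simp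
    show "AE u in \<nu>. norm (iexp ((s n *\<^sub>R \<xi>) \<bullet> u) - 1) \<le> (2 + B * norm \<xi>) * min 1 (norm u)" for n
    proof (rule AE_I2)
      fix u
      have "norm (iexp ((s n *\<^sub>R \<xi>) \<bullet> u) - 1) \<le> (2 + norm (s n *\<^sub>R \<xi>)) * min 1 (norm u)"
        by (rule norm_iexp_diff_one_le_min)
      also have "\<dots> \<le> (2 + B * norm \<xi>) * min 1 (norm u)"
        using B[of n] by (intro mult_right_mono) (auto intro: mult_right_mono)
      finally show "norm (iexp ((s n *\<^sub>R \<xi>) \<bullet> u) - 1) \<le> (2 + B * norm \<xi>) * min 1 (norm u)" .
    qed
  qed (use integrable_\<nu>_min in auto)
  moreover have "(\<lambda>n. \<i> * complex_of_real (b\<^sub>0 \<bullet> (s n *\<^sub>R \<xi>))) \<longlonglongrightarrow> \<i> * complex_of_real (b\<^sub>0 \<bullet> (0 *\<^sub>R \<xi>))"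
    by (intro tendsto_intros assms)
  ultimately show "(\<lambda>n. psi (s n *\<^sub>R \<xi>)) \<longlonglongrightarrow> 0"
    unfolding psi_def using tendsto_add by fastforce
qed

text \<open>All integrands over \<open>M\<close> are bounded random variables: the decay of the
  gradient absorbs the factor \<open>X\<close>, and the jump integral is at most a multiple of
  \<open>K\<^sub>0\<close>.\<close>

lemma integrable_schwartz:
  assumes "schwartz f"
  shows "integrable M (\<lambda>\<omega>. X \<omega> \<bullet> grad f (X \<omega>))"
    and "integrable M (\<lambda>\<omega>. v \<bullet> grad f (X \<omega>))"
    and "integrable \<nu>' (\<lambda>u. f (x + u) - f x)"
    and "integrable M (\<lambda>\<omega>. LINT u|\<nu>'. f (X \<omega> + u) - f (X \<omega>))"
proof -
  obtain A C where bounds: "\<And>x. norm (grad f x) \<le> C" "\<And>x. norm x * norm (grad f x) \<le> C"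
    "\<And>x u. \<bar>f (x + u) - f x\<bar> \<le> (2 * A + C) * min 1 (norm u)"
    using schwartz_bounds[OF assms] by metis
  have [measurable]: "f \<in> borel_measurable borel" "grad f \<in> borel_measurable borel"
    using schwartz_continuous[OF assms] by (auto intro: borel_measurable_continuous_onI)
  have Cauchy: "\<bar>v \<bullet> grad f x\<bar> \<le> norm v * norm (grad f x)" for v x
    by (rule Cauchy_Schwarz_ineq2)
  show "integrable M (\<lambda>\<omega>. X \<omega> \<bullet> grad f (X \<omega>))"
    by (rule integrable_M[where C = C]) (auto intro: order_trans[OF Cauchy bounds(2)])
  have "norm v * norm (grad f x) \<le> norm v * C" for x
    by (intro mult_left_mono bounds) auto
  then show "integrable M (\<lambda>\<omega>. v \<bullet> grad f (X \<omega>))"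
    by (intro integrable_M[where C = "norm v * C"]) (auto intro: order_trans[OF Cauchy])
  show "integrable \<nu>' (\<lambda>u. f (x + u) - f x)"
    using bounds(3) by (intro integrable_\<nu>') auto
  show "integrable M (\<lambda>\<omega>. LINT u|\<nu>'. f (X \<omega> + u) - f (X \<omega>))"
    using bounds(3) by (intro integrable_M[where C = "(2 * A + C) * K\<^sub>0"] integrable_\<nu>'(2)) auto
qed

text \<open>\<open>Phi \<epsilon>\<close>, the damped characteristic function along the ray, is
  differentiable because the Gaussian absorbs the growth of \<open>X\<close>. It is compared with
  \<open>exp psi\<close> by means of the integrating factor \<open>exp (- psi)\<close>.\<close>

lemma phi_eq_exp_psi:
  assumes stein: "\<And>f. schwartz f \<Longrightarrow>
      (LINT \<omega>|M. X \<omega> \<bullet> grad f (X \<omega>)) = (LINT \<omega>|M. b\<^sub>0 \<bullet> grad f (X \<omega>)) +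
        (LINT \<omega>|M. LINT u|\<nu>'. f (X \<omega> + u) - f (X \<omega>))"
  shows "phi \<xi> = exp (psi \<xi>)"
proof -
  define g :: "real \<Rightarrow> 'a \<Rightarrow> real" where "g \<epsilon> x = exp (- \<epsilon> * (x \<bullet> x))" for \<epsilon> x
  have [measurable]: "g \<epsilon> \<in> borel_measurable borel" for \<epsilon>
    unfolding g_def by measurable
  have g_le: "0 < g \<epsilon> x" "g \<epsilon> x \<le> 1" if "0 \<le> \<epsilon>" for \<epsilon> x
    using that by (auto simp: g_def)
  \<comment> \<open>The first of the estimates, uniform in \<open>x\<close>, that stand in for
    moments of \<open>X\<close>. It is \<open>y \<le> exp y\<close>; the linear version
    \<open>gl\<close> follows from \<open>2 * norm x \<le> 1 + x \<bullet> x\<close>.\<close>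
  have gq: "\<epsilon> * (x \<bullet> x) * g \<epsilon> x \<le> 1" for \<epsilon> x
  proof -
    have "\<epsilon> * (x \<bullet> x) \<le> exp (\<epsilon> * (x \<bullet> x))"
      using exp_ge_add_one_self[of "\<epsilon> * (x \<bullet> x)"] by linarith
    then show ?thesis
      by (simp add: g_def exp_minus field_simps)
  qed
  have gl: "\<epsilon> * norm x * g \<epsilon> x \<le> 1" if "0 \<le> \<epsilon>" "\<epsilon> \<le> 1" for \<epsilon> x
  proof -
    have "2 * norm x \<le> 1 + x \<bullet> x"
      using zero_le_power2[of "norm x - 1"]
      by (simp add: power2_diff power2_norm_eq_inner)
    then have "\<epsilon> * (2 * norm x) * g \<epsilon> x \<le> \<epsilon> * (1 + x \<bullet> x) * g \<epsilon> x"
      using that g_le(1)[of \<epsilon> x] by (intro mult_right_mono mult_left_mono) auto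
    also have "\<dots> = \<epsilon> * g \<epsilon> x + \<epsilon> * (x \<bullet> x) * g \<epsilon> x"
      by (simp add: algebra_simps)
    also have "\<dots> \<le> 1 + 1"
      using that g_le[of \<epsilon> x] by (intro add_mono gq mult_le_one) auto
    finally show ?thesis by simp
  qed
  have g_deriv: "(g \<epsilon> has_derivative (\<lambda>v. - 2 * \<epsilon> * (x \<bullet> v) * g \<epsilon> x)) (at x)" for \<epsilon> x
    unfolding g_def by (auto intro!: derivative_eq_intros simp: inner_commute algebra_simps)
  \<comment> \<open>\<open>g\<close> is at most 1 and its gradient has norm
    \<open>2 * \<epsilon> * norm x * g \<epsilon> x \<le> 2\<close> by \<open>gl\<close>, hence the
    constant \<open>2 * 1 + 2\<close>.\<close>
  have g_diff: "norm (g \<epsilon> (x + u) - g \<epsilon> x) \<le> (2 * 1 + 2) * min 1 (norm u)"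
    if "0 \<le> \<epsilon>" "\<epsilon> \<le> 1" for \<epsilon> x u
  proof (rule norm_diff_le_min[OF g_deriv])
    show "norm (- 2 * \<epsilon> * (x \<bullet> v) * g \<epsilon> x) \<le> 2 * norm v" for x v
    proof -
      have "norm (- 2 * \<epsilon> * (x \<bullet> v) * g \<epsilon> x) = 2 * (\<epsilon> * g \<epsilon> x * \<bar>x \<bullet> v\<bar>)"
        using that g_le(1)[of \<epsilon> x] by (simp add: abs_mult)
      also have "\<dots> \<le> 2 * (\<epsilon> * g \<epsilon> x * (norm x * norm v))"
        using that g_le(1)[of \<epsilon> x] by (intro mult_left_mono Cauchy_Schwarz_ineq2) auto
      also have "\<dots> = 2 * (\<epsilon> * norm x * g \<epsilon> x) * norm v" by simp
      also have "\<dots> \<le> 2 * 1 * norm v"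
        using that by (intro mult_right_mono mult_left_mono gl) auto
      finally show ?thesis by simp
    qed
    show "norm (g \<epsilon> x) \<le> 1" for x
      using g_le[of \<epsilon> x] that by simp
  qed
  define E :: "'a \<Rightarrow> real \<Rightarrow> 'a \<Rightarrow> complex" where "E \<eta> \<epsilon> x = iexp (\<eta> \<bullet> x) * g \<epsilon> x" for \<eta> \<epsilon> x
  have [measurable]: "E \<eta> \<epsilon> \<in> borel_measurable borel" for \<eta> \<epsilon>
    unfolding E_def by measurable
  \<comment> \<open>Real and imaginary part of \<open>E\<close> are Schwartz functions. The bracket
    is the result of differentiating \<open>E\<close> in the direction \<open>x - b\<^sub>0\<close>:
    the character yields the first term, the Gaussian the second.\<close>
  have stein_E: "(CLINT \<omega>|M. (\<i> * (\<eta> \<bullet> (X \<omega> - b\<^sub>0)) - 2 * \<epsilon> * (X \<omega> \<bullet> (X \<omega> - b\<^sub>0))) * E \<eta> \<epsilon> (X \<omega>))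
      = (CLINT \<omega>|M. CLINT u|\<nu>'. E \<eta> \<epsilon> (X \<omega> + u) - E \<eta> \<epsilon> (X \<omega>))"
    and int_E: "integrable M (\<lambda>\<omega>. (\<i> * (\<eta> \<bullet> (X \<omega> - b\<^sub>0)) - 2 * \<epsilon> * (X \<omega> \<bullet> (X \<omega> - b\<^sub>0))) * E \<eta> \<epsilon> (X \<omega>))"
    and int_E2: "integrable M (\<lambda>\<omega>. CLINT u|\<nu>'. E \<eta> \<epsilon> (X \<omega> + u) - E \<eta> \<epsilon> (X \<omega>))"
    and int_E3: "integrable \<nu>' (\<lambda>u. E \<eta> \<epsilon> (x + u) - E \<eta> \<epsilon> x)"
    if "0 < \<epsilon>" for \<eta> \<epsilon> x
  proof -
    let ?c = "\<lambda>x. cos (\<eta> \<bullet> x) * exp (- \<epsilon> * (x \<bullet> x))" and ?s = "\<lambda>x. sin (\<eta> \<bullet> x) * exp (- \<epsilon> * (x \<bullet> x))"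
    have c: "schwartz ?c" and s: "schwartz ?s"
      by (rule gauss_trig_schwartz[OF that gauss_trig.cos], rule gauss_trig_schwartz[OF that gauss_trig.sin])
    have gc: "grad ?c x = (- (sin (\<eta> \<bullet> x) * g \<epsilon> x)) *\<^sub>R \<eta> - (2 * \<epsilon> * cos (\<eta> \<bullet> x) * g \<epsilon> x) *\<^sub>R x" for x
      by (rule grad_eqI)
         (auto intro!: derivative_eq_intros simp: g_def inner_commute algebra_simps)
    have gs: "grad ?s x = (cos (\<eta> \<bullet> x) * g \<epsilon> x) *\<^sub>R \<eta> - (2 * \<epsilon> * sin (\<eta> \<bullet> x) * g \<epsilon> x) *\<^sub>R x" for x
      by (rule grad_eqI)
         (auto intro!: derivative_eq_intros simp: g_def inner_commute algebra_simps)
    have E_cs: "E \<eta> \<epsilon> x = of_real (?c x) + \<i> * of_real (?s x)" for x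
      by (simp add: E_def g_def cis_conv_exp[symmetric] cis.ctr complex_eq_iff exp_of_real[symmetric])
    have E_diff: "E \<eta> \<epsilon> (x + u) - E \<eta> \<epsilon> x = of_real (?c (x + u) - ?c x) + \<i> * of_real (?s (x + u) - ?s x)" for x u
      unfolding E_cs of_real_diff by (simp only: right_diff_distrib add_diff_add)
    have D_eq: "(\<i> * (\<eta> \<bullet> (x - b\<^sub>0)) - 2 * \<epsilon> * (x \<bullet> (x - b\<^sub>0))) * E \<eta> \<epsilon> x
        = of_real (x \<bullet> grad ?c x - b\<^sub>0 \<bullet> grad ?c x) + \<i> * of_real (x \<bullet> grad ?s x - b\<^sub>0 \<bullet> grad ?s x)" for x
      unfolding gc gs E_cs[unfolded g_def[symmetric]]
      by (simp add: complex_eq_iff inner_diff_right inner_commute algebra_simps)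
    note ic = integrable_schwartz[OF c] and is' = integrable_schwartz[OF s]
    show "integrable M (\<lambda>\<omega>. (\<i> * (\<eta> \<bullet> (X \<omega> - b\<^sub>0)) - 2 * \<epsilon> * (X \<omega> \<bullet> (X \<omega> - b\<^sub>0))) * E \<eta> \<epsilon> (X \<omega>))"
      unfolding D_eq using ic(1,2) is'(1,2)
      by (intro Bochner_Integration.integrable_add integrable_mult_right integrable_of_real
          Bochner_Integration.integrable_diff)
    show "integrable \<nu>' (\<lambda>u. E \<eta> \<epsilon> (x + u) - E \<eta> \<epsilon> x)"
      unfolding E_diff using ic(3) is'(3)
      by (intro Bochner_Integration.integrable_add integrable_mult_right integrable_of_real)
    have E2: "(CLINT u|\<nu>'. E \<eta> \<epsilon> (x + u) - E \<eta> \<epsilon> x)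
        = of_real (LINT u|\<nu>'. ?c (x + u) - ?c x) + \<i> * of_real (LINT u|\<nu>'. ?s (x + u) - ?s x)" for x
      unfolding E_diff using ic(3) is'(3)
      by (subst Bochner_Integration.integral_add)
         (auto simp only: integral_complex_of_real integral_mult_right_zero
           intro!: integrable_mult_right integrable_of_real)
    show "integrable M (\<lambda>\<omega>. CLINT u|\<nu>'. E \<eta> \<epsilon> (X \<omega> + u) - E \<eta> \<epsilon> (X \<omega>))"
      unfolding E2 using ic(4) is'(4)
      by (intro Bochner_Integration.integrable_add integrable_mult_right integrable_of_real)
    have "(CLINT \<omega>|M. (\<i> * (\<eta> \<bullet> (X \<omega> - b\<^sub>0)) - 2 * \<epsilon> * (X \<omega> \<bullet> (X \<omega> - b\<^sub>0))) * E \<eta> \<epsilon> (X \<omega>))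
      = of_real (LINT \<omega>|M. X \<omega> \<bullet> grad ?c (X \<omega>) - b\<^sub>0 \<bullet> grad ?c (X \<omega>))
        + \<i> * of_real (LINT \<omega>|M. X \<omega> \<bullet> grad ?s (X \<omega>) - b\<^sub>0 \<bullet> grad ?s (X \<omega>))"
      unfolding D_eq using ic(1,2) is'(1,2)
      by (subst Bochner_Integration.integral_add)
         (auto simp only: integral_complex_of_real integral_mult_right_zero
           intro!: integrable_mult_right integrable_of_real Bochner_Integration.integrable_diff)
    also have "(LINT \<omega>|M. X \<omega> \<bullet> grad ?c (X \<omega>) - b\<^sub>0 \<bullet> grad ?c (X \<omega>))
        = (LINT \<omega>|M. LINT u|\<nu>'. ?c (X \<omega> + u) - ?c (X \<omega>))"
      using stein[OF c] ic(1,2) by (subst Bochner_Integration.integral_diff) simp_all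
    also have "(LINT \<omega>|M. X \<omega> \<bullet> grad ?s (X \<omega>) - b\<^sub>0 \<bullet> grad ?s (X \<omega>))
        = (LINT \<omega>|M. LINT u|\<nu>'. ?s (X \<omega> + u) - ?s (X \<omega>))"
      using stein[OF s] ic(1,2) is'(1,2) by (subst Bochner_Integration.integral_diff) simp_all
    also have "of_real (LINT \<omega>|M. LINT u|\<nu>'. ?c (X \<omega> + u) - ?c (X \<omega>))
          + \<i> * of_real (LINT \<omega>|M. LINT u|\<nu>'. ?s (X \<omega> + u) - ?s (X \<omega>))
        = (CLINT \<omega>|M. CLINT u|\<nu>'. E \<eta> \<epsilon> (X \<omega> + u) - E \<eta> \<epsilon> (X \<omega>))"
      unfolding E2 using ic(4) is'(4)
      by (subst Bochner_Integration.integral_add)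
         (auto simp only: integral_complex_of_real integral_mult_right_zero
           intro!: integrable_mult_right integrable_of_real)
    finally show "(CLINT \<omega>|M. (\<i> * (\<eta> \<bullet> (X \<omega> - b\<^sub>0)) - 2 * \<epsilon> * (X \<omega> \<bullet> (X \<omega> - b\<^sub>0))) * E \<eta> \<epsilon> (X \<omega>))
      = (CLINT \<omega>|M. CLINT u|\<nu>'. E \<eta> \<epsilon> (X \<omega> + u) - E \<eta> \<epsilon> (X \<omega>))" .
  qed
  have int_E0: "integrable M (\<lambda>\<omega>. E \<eta> \<epsilon> (X \<omega>))" if "0 \<le> \<epsilon>" for \<eta> \<epsilon>
    using g_le[OF that] by (intro integrable_M[where C = 1]) (auto simp: E_def norm_mult abs_of_pos)
  define Phi where "Phi \<epsilon> t = (CLINT \<omega>|M. E (t *\<^sub>R \<xi>) \<epsilon> (X \<omega>))" for \<epsilon> t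
  define Phi' where "Phi' \<epsilon> t = (CLINT \<omega>|M. \<i> * (\<xi> \<bullet> X \<omega>) * E (t *\<^sub>R \<xi>) \<epsilon> (X \<omega>))" for \<epsilon> t
  have Phi_deriv: "(Phi \<epsilon> has_vector_derivative Phi' \<epsilon> t) (at t)" if \<epsilon>: "0 < \<epsilon>" "\<epsilon> \<le> 1" for \<epsilon> t
    unfolding Phi_def[abs_def] Phi'_def
  proof (rule has_vector_derivative_Bochner_integral[where S = UNIV
        and f = "\<lambda>t \<omega>. E (t *\<^sub>R \<xi>) \<epsilon> (X \<omega>)"
        and f' = "\<lambda>t \<omega>. \<i> * (\<xi> \<bullet> X \<omega>) * E (t *\<^sub>R \<xi>) \<epsilon> (X \<omega>)"
        and w = "\<lambda>_. norm \<xi> / \<epsilon>"])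
    show "((\<lambda>t. E (t *\<^sub>R \<xi>) \<epsilon> (X \<omega>)) has_vector_derivative
        \<i> * (\<xi> \<bullet> X \<omega>) * E (t *\<^sub>R \<xi>) \<epsilon> (X \<omega>)) (at t)" for t \<omega>
    proof -
      have "((\<lambda>t. iexp (t * (\<xi> \<bullet> X \<omega>)) * complex_of_real (g \<epsilon> (X \<omega>))) has_vector_derivative
        \<i> * (\<xi> \<bullet> X \<omega>) * iexp (t * (\<xi> \<bullet> X \<omega>)) * g \<epsilon> (X \<omega>)) (at t)"
        by (intro has_vector_derivative_mult_left has_vector_derivative_iexp)
           (auto intro!: derivative_eq_intros)
      then show ?thesis by (simp add: E_def mult.assoc)
    qed
    show "norm (\<i> * (\<xi> \<bullet> X \<omega>) * E (t *\<^sub>R \<xi>) \<epsilon> (X \<omega>)) \<le> norm \<xi> / \<epsilon>" for t \<omega>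
    proof -
      have "norm (\<i> * (\<xi> \<bullet> X \<omega>) * E (t *\<^sub>R \<xi>) \<epsilon> (X \<omega>)) = \<bar>\<xi> \<bullet> X \<omega>\<bar> * g \<epsilon> (X \<omega>)"
        using g_le(1)[of \<epsilon> "X \<omega>"] \<epsilon> by (simp add: E_def norm_mult)
      also have "\<dots> \<le> norm \<xi> * norm (X \<omega>) * g \<epsilon> (X \<omega>)"
        using g_le(1)[of \<epsilon> "X \<omega>"] \<epsilon> by (intro mult_right_mono Cauchy_Schwarz_ineq2) auto
      also have "\<dots> = norm \<xi> / \<epsilon> * (\<epsilon> * norm (X \<omega>) * g \<epsilon> (X \<omega>))"
        using \<epsilon> by simp
      also have "\<dots> \<le> norm \<xi> / \<epsilon> * 1"
        using \<epsilon> by (intro mult_left_mono gl) auto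
      finally show ?thesis by simp
    qed
  qed (use \<epsilon> int_E0 in auto)
  \<comment> \<open>The error from differentiating the Gaussian factor: uniformly bounded, and
    pointwise of order \<epsilon>.\<close>
  have quad: "\<bar>2 * \<epsilon> * (x \<bullet> (x - b\<^sub>0))\<bar> * g \<epsilon> x \<le> 2 * (1 + norm b\<^sub>0)" if "0 \<le> \<epsilon>" "\<epsilon> \<le> 1" for \<epsilon> x
  proof -
    have "\<bar>2 * \<epsilon> * (x \<bullet> (x - b\<^sub>0))\<bar> * g \<epsilon> x = 2 * (\<epsilon> * \<bar>x \<bullet> x - x \<bullet> b\<^sub>0\<bar> * g \<epsilon> x)"
      using that by (simp add: abs_mult inner_diff_right)
    also have "\<bar>x \<bullet> x - x \<bullet> b\<^sub>0\<bar> \<le> x \<bullet> x + norm x * norm b\<^sub>0"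
      using Cauchy_Schwarz_ineq2[of x b\<^sub>0] inner_ge_zero[of x] by linarith
    also have "\<epsilon> * (x \<bullet> x + norm x * norm b\<^sub>0) * g \<epsilon> x
        = \<epsilon> * (x \<bullet> x) * g \<epsilon> x + \<epsilon> * norm x * g \<epsilon> x * norm b\<^sub>0"
      by (simp add: algebra_simps)
    also have "\<dots> \<le> 1 + 1 * norm b\<^sub>0"
      using that by (intro add_mono gq mult_right_mono gl) auto
    finally show ?thesis
      using that g_le(1)[of \<epsilon> x] by (simp add: mult_left_mono mult_right_mono)
  qed
  \<comment> \<open>The error from the Gaussian in the jump term, after the oscillation has been
    removed.\<close>
  define H where "H \<epsilon> x = (LINT u|\<nu>'. \<bar>g \<epsilon> (x + u) - g \<epsilon> x\<bar>)" for \<epsilon> x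
  have H: "integrable \<nu>' (\<lambda>u. \<bar>g \<epsilon> (x + u) - g \<epsilon> x\<bar>)" "norm (H \<epsilon> x) \<le> (2 * 1 + 2) * K\<^sub>0"
    if "0 \<le> \<epsilon>" "\<epsilon> \<le> 1" for \<epsilon> x
    unfolding H_def using g_diff[OF that]
    by (intro integrable_\<nu>'(1)[where C = "2 * 1 + 2"] integrable_\<nu>'(2); simp)+
  have [measurable]: "H \<epsilon> \<in> borel_measurable borel" for \<epsilon>
    unfolding H_def[abs_def] by measurable
  define \<rho> where "\<rho> \<epsilon> = (LINT \<omega>|M. \<bar>2 * \<epsilon> * (X \<omega> \<bullet> (X \<omega> - b\<^sub>0))\<bar> * g \<epsilon> (X \<omega>)) + (LINT \<omega>|M. H \<epsilon> (X \<omega>))" for \<epsilon>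
  \<comment> \<open>On the left is the residual of \<open>Phi \<epsilon>\<close> in the differential
    equation that \<open>exp psi\<close> solves along the ray.\<close>
  have key: "norm (t * Phi' \<epsilon> t - (\<i> * (t * (b\<^sub>0 \<bullet> \<xi>)) + jump (t *\<^sub>R \<xi>)) * Phi \<epsilon> t) \<le> \<rho> \<epsilon>"
    if \<epsilon>: "0 < \<epsilon>" "\<epsilon> \<le> 1" for \<epsilon> t
  proof -
    define \<eta> where "\<eta> = t *\<^sub>R \<xi>"
    let ?A = "\<lambda>x. (\<i> * (\<eta> \<bullet> (x - b\<^sub>0)) - 2 * \<epsilon> * (x \<bullet> (x - b\<^sub>0))) * E \<eta> \<epsilon> x"
    let ?B = "\<lambda>x. of_real (2 * \<epsilon> * (x \<bullet> (x - b\<^sub>0))) * E \<eta> \<epsilon> x"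
    let ?C = "\<lambda>x. (CLINT u|\<nu>'. E \<eta> \<epsilon> (x + u) - E \<eta> \<epsilon> x)"
    have norm_E: "norm (E \<eta> \<epsilon> x) = g \<epsilon> x" for x
      using g_le(1)[of \<epsilon> x] \<epsilon> by (simp add: E_def norm_mult)
    have normB: "norm (?B x) = \<bar>2 * \<epsilon> * (x \<bullet> (x - b\<^sub>0))\<bar> * g \<epsilon> x" for x
      by (simp only: norm_mult norm_E norm_of_real abs_mult)
    have intB: "integrable M (\<lambda>\<omega>. ?B (X \<omega>))"
      using \<epsilon> normB quad by (intro integrable_M[where C = "2 * (1 + norm b\<^sub>0)"]) auto
    have intE: "integrable M (\<lambda>\<omega>. E \<eta> \<epsilon> (X \<omega>))"
      using int_E0 \<epsilon> by simp
    have "t * Phi' \<epsilon> t = (CLINT \<omega>|M. t * (\<i> * (\<xi> \<bullet> X \<omega>) * E \<eta> \<epsilon> (X \<omega>)))"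
      unfolding Phi'_def \<eta>_def by (rule integral_mult_right_zero[symmetric])
    also have "\<dots> = (CLINT \<omega>|M. ?A (X \<omega>) + (?B (X \<omega>) + \<i> * (t * (b\<^sub>0 \<bullet> \<xi>)) * E \<eta> \<epsilon> (X \<omega>)))"
      by (intro Bochner_Integration.integral_cong)
         (simp_all add: \<eta>_def inner_diff_right inner_commute algebra_simps)
    also have "\<dots> = (CLINT \<omega>|M. ?A (X \<omega>)) + ((CLINT \<omega>|M. ?B (X \<omega>)) + \<i> * (t * (b\<^sub>0 \<bullet> \<xi>)) * Phi \<epsilon> t)"
      unfolding Phi_def \<eta>_def[symmetric] using int_E[OF \<epsilon>(1)] intB intE
      by (simp add: Bochner_Integration.integral_add)
    also have "(CLINT \<omega>|M. ?A (X \<omega>)) = (CLINT \<omega>|M. ?C (X \<omega>))"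
      by (rule stein_E[OF \<epsilon>(1)])
    finally have "t * Phi' \<epsilon> t - (\<i> * (t * (b\<^sub>0 \<bullet> \<xi>)) + jump \<eta>) * Phi \<epsilon> t
        = (CLINT \<omega>|M. ?B (X \<omega>)) + ((CLINT \<omega>|M. ?C (X \<omega>)) - jump \<eta> * Phi \<epsilon> t)"
      by (simp add: algebra_simps)
    also have "(CLINT \<omega>|M. ?C (X \<omega>)) - jump \<eta> * Phi \<epsilon> t = (CLINT \<omega>|M. ?C (X \<omega>) - jump \<eta> * E \<eta> \<epsilon> (X \<omega>))"
      unfolding Phi_def \<eta>_def[symmetric] using int_E2[OF \<epsilon>(1)] intE
      by (simp add: Bochner_Integration.integral_diff)
    finally have eq: "t * Phi' \<epsilon> t - (\<i> * (t * (b\<^sub>0 \<bullet> \<xi>)) + jump \<eta>) * Phi \<epsilon> t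
        = (CLINT \<omega>|M. ?B (X \<omega>)) + (CLINT \<omega>|M. ?C (X \<omega>) - jump \<eta> * E \<eta> \<epsilon> (X \<omega>))" .
    \<comment> \<open>Product rule for differences: subtracting
      \<open>(iexp (\<eta> \<bullet> u) - 1) * E \<eta> \<epsilon> x\<close> leaves the character at
      \<open>x + u\<close> times an increment of the Gaussian, whose modulus does not involve
      \<open>\<eta>\<close>.\<close>
    have C: "?C x - jump \<eta> * E \<eta> \<epsilon> x = (CLINT u|\<nu>'. iexp (\<eta> \<bullet> (x + u)) * (g \<epsilon> (x + u) - g \<epsilon> x))" for x
    proof -
      have "?C x - jump \<eta> * E \<eta> \<epsilon> x = ?C x - (CLINT u|\<nu>'. (iexp (\<eta> \<bullet> u) - 1) * E \<eta> \<epsilon> x)"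
        unfolding jump_def by simp
      also have "\<dots> = (CLINT u|\<nu>'. (E \<eta> \<epsilon> (x + u) - E \<eta> \<epsilon> x) - (iexp (\<eta> \<bullet> u) - 1) * E \<eta> \<epsilon> x)"
        using int_E3[OF \<epsilon>(1)] integrable_jump
        by (intro Bochner_Integration.integral_diff[symmetric]) auto
      also have "\<dots> = (CLINT u|\<nu>'. iexp (\<eta> \<bullet> (x + u)) * (g \<epsilon> (x + u) - g \<epsilon> x))"
        by (intro Bochner_Integration.integral_cong)
           (simp_all add: E_def inner_add_right distrib_left exp_add algebra_simps)
      finally show ?thesis .
    qed
    have "norm (CLINT \<omega>|M. ?B (X \<omega>)) \<le> (LINT \<omega>|M. \<bar>2 * \<epsilon> * (X \<omega> \<bullet> (X \<omega> - b\<^sub>0))\<bar> * g \<epsilon> (X \<omega>))"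
      using integrable_norm[OF intB] by (intro norm_integral_le) (simp_all only: normB order_refl)
    moreover have "norm (CLINT \<omega>|M. ?C (X \<omega>) - jump \<eta> * E \<eta> \<epsilon> (X \<omega>)) \<le> (LINT \<omega>|M. H \<epsilon> (X \<omega>))"
    proof (rule norm_integral_le)
      show "integrable M (\<lambda>\<omega>. H \<epsilon> (X \<omega>))"
        using H(2)[of \<epsilon>] \<epsilon> by (intro integrable_M[where C = "(2 * 1 + 2) * K\<^sub>0"]) auto
      show "norm (?C (X \<omega>) - jump \<eta> * E \<eta> \<epsilon> (X \<omega>)) \<le> H \<epsilon> (X \<omega>)" for \<omega>
        unfolding C H_def using H(1)[of \<epsilon>] \<epsilon>
        by (intro norm_integral_le) (auto simp: norm_mult of_real_diff[symmetric] simp del: of_real_diff)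
    qed
    ultimately show ?thesis
      unfolding \<eta>_def[symmetric] eq \<rho>_def by (rule norm_triangle_mono)
  qed
  define e :: "nat \<Rightarrow> real" where "e n = inverse (Suc n)" for n
  have e: "0 < e n" "e n \<le> 1" for n
    by (auto simp: e_def inverse_le_1_iff)
  have e_lim: "e \<longlonglongrightarrow> 0"
    unfolding e_def[abs_def] by (rule LIMSEQ_inverse_real_of_nat)
  have g_lim: "(\<lambda>n. g (e n) x) \<longlonglongrightarrow> 1" for x
  proof -
    have "(\<lambda>n. exp (- e n * (x \<bullet> x))) \<longlonglongrightarrow> exp (- 0 * (x \<bullet> x))"
      by (intro tendsto_intros e_lim)
    then show ?thesis by (simp add: g_def)
  qed
  have \<rho>_lim: "(\<lambda>n. \<rho> (e n)) \<longlonglongrightarrow> 0"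
  proof -
    have "(\<lambda>n. LINT \<omega>|M. \<bar>2 * e n * (X \<omega> \<bullet> (X \<omega> - b\<^sub>0))\<bar> * g (e n) (X \<omega>)) \<longlonglongrightarrow> (LINT \<omega>|M. 0)"
    proof (rule integral_dominated_convergence[where w = "\<lambda>_. 2 * (1 + norm b\<^sub>0)"])
      have "(\<lambda>n. \<bar>2 * e n * (x \<bullet> (x - b\<^sub>0))\<bar> * g (e n) x) \<longlonglongrightarrow> \<bar>2 * 0 * (x \<bullet> (x - b\<^sub>0))\<bar> * 1" for x
        by (intro tendsto_intros e_lim g_lim)
      then show "AE \<omega> in M. (\<lambda>n. \<bar>2 * e n * (X \<omega> \<bullet> (X \<omega> - b\<^sub>0))\<bar> * g (e n) (X \<omega>)) \<longlonglongrightarrow> 0" by simp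
      show "AE \<omega> in M. norm (\<bar>2 * e n * (X \<omega> \<bullet> (X \<omega> - b\<^sub>0))\<bar> * g (e n) (X \<omega>)) \<le> 2 * (1 + norm b\<^sub>0)" for n
        using quad[of "e n"] e[of n] g_le(1)[of "e n"]
        by (intro AE_I2) (simp add: abs_mult less_imp_le)
    qed auto
    moreover have "(\<lambda>n. LINT \<omega>|M. H (e n) (X \<omega>)) \<longlonglongrightarrow> (LINT \<omega>|M. 0)"
    proof (rule integral_dominated_convergence[where w = "\<lambda>_. (2 * 1 + 2) * K\<^sub>0"])
      have "(\<lambda>n. H (e n) x) \<longlonglongrightarrow> (LINT u|\<nu>'. 0)" for x
        unfolding H_def
      proof (rule integral_dominated_convergence[where w = "\<lambda>u. (2 * 1 + 2) * min 1 (norm u)"])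
        have "(\<lambda>n. \<bar>g (e n) (x + u) - g (e n) x\<bar>) \<longlonglongrightarrow> \<bar>1 - 1\<bar>" for u
          by (intro tendsto_intros g_lim)
        then show "AE u in \<nu>'. (\<lambda>n. \<bar>g (e n) (x + u) - g (e n) x\<bar>) \<longlonglongrightarrow> 0" by simp
        show "AE u in \<nu>'. norm \<bar>g (e n) (x + u) - g (e n) x\<bar> \<le> (2 * 1 + 2) * min 1 (norm u)" for n
          using g_diff[of "e n" x] e[of n] by (intro AE_I2) simp
      qed (use integrable_\<nu>'_min in auto)
      then show "AE \<omega> in M. (\<lambda>n. H (e n) (X \<omega>)) \<longlonglongrightarrow> 0" by simp
      show "AE \<omega> in M. norm (H (e n) (X \<omega>)) \<le> (2 * 1 + 2) * K\<^sub>0" for n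
        using H(2)[of "e n"] e[of n] by (intro AE_I2) (simp add: less_imp_le)
    qed auto
    ultimately show ?thesis
      unfolding \<rho>_def using tendsto_add by fastforce
  qed
  have Phi_lim: "(\<lambda>n. Phi (e n) t) \<longlonglongrightarrow> phi (t *\<^sub>R \<xi>)" for t
    unfolding Phi_def phi_def
  proof (rule integral_dominated_convergence[where w = "\<lambda>_. 1"])
    have "(\<lambda>n. E \<eta> (e n) x) \<longlonglongrightarrow> iexp (\<eta> \<bullet> x) * complex_of_real 1" for \<eta> x
      unfolding E_def by (intro tendsto_intros g_lim)
    then show "AE \<omega> in M. (\<lambda>n. E (t *\<^sub>R \<xi>) (e n) (X \<omega>)) \<longlonglongrightarrow> iexp ((t *\<^sub>R \<xi>) \<bullet> X \<omega>)"
      by (intro AE_I2) (simp only: of_real_1 mult_1_right)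
    show "AE \<omega> in M. norm (E (t *\<^sub>R \<xi>) (e n) (X \<omega>)) \<le> 1" for n
      using g_le[of "e n"] e[of n] by (intro AE_I2) (simp add: E_def norm_mult less_imp_le)
  qed auto
  \<comment> \<open>For an exact solution the product would be constant. Here its derivative on
    \<open>{s..1}\<close> is at most \<open>\<rho> (e n) / s * B\<close>, so the increment of the
    damped product vanishes in the limit.\<close>
  have const: "phi (s *\<^sub>R \<xi>) * exp (- psi (s *\<^sub>R \<xi>)) = phi \<xi> * exp (- psi \<xi>)" if s: "0 < s" "s < 1" for s
  proof -
    let ?P = "\<lambda>t. psi (t *\<^sub>R \<xi>)" and ?P' = "\<lambda>t. \<i> * (b\<^sub>0 \<bullet> \<xi>) + jump (t *\<^sub>R \<xi>) / t"
    have P: "(?P has_vector_derivative ?P' t) (at t)" if "s \<le> t" for t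
      using psi_has_vector_derivative[of t] that s by simp
    have expP: "((\<lambda>t. exp (- ?P t)) has_vector_derivative - ?P' t * exp (- ?P t)) (at t)" if "s \<le> t" for t
    proof -
      have "(exp has_field_derivative exp (- ?P t)) (at (- ?P t))"
        by (rule DERIV_exp)
      from field_vector_diff_chain_at[OF has_vector_derivative_minus[OF P[OF that]] this]
      show ?thesis by (simp add: comp_def)
    qed
    have "continuous_on {s..1} (\<lambda>t. exp (- ?P t))"
      using expP by (intro continuous_at_imp_continuous_on ballI) (auto intro: has_vector_derivative_continuous)
    then have "bounded ((\<lambda>t. exp (- ?P t)) ` {s..1})"
      by (intro compact_imp_bounded compact_continuous_image) auto
    then obtain B where B: "0 < B" "\<And>t. t \<in> {s..1} \<Longrightarrow> norm (exp (- ?P t)) \<le> B"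
      by (auto simp: bounded_pos)
    define \<Psi> where "\<Psi> n t = Phi (e n) t * exp (- ?P t)" for n t
    have bound: "norm (\<Psi> n 1 - \<Psi> n s) \<le> (\<rho> (e n) / s * B) * norm (1 - s)" for n
    proof (rule differentiable_bound[of "{s..1}"])
      fix t assume t: "t \<in> {s..1}"
      let ?D = "Phi (e n) t * (- ?P' t * exp (- ?P t)) + Phi' (e n) t * exp (- ?P t)"
      have "(\<Psi> n has_vector_derivative ?D) (at t)"
        unfolding \<Psi>_def[abs_def] using t
        by (intro has_vector_derivative_mult Phi_deriv e expP) auto
      then show "(\<Psi> n has_derivative (\<lambda>h. h *\<^sub>R ?D)) (at t within {s..1})"
        using has_vector_derivative_at_within unfolding has_vector_derivative_def by blast
      \<comment> \<open>Extracting \<open>1 / t\<close> exhibits the residual bounded in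
        \<open>key\<close>; \<open>t \<ge> s\<close> gives the denominator.\<close>
      have "?D = (t * Phi' (e n) t - (\<i> * (t * (b\<^sub>0 \<bullet> \<xi>)) + jump (t *\<^sub>R \<xi>)) * Phi (e n) t) / t * exp (- ?P t)"
        using t s by (simp add: field_simps)
      also have "norm \<dots> \<le> \<rho> (e n) / s * B"
        unfolding norm_mult norm_divide norm_of_real
        using t s B(2)[OF t] key[OF e, of t n] order_trans[OF norm_ge_zero key[OF e, of t n]]
        by (intro mult_mono frac_le) auto
      finally have D: "norm ?D \<le> \<rho> (e n) / s * B" .
      show "onorm (\<lambda>h. h *\<^sub>R ?D) \<le> \<rho> (e n) / s * B"
      proof (rule onorm_le)
        show "norm (h *\<^sub>R ?D) \<le> \<rho> (e n) / s * B * norm h" for h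
          using mult_right_mono[OF D, of "norm h"] by (simp add: mult.commute)
      qed
    qed (use s in auto)
    have "(\<lambda>n. \<Psi> n 1 - \<Psi> n s) \<longlonglongrightarrow> 0"
    proof (rule Lim_null_comparison)
      show "eventually (\<lambda>n. norm (\<Psi> n 1 - \<Psi> n s) \<le> (\<rho> (e n) / s * B) * norm (1 - s)) sequentially"
        using bound by simp
      have "(\<lambda>n. (\<rho> (e n) / s * B) * norm (1 - s)) \<longlonglongrightarrow> (0 / s * B) * norm (1 - s)"
        using s by (intro tendsto_intros \<rho>_lim) auto
      then show "(\<lambda>n. (\<rho> (e n) / s * B) * norm (1 - s)) \<longlonglongrightarrow> 0" by simp
    qed
    moreover have "(\<lambda>n. \<Psi> n 1 - \<Psi> n s) \<longlonglongrightarrow>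
        phi (1 *\<^sub>R \<xi>) * exp (- psi (1 *\<^sub>R \<xi>)) - phi (s *\<^sub>R \<xi>) * exp (- psi (s *\<^sub>R \<xi>))"
      unfolding \<Psi>_def by (intro tendsto_intros Phi_lim)
    ultimately show ?thesis
      using LIMSEQ_unique by fastforce
  qed
  \<comment> \<open>Starting at 1/2 rather than 1, since \<open>const\<close> asks for
    \<open>s < 1\<close>.\<close>
  have h: "(\<lambda>n. inverse (real (Suc (Suc n)))) \<longlonglongrightarrow> 0"
    using LIMSEQ_inverse_real_of_nat by (rule LIMSEQ_Suc)
  have "(\<lambda>n. phi (inverse (real (Suc (Suc n))) *\<^sub>R \<xi>) * exp (- psi (inverse (real (Suc (Suc n))) *\<^sub>R \<xi>)))
      \<longlonglongrightarrow> 1 * exp (- 0)"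
    by (intro tendsto_intros tendsto_phi_psi_0 h)
  moreover have "phi (inverse (real (Suc (Suc n))) *\<^sub>R \<xi>) * exp (- psi (inverse (real (Suc (Suc n))) *\<^sub>R \<xi>))
      = phi \<xi> * exp (- psi \<xi>)" for n
    by (rule const) (auto simp: inverse_less_1_iff)
  ultimately have "phi \<xi> * exp (- psi \<xi>) = 1"
    by (simp add: LIMSEQ_const_iff)
  then show ?thesis
    by (simp add: exp_minus field_simps)
qed

end

subsection \<open>From the characteristic function to the integral identity\<close>

text \<open>All exchanges of integrals below have a majorant of product form, including those over
  infinite measures such as \<open>lborel\<close> and \<open>\<nu>'\<close>.\<close>

lemma (in pair_sigma_finite) Fubini_product_bound:
  fixes f :: "'a \<Rightarrow> 'b \<Rightarrow> 'c::{banach, second_countable_topology}"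
  assumes f: "case_prod f \<in> borel_measurable (M1 \<Otimes>\<^sub>M M2)"
    and p: "integrable M1 p" and q: "integrable M2 q"
    and bound: "\<And>x y. norm (f x y) \<le> p x * q y"
  shows "(\<integral>y. (\<integral>x. f x y \<partial>M1) \<partial>M2) = (\<integral>x. (\<integral>y. f x y \<partial>M2) \<partial>M1)"
proof (rule Fubini_integral)
  have [measurable]: "p \<in> borel_measurable M1" "q \<in> borel_measurable M2"
    using p q by auto
  have "integrable (M1 \<Otimes>\<^sub>M M2) (\<lambda>(x, y). p x * q y)"
  proof (rule Fubini_integrable)
    have "integrable M1 (\<lambda>x. norm (p x) * (\<integral>y. norm (q y) \<partial>M2))"
      using p by (intro integrable_mult_left integrable_norm)
    then show "integrable M1 (\<lambda>x. \<integral>y. norm (case (x, y) of (x, y) \<Rightarrow> p x * q y) \<partial>M2)"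
      by (simp only: case_prod_conv norm_mult integral_mult_right_zero)
  qed (use q in auto)
  then show "integrable (M1 \<Otimes>\<^sub>M M2) (case_prod f)"
    by (rule Bochner_Integration.integrable_bound)
       (use f bound in \<open>auto intro!: AE_I2 intro: order_trans[OF _ abs_ge_self]\<close>)
qed

text \<open>Left unnormalised, this is exactly the characteristic function of
  \<open>std_gauss\<close>. Its total mass is carried along as a factor and divided out at the
  end.\<close>

abbreviation gauss :: "'a::euclidean_space \<Rightarrow> real" where
  "gauss y \<equiv> exp (- (y \<bullet> y) / 2)"

lemma integrable_gauss:
  "integrable lborel (\<lambda>y::'a::euclidean_space. gauss y)"
  "integrable lborel (\<lambda>y::'a::euclidean_space. (1 + \<delta> * norm y) * gauss y)"
proof -
  have *: "(1 + norm y) ^ n * gauss y = (1 + norm y) ^ n * exp (- (1 / 2) * (y \<bullet> y))" for y :: 'a and n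
    by simp
  obtain B where B: "\<And>y::'a. (1 + norm y) ^ (2 * DIM('a)) * gauss y \<le> B"
    unfolding * by (rule power_gauss_bounded[where 'a = 'a, of "1 / 2" "2 * DIM('a)"]) auto
  show 1: "integrable lborel (\<lambda>y::'a. gauss y)"
    using B by (intro integrable_lborel_decay) auto
  obtain C where C: "\<And>y::'a. (1 + norm y) ^ Suc (2 * DIM('a)) * gauss y \<le> C"
    unfolding * by (rule power_gauss_bounded[where 'a = 'a, of "1 / 2" "Suc (2 * DIM('a))"]) auto
  have 2: "integrable lborel (\<lambda>y::'a. norm y * gauss y)"
  proof (rule integrable_lborel_decay)
    fix y :: 'a
    have "(1 + norm y) ^ (2 * DIM('a)) * norm (norm y * gauss y)
        \<le> (1 + norm y) ^ (2 * DIM('a)) * ((1 + norm y) * gauss y)"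
      by (intro mult_left_mono) (auto simp: abs_mult)
    also have "\<dots> = (1 + norm y) ^ Suc (2 * DIM('a)) * gauss y"
      by simp
    also have "\<dots> \<le> C" by (rule C)
    finally show "(1 + norm y) ^ (2 * DIM('a)) * norm (norm y * gauss y) \<le> C" .
  qed measurable
  have "(\<lambda>y::'a. (1 + \<delta> * norm y) * gauss y) = (\<lambda>y. gauss y + \<delta> * (norm y * gauss y))"
    by (auto simp: algebra_simps)
  with 1 2 show "integrable lborel (\<lambda>y::'a. (1 + \<delta> * norm y) * gauss y)"
    by simp
qed

lemma integral_gauss_pos: "0 < (LINT y::'a::euclidean_space|lborel. gauss y)"
proof -
  have "(LINT y::'a|lborel. gauss y) \<noteq> 0"
  proof
    assume "(LINT y::'a|lborel. gauss y) = 0"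
    then have "AE y::'a in lborel. gauss y = 0"
      by (subst (asm) integral_nonneg_eq_0_iff_AE[OF integrable_gauss(1)]) auto
    then have "AE y::'a in lborel. False" by simp
    then show False
      by (simp add: AE_iff_measurable[where N = UNIV])
  qed
  moreover have "0 \<le> (LINT y::'a|lborel. gauss y)"
    by (intro Bochner_Integration.integral_nonneg) simp
  ultimately show ?thesis by (metis less_eq_real_def)
qed

lemma integral_lborel_affine:
  fixes F :: "'a::euclidean_space \<Rightarrow> 'b::{banach, second_countable_topology}"
  assumes [measurable]: "F \<in> borel_measurable borel" and c: "0 < c"
  shows "integral\<^sup>L lborel F = c ^ DIM('a) *\<^sub>R (\<integral>y. F (x + c *\<^sub>R y) \<partial>lborel)"
proof -
  have "lborel = density (distr lborel borel (\<lambda>y. x + c *\<^sub>R y)) (\<lambda>_. ennreal (c ^ DIM('a)))"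
    using lborel_affine[of c x] c by (simp add: ennreal_power)
  then have "integral\<^sup>L lborel F = integral\<^sup>L (density (distr lborel borel (\<lambda>y. x + c *\<^sub>R y)) (\<lambda>_. ennreal (c ^ DIM('a)))) F"
    by simp
  also have "\<dots> = c ^ DIM('a) *\<^sub>R (\<integral>y. F (x + c *\<^sub>R y) \<partial>lborel)"
    using c by (subst integral_density) (auto simp: integral_distr)
  finally show ?thesis .
qed

section \<open>Gaussian mollification of a Schwartz function\<close>

definition smooth :: "('a::euclidean_space \<Rightarrow> real) \<Rightarrow> real \<Rightarrow> 'a \<Rightarrow> real" where
  "smooth f \<delta> x = (LINT y|lborel. f (x + \<delta> *\<^sub>R y) * gauss y)"

definition dsmooth :: "('a::euclidean_space \<Rightarrow> real) \<Rightarrow> real \<Rightarrow> 'a \<Rightarrow> 'a \<Rightarrow> real" where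
  "dsmooth f \<delta> x v = (LINT y|lborel. (grad f (x + \<delta> *\<^sub>R y) \<bullet> v) * gauss y)"

text \<open>Up to normalisation the Fourier transform of \<open>f\<close> at the frequency
  \<open>z / \<delta>\<close>; the power of \<open>\<delta>\<close> is the Jacobian of
  \<open>w = x + \<delta> y\<close>.\<close>

definition smooth_symbol :: "('a::euclidean_space \<Rightarrow> real) \<Rightarrow> real \<Rightarrow> 'a \<Rightarrow> complex" where
  "smooth_symbol f \<delta> z = (1 / \<delta> ^ DIM('a)) * (CLINT w|lborel. f w * iexp (- (z \<bullet> w) / \<delta>))"

context
  fixes f :: "'a::euclidean_space \<Rightarrow> real"
  assumes f: "schwartz f"
begin

lemma schwartz_measurable [measurable]: "f \<in> borel_measurable borel" "grad f \<in> borel_measurable borel"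
  using schwartz_continuous[OF f] by (auto intro: borel_measurable_continuous_onI)

lemma schwartz_integrable: "integrable lborel f"
proof -
  obtain C where "\<And>x. (1 + norm x) ^ (2 * DIM('a)) * \<bar>f x\<bar> \<le> C"
    using schwartz_bound[OF f] by blast
  then show ?thesis
    by (intro integrable_lborel_decay) auto
qed

lemma smooth_symbol_measurable [measurable]: "smooth_symbol f \<delta> \<in> borel_measurable borel"
  unfolding smooth_symbol_def[abs_def] by measurable

lemma smooth_symbol_bound:
  assumes "0 < \<delta>"
  obtains B where "0 \<le> B" "\<And>z. norm (smooth_symbol f \<delta> z) \<le> B"
proof
  have "norm (CLINT w|lborel. f w * iexp (- (z \<bullet> w) / \<delta>)) \<le> (LINT w|lborel. \<bar>f w\<bar>)" for z
    by (rule norm_integral_le) (use schwartz_integrable in \<open>auto simp: norm_mult simp del: of_real_divide of_real_minus\<close>)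
  then show "norm (smooth_symbol f \<delta> z) \<le> (1 / \<delta> ^ DIM('a)) * (LINT w|lborel. \<bar>f w\<bar>)" for z
    unfolding smooth_symbol_def using assms
    by (simp add: norm_mult norm_divide norm_power mult_left_mono divide_right_mono)
  show "0 \<le> (1 / \<delta> ^ DIM('a)) * (LINT w|lborel. \<bar>f w\<bar>)"
    using assms by simp
qed

text \<open>After the substitution \<open>w = x + \<delta> y\<close> the kernel is
  \<open>gauss\<close> at \<open>(x - w) / \<delta>\<close>, which \<open>char_std_gauss\<close>
  expands into characters. Exchanging the integrals collects all that depends on \<open>w\<close> in
  the symbol.\<close>

lemma smooth_eq:
  assumes \<delta>: "0 < \<delta>"
  shows "complex_of_real (smooth f \<delta> x)
    = (CLINT z|std_gauss. smooth_symbol f \<delta> z * iexp (((1 / \<delta>) *\<^sub>R z) \<bullet> x))"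
proof -
  interpret G: prob_space "std_gauss :: 'a measure"
    by (rule prob_space_std_gauss)
  interpret pair_sigma_finite "lborel :: 'a measure" "std_gauss :: 'a measure" ..
  let ?k = "\<lambda>w z. complex_of_real (f w) * iexp (z \<bullet> ((1 / \<delta>) *\<^sub>R (x - w)))"
  have "(LINT w|lborel. f w * gauss ((1 / \<delta>) *\<^sub>R (x - w)))
    = \<delta> ^ DIM('a) *\<^sub>R (LINT y|lborel. f (x + \<delta> *\<^sub>R y) * gauss ((1 / \<delta>) *\<^sub>R (x - (x + \<delta> *\<^sub>R y))))"
    using \<delta> by (intro integral_lborel_affine) measurable
  also have "(LINT y|lborel. f (x + \<delta> *\<^sub>R y) * gauss ((1 / \<delta>) *\<^sub>R (x - (x + \<delta> *\<^sub>R y)))) = smooth f \<delta> x"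
    unfolding smooth_def using \<delta> by (intro Bochner_Integration.integral_cong) auto
  finally have "smooth f \<delta> x = (1 / \<delta> ^ DIM('a)) * (LINT w|lborel. f w * gauss ((1 / \<delta>) *\<^sub>R (x - w)))"
    using \<delta> by simp
  then have "complex_of_real (smooth f \<delta> x)
      = (1 / \<delta> ^ DIM('a)) * (CLINT w|lborel. complex_of_real (f w) * complex_of_real (gauss ((1 / \<delta>) *\<^sub>R (x - w))))"
    by (simp add: integral_complex_of_real[symmetric] del: integral_complex_of_real)
  also have "(CLINT w|lborel. complex_of_real (f w) * complex_of_real (gauss ((1 / \<delta>) *\<^sub>R (x - w))))
      = (CLINT w|lborel. CLINT z|std_gauss. ?k w z)"
    by (simp only: char_std_gauss[symmetric] integral_mult_right_zero)
  also have "\<dots> = (CLINT z|std_gauss. CLINT w|lborel. ?k w z)"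
  proof (rule Fubini_product_bound[symmetric])
    show "integrable lborel (\<lambda>w. \<bar>f w\<bar>)" using schwartz_integrable by simp
    show "integrable (std_gauss :: 'a measure) (\<lambda>_. 1 :: real)" by simp
    show "norm (?k w z) \<le> \<bar>f w\<bar> * 1" for w z by (simp only: norm_mult norm_of_real norm_exp_i_times)
  qed measurable
  also have "(\<lambda>z. CLINT w|lborel. ?k w z)
      = (\<lambda>z. (CLINT w|lborel. f w * iexp (- (z \<bullet> w) / \<delta>)) * iexp (((1 / \<delta>) *\<^sub>R z) \<bullet> x))"
  proof
    fix z
    have "?k w z = f w * iexp (- (z \<bullet> w) / \<delta>) * iexp (((1 / \<delta>) *\<^sub>R z) \<bullet> x)" for w
      by (simp add: inner_diff_right exp_add[symmetric] diff_divide_distrib algebra_simps)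
    then show "(CLINT w|lborel. ?k w z) = (CLINT w|lborel. f w * iexp (- (z \<bullet> w) / \<delta>)) * iexp (((1 / \<delta>) *\<^sub>R z) \<bullet> x)"
      by (simp only: integral_mult_left_zero)
  qed
  also have "(1 / \<delta> ^ DIM('a)) * (CLINT z|std_gauss. (CLINT w|lborel. f w * iexp (- (z \<bullet> w) / \<delta>)) * iexp (((1 / \<delta>) *\<^sub>R z) \<bullet> x))
     = (CLINT z|std_gauss. smooth_symbol f \<delta> z * iexp (((1 / \<delta>) *\<^sub>R z) \<bullet> x))"
    by (simp only: smooth_symbol_def mult.assoc integral_mult_right_zero of_real_divide of_real_power of_real_1)
  finally show ?thesis .
qed

lemma schwartz_gauss_integrable:
  "integrable lborel (\<lambda>y. f (x + \<delta> *\<^sub>R y) * gauss y)"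
  "integrable lborel (\<lambda>y. (grad f (x + \<delta> *\<^sub>R y) \<bullet> v) * gauss y)"
proof -
  obtain A C where AC: "0 \<le> A" "0 \<le> C" "\<And>x. \<bar>f x\<bar> \<le> A" "\<And>x. norm (grad f x) \<le> C"
    using schwartz_bounds[OF f] by metis
  show "integrable lborel (\<lambda>y. f (x + \<delta> *\<^sub>R y) * gauss y)"
  proof (rule Bochner_Integration.integrable_bound)
    show "integrable lborel (\<lambda>y::'a. A * gauss y)"
      by (intro integrable_mult_right integrable_gauss)
    show "AE y in lborel. norm (f (x + \<delta> *\<^sub>R y) * gauss y) \<le> norm (A * gauss y)"
      using AC by (intro AE_I2) (simp add: abs_mult)
  qed measurable
  show "integrable lborel (\<lambda>y. (grad f (x + \<delta> *\<^sub>R y) \<bullet> v) * gauss y)"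
  proof (rule Bochner_Integration.integrable_bound)
    show "integrable lborel (\<lambda>y::'a. C * norm v * gauss y)"
      by (intro integrable_mult_right integrable_gauss)
    have "\<bar>grad f w \<bullet> v\<bar> \<le> C * norm v" for w
      using Cauchy_Schwarz_ineq2[of "grad f w" v] mult_right_mono[OF AC(4)[of w], of "norm v"] by simp
    then show "AE y in lborel. norm ((grad f (x + \<delta> *\<^sub>R y) \<bullet> v) * gauss y) \<le> norm (C * norm v * gauss y)"
      using AC by (intro AE_I2) (simp add: abs_mult)
  qed measurable
qed

lemma smooth_has_vector_derivative:
  "((\<lambda>t. smooth f \<delta> (x + t *\<^sub>R v)) has_vector_derivative dsmooth f \<delta> (x + t *\<^sub>R v) v) (at t)"
proof -
  obtain A C where AC: "0 \<le> A" "0 \<le> C" "\<And>x. \<bar>f x\<bar> \<le> A" "\<And>x. norm (grad f x) \<le> C"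
    using schwartz_bounds[OF f] by metis
  show ?thesis
    unfolding smooth_def dsmooth_def
  proof (rule has_vector_derivative_Bochner_integral[where S = UNIV
        and f = "\<lambda>t y. f (x + t *\<^sub>R v + \<delta> *\<^sub>R y) * gauss y"
        and f' = "\<lambda>t y. (grad f (x + t *\<^sub>R v + \<delta> *\<^sub>R y) \<bullet> v) * gauss y"
        and w = "\<lambda>y. C * norm v * gauss y"])
    fix s y
    have "((\<lambda>t. x + t *\<^sub>R v + \<delta> *\<^sub>R y) has_derivative (\<lambda>h. h *\<^sub>R v)) (at s)"
      by (auto intro!: derivative_eq_intros)
    from has_derivative_compose[OF this schwartz_has_derivative[OF f]]
    have "((\<lambda>t. f (x + t *\<^sub>R v + \<delta> *\<^sub>R y)) has_vector_derivative grad f (x + s *\<^sub>R v + \<delta> *\<^sub>R y) \<bullet> v) (at s)"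
      by (simp add: has_vector_derivative_def)
    then show "((\<lambda>t. f (x + t *\<^sub>R v + \<delta> *\<^sub>R y) * gauss y) has_vector_derivative
        (grad f (x + s *\<^sub>R v + \<delta> *\<^sub>R y) \<bullet> v) * gauss y) (at s)"
      by (rule has_vector_derivative_mult_left)
    have "\<bar>grad f w \<bullet> v\<bar> \<le> C * norm v" for w
      using Cauchy_Schwarz_ineq2[of "grad f w" v] mult_right_mono[OF AC(4)[of w], of "norm v"] by simp
    then show "norm ((grad f (x + s *\<^sub>R v + \<delta> *\<^sub>R y) \<bullet> v) * gauss y) \<le> C * norm v * gauss y"
      by (simp add: abs_mult)
    show "integrable lborel (\<lambda>y. f (x + t *\<^sub>R v + \<delta> *\<^sub>R y) * gauss y)" for t
      by (rule schwartz_gauss_integrable)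
    show "integrable lborel (\<lambda>y::'a. C * norm v * gauss y)"
      by (intro integrable_mult_right integrable_gauss)
  qed auto
qed

text \<open>Both sides of \<open>smooth_eq\<close> are differentiated along \<open>v\<close> and the
  derivatives compared. The factor brought down from the character grows linearly in
  \<open>z\<close>, so the first Gaussian moment dominates.\<close>

lemma dsmooth_eq:
  assumes \<delta>: "0 < \<delta>"
  shows "complex_of_real (dsmooth f \<delta> x v) = (CLINT z|std_gauss.
    smooth_symbol f \<delta> z * (\<i> * (((1 / \<delta>) *\<^sub>R z) \<bullet> v) * iexp (((1 / \<delta>) *\<^sub>R z) \<bullet> x)))"
proof -
  interpret G: prob_space "std_gauss :: 'a measure"
    by (rule prob_space_std_gauss)
  obtain B where B: "0 \<le> B" "\<And>z. norm (smooth_symbol f \<delta> z) \<le> B"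
    using smooth_symbol_bound[OF \<delta>] by blast
  have "((\<lambda>t. CLINT z|std_gauss. smooth_symbol f \<delta> z * iexp (((1 / \<delta>) *\<^sub>R z) \<bullet> (x + t *\<^sub>R v)))
      has_vector_derivative (CLINT z|std_gauss.
        smooth_symbol f \<delta> z * (\<i> * (((1 / \<delta>) *\<^sub>R z) \<bullet> v) * iexp (((1 / \<delta>) *\<^sub>R z) \<bullet> (x + 0 *\<^sub>R v))))) (at 0)"
  proof (rule has_vector_derivative_Bochner_integral[where S = UNIV
        and f = "\<lambda>t z. smooth_symbol f \<delta> z * iexp (((1 / \<delta>) *\<^sub>R z) \<bullet> (x + t *\<^sub>R v))"
        and f' = "\<lambda>t z. smooth_symbol f \<delta> z * (\<i> * (((1 / \<delta>) *\<^sub>R z) \<bullet> v) * iexp (((1 / \<delta>) *\<^sub>R z) \<bullet> (x + t *\<^sub>R v)))"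
        and w = "\<lambda>z. B * (norm v / \<delta> * norm z)"])
    show "integrable std_gauss (\<lambda>z. smooth_symbol f \<delta> z * iexp (((1 / \<delta>) *\<^sub>R z) \<bullet> (x + t *\<^sub>R v)))" for t
    proof (rule G.integrable_const_bound[where B = B])
      show "AE z in std_gauss. norm (smooth_symbol f \<delta> z * iexp (((1 / \<delta>) *\<^sub>R z) \<bullet> (x + t *\<^sub>R v))) \<le> B"
        unfolding norm_mult norm_exp_i_times using B by simp
    qed measurable
    fix t z
    have "((\<lambda>t. \<zeta> \<bullet> (x + t *\<^sub>R v)) has_real_derivative \<zeta> \<bullet> v) (at t)" for \<zeta>
      unfolding inner_add_right inner_scaleR_right by (auto intro!: derivative_eq_intros)
    then show "((\<lambda>t. smooth_symbol f \<delta> z * iexp (((1 / \<delta>) *\<^sub>R z) \<bullet> (x + t *\<^sub>R v))) has_vector_derivative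
        smooth_symbol f \<delta> z * (\<i> * (((1 / \<delta>) *\<^sub>R z) \<bullet> v) * iexp (((1 / \<delta>) *\<^sub>R z) \<bullet> (x + t *\<^sub>R v)))) (at t)"
      by (intro has_vector_derivative_mult_right has_vector_derivative_iexp)
    have "\<bar>((1 / \<delta>) *\<^sub>R z) \<bullet> v\<bar> \<le> norm v / \<delta> * norm z"
      using Cauchy_Schwarz_ineq2[of "(1 / \<delta>) *\<^sub>R z" v] \<delta> by (simp add: mult.commute)
    then show "norm (smooth_symbol f \<delta> z * (\<i> * (((1 / \<delta>) *\<^sub>R z) \<bullet> v) * iexp (((1 / \<delta>) *\<^sub>R z) \<bullet> (x + t *\<^sub>R v))))
        \<le> B * (norm v / \<delta> * norm z)"
      unfolding norm_mult norm_exp_i_times norm_of_real norm_ii mult_1_left mult_1_right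
      by (intro mult_mono[OF B(2) _ B(1)]) auto
  qed (use integrable_std_gauss_norm in auto)
  moreover have "((\<lambda>t. complex_of_real (smooth f \<delta> (x + t *\<^sub>R v))) has_vector_derivative
      complex_of_real (dsmooth f \<delta> (x + 0 *\<^sub>R v) v)) (at 0)"
    using smooth_has_vector_derivative[where t = 0]
    by (intro has_vector_derivative_of_real)
       (simp only: has_real_derivative_iff_has_vector_derivative)
  ultimately show ?thesis
    unfolding smooth_eq[OF \<delta>] using vector_derivative_unique_at by fastforce
qed

lemma smooth_measurable [measurable]: "smooth f \<delta> \<in> borel_measurable borel"
  and dsmooth_measurable [measurable]:
    "(\<lambda>\<omega>. dsmooth f \<delta> (X \<omega>) (Y \<omega>)) \<in> borel_measurable M"
    if [measurable]: "X \<in> borel_measurable M" "Y \<in> borel_measurable M"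
  unfolding smooth_def[abs_def] dsmooth_def[abs_def] by measurable

text \<open>One constant for all widths, as the limit \<delta> to 0 requires. The third bound has no
  factor \<open>norm x\<close> although the direction is \<open>x\<close>: it is the mollified form
  of the bound on \<open>norm x * norm (grad f x)\<close>, and its range of \<open>t\<close>
  contains a neighbourhood of 1.\<close>

lemma smooth_bounds:
  obtains B where "0 \<le> B" "\<And>x \<delta>. \<bar>smooth f \<delta> x\<bar> \<le> B"
    "\<And>x v \<delta>. \<bar>dsmooth f \<delta> x v\<bar> \<le> B * norm v"
    "\<And>x \<delta> t. 0 \<le> \<delta> \<Longrightarrow> \<delta> \<le> 1 \<Longrightarrow> 1 / 2 < t \<Longrightarrow> \<bar>dsmooth f \<delta> (t *\<^sub>R x) x\<bar> \<le> B"
    "\<And>x u \<delta>. \<bar>smooth f \<delta> (x + u) - smooth f \<delta> x\<bar> \<le> B * min 1 (norm u)"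
proof -
  obtain A C where AC: "0 \<le> A" "0 \<le> C" "\<And>x. \<bar>f x\<bar> \<le> A" "\<And>x. norm (grad f x) \<le> C"
    "\<And>x. norm x * norm (grad f x) \<le> C"
    "\<And>x u. \<bar>f (x + u) - f x\<bar> \<le> (2 * A + C) * min 1 (norm u)"
    using schwartz_bounds[OF f] by metis
  define c where "c = (LINT y::'a|lborel. gauss y)"
  define c1 where "c1 = (LINT y::'a|lborel. (1 + 1 * norm y) * gauss y)"
  have c: "0 \<le> c" "0 \<le> c1"
    unfolding c_def c1_def by (auto intro!: Bochner_Integration.integral_nonneg)
  have 1: "\<bar>smooth f \<delta> x\<bar> \<le> A * c" for \<delta> x
  proof -
    have "norm (smooth f \<delta> x) \<le> (LINT y::'a|lborel. A * gauss y)"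
      unfolding smooth_def using AC
      by (intro norm_integral_le integrable_mult_right integrable_gauss) (simp add: abs_mult)
    then show ?thesis by (simp add: c_def)
  qed
  have 2: "\<bar>dsmooth f \<delta> x v\<bar> \<le> C * c * norm v" for \<delta> x v
  proof -
    have "\<bar>grad f w \<bullet> v\<bar> \<le> C * norm v" for w
      using Cauchy_Schwarz_ineq2[of "grad f w" v] mult_right_mono[OF AC(4)[of w], of "norm v"] by simp
    then have "norm (dsmooth f \<delta> x v) \<le> (LINT y::'a|lborel. C * norm v * gauss y)"
      unfolding dsmooth_def
      by (intro norm_integral_le integrable_mult_right integrable_gauss) (simp add: abs_mult)
    then show ?thesis by (simp add: c_def ac_simps)
  qed
  have 3: "\<bar>dsmooth f \<delta> (t *\<^sub>R x) x\<bar> \<le> 2 * C * c1"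
    if "0 \<le> \<delta>" "\<delta> \<le> 1" "1 / 2 < t" for \<delta> x t
  proof -
    have "\<bar>grad f (t *\<^sub>R x + \<delta> *\<^sub>R y) \<bullet> x\<bar> \<le> 2 * C * (1 + 1 * norm y)" for y
    proof -
      let ?w = "t *\<^sub>R x + \<delta> *\<^sub>R y"
      \<comment> \<open>The direction is compared with the point \<open>?w\<close> at which the
        gradient is taken: the decay of the gradient absorbs \<open>norm ?w\<close>, the Gaussian
        absorbs \<open>norm y\<close>.\<close>
      have "norm x \<le> 2 * norm (t *\<^sub>R x)"
        using that mult_right_mono[of "1 / 2" t "norm x"] by simp
      also have "norm (t *\<^sub>R x) \<le> norm ?w + norm (\<delta> *\<^sub>R y)"
        using norm_triangle_ineq4[of ?w "\<delta> *\<^sub>R y"] by simp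
      also have "norm (\<delta> *\<^sub>R y) \<le> norm y"
        using that by (simp add: mult_left_le_one_le)
      finally have x: "norm x \<le> 2 * (norm ?w + norm y)" by simp
      have "\<bar>grad f ?w \<bullet> x\<bar> \<le> norm (grad f ?w) * norm x"
        by (rule Cauchy_Schwarz_ineq2)
      also have "\<dots> \<le> norm (grad f ?w) * (2 * (norm ?w + norm y))"
        using x by (intro mult_left_mono) auto
      also have "\<dots> = 2 * (norm ?w * norm (grad f ?w) + norm (grad f ?w) * norm y)"
        by (simp add: algebra_simps)
      also have "\<dots> \<le> 2 * (C + C * norm y)"
        by (intro mult_left_mono add_mono AC mult_right_mono) auto
      finally show ?thesis by (simp add: algebra_simps)
    qed
    then have "norm (dsmooth f \<delta> (t *\<^sub>R x) x) \<le> (LINT y::'a|lborel. 2 * C * ((1 + 1 * norm y) * gauss y))"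
      unfolding dsmooth_def
      by (intro norm_integral_le integrable_mult_right integrable_gauss)
         (simp add: abs_mult mult.assoc[symmetric])
    then show ?thesis
      unfolding c1_def integral_mult_right_zero by simp
  qed
  have 4: "\<bar>smooth f \<delta> (x + u) - smooth f \<delta> x\<bar> \<le> (2 * A + C) * c * min 1 (norm u)" for \<delta> x u
  proof -
    have "smooth f \<delta> (x + u) - smooth f \<delta> x
        = (LINT y|lborel. (f (x + \<delta> *\<^sub>R y + u) - f (x + \<delta> *\<^sub>R y)) * gauss y)"
      using schwartz_gauss_integrable(1)[of "x + u" \<delta>] schwartz_gauss_integrable(1)[of x \<delta>]
      unfolding smooth_def left_diff_distrib
      by (subst Bochner_Integration.integral_diff) (simp_all only: ac_simps)
    also have "norm \<dots> \<le> (LINT y::'a|lborel. (2 * A + C) * min 1 (norm u) * gauss y)"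
      using AC(6) by (intro norm_integral_le integrable_mult_right integrable_gauss) (simp add: abs_mult)
    finally show ?thesis by (simp add: c_def ac_simps)
  qed
  define B where "B = A * c + C * c + 2 * C * c1 + (2 * A + C) * c"
  have nn: "0 \<le> A * c" "0 \<le> C * c" "0 \<le> 2 * C * c1" "0 \<le> (2 * A + C) * c"
    using AC c by auto
  show ?thesis
  proof (rule that[of B])
    show "0 \<le> B" "\<bar>smooth f \<delta> x\<bar> \<le> B" for x \<delta>
      using nn 1[of \<delta> x] by (auto simp: B_def)
    have "C * c * norm v \<le> B * norm v" for v :: 'a
      using nn by (intro mult_right_mono) (auto simp: B_def)
    then show "\<bar>dsmooth f \<delta> x v\<bar> \<le> B * norm v" for x v \<delta>
      by (rule order_trans[OF 2])
    show "\<bar>dsmooth f \<delta> (t *\<^sub>R x) x\<bar> \<le> B" if "0 \<le> \<delta>" "\<delta> \<le> 1" "1 / 2 < t" for \<delta> x t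
      using nn 3[OF that, of x] by (auto simp: B_def)
    have "(2 * A + C) * c * min 1 (norm u) \<le> B * min 1 (norm u)" for u :: 'a
      using nn by (intro mult_right_mono) (auto simp: B_def)
    then show "\<bar>smooth f \<delta> (x + u) - smooth f \<delta> x\<bar> \<le> B * min 1 (norm u)" for x u \<delta>
      by (rule order_trans[OF 4])
  qed
qed

lemma smooth_tendsto:
  assumes \<delta>: "\<delta> \<longlonglongrightarrow> 0"
  shows "(\<lambda>n. smooth f (\<delta> n) x) \<longlonglongrightarrow> f x * (LINT y::'a|lborel. gauss y)"
    and "(\<lambda>n. dsmooth f (\<delta> n) x v) \<longlonglongrightarrow> (grad f x \<bullet> v) * (LINT y::'a|lborel. gauss y)"
proof -
  obtain A C where AC: "0 \<le> A" "0 \<le> C" "\<And>x. \<bar>f x\<bar> \<le> A" "\<And>x. norm (grad f x) \<le> C"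
    using schwartz_bounds[OF f] by metis
  have lim: "(\<lambda>n. x + \<delta> n *\<^sub>R y) \<longlonglongrightarrow> x + 0 *\<^sub>R y" for y
    by (intro tendsto_intros \<delta>)
  have f_lim: "(\<lambda>n. f (x + \<delta> n *\<^sub>R y)) \<longlonglongrightarrow> f x" for y
    using continuous_on_tendsto_compose[OF schwartz_continuous(1)[OF f] lim[of y]] by simp
  have g_lim: "(\<lambda>n. grad f (x + \<delta> n *\<^sub>R y)) \<longlonglongrightarrow> grad f x" for y
    using continuous_on_tendsto_compose[OF schwartz_continuous(2)[OF f] lim[of y]] by simp
  have "(\<lambda>n. smooth f (\<delta> n) x) \<longlonglongrightarrow> (LINT y::'a|lborel. f x * gauss y)"
    unfolding smooth_def
  proof (rule integral_dominated_convergence[where w = "\<lambda>y. A * gauss y"])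
    show "AE y in lborel. (\<lambda>n. f (x + \<delta> n *\<^sub>R y) * gauss y) \<longlonglongrightarrow> f x * gauss y"
      by (intro AE_I2 tendsto_intros f_lim)
    show "integrable lborel (\<lambda>y::'a. A * gauss y)"
      by (intro integrable_mult_right integrable_gauss)
    show "AE y in lborel. norm (f (x + \<delta> n *\<^sub>R y) * gauss y) \<le> A * gauss y" for n
      using AC by (intro AE_I2) (simp add: abs_mult)
  qed auto
  then show "(\<lambda>n. smooth f (\<delta> n) x) \<longlonglongrightarrow> f x * (LINT y::'a|lborel. gauss y)"
    by (simp only: integral_mult_right_zero)
  have "(\<lambda>n. dsmooth f (\<delta> n) x v) \<longlonglongrightarrow> (LINT y::'a|lborel. (grad f x \<bullet> v) * gauss y)"
    unfolding dsmooth_def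
  proof (rule integral_dominated_convergence[where w = "\<lambda>y. C * norm v * gauss y"])
    show "AE y in lborel. (\<lambda>n. (grad f (x + \<delta> n *\<^sub>R y) \<bullet> v) * gauss y) \<longlonglongrightarrow> (grad f x \<bullet> v) * gauss y"
      by (intro AE_I2 tendsto_intros g_lim)
    show "integrable lborel (\<lambda>y::'a. C * norm v * gauss y)"
      by (intro integrable_mult_right integrable_gauss)
    have "\<bar>grad f w \<bullet> v\<bar> \<le> C * norm v" for w
      using Cauchy_Schwarz_ineq2[of "grad f w" v] mult_right_mono[OF AC(4)[of w], of "norm v"] by simp
    then show "AE y in lborel. norm ((grad f (x + \<delta> n *\<^sub>R y) \<bullet> v) * gauss y) \<le> C * norm v * gauss y" for n
      by (intro AE_I2) (simp add: abs_mult)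
  qed auto
  then show "(\<lambda>n. dsmooth f (\<delta> n) x v) \<longlonglongrightarrow> (grad f x \<bullet> v) * (LINT y::'a|lborel. gauss y)"
    by (simp only: integral_mult_right_zero)
qed

end

section \<open>From characters to mollified and then to general Schwartz functions\<close>

context ou_pair
begin

text \<open>By \<open>smooth_eq\<close> the expectation of \<open>smooth f \<delta> (t X)\<close> is
  an average of \<open>phi (t \<zeta> z)\<close> with weight \<open>a z\<close>. Its derivative at
  \<open>t = 1\<close>, taken under the expectation, is the left side; taken through
  \<open>phi = exp psi\<close>, it splits into a drift and a jump part, which Fubini carries back to
  the two terms on the right.\<close>

lemma stein_smooth:
  assumes phi: "\<And>\<xi>. phi \<xi> = exp (psi \<xi>)" and f: "schwartz f" and \<delta>: "0 < \<delta>" "\<delta> \<le> 1"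
  shows "(LINT \<omega>|M. dsmooth f \<delta> (X \<omega>) (X \<omega>)) = (LINT \<omega>|M. dsmooth f \<delta> (X \<omega>) b\<^sub>0) +
    (LINT \<omega>|M. LINT u|\<nu>'. smooth f \<delta> (X \<omega> + u) - smooth f \<delta> (X \<omega>))"
proof -
  interpret G: prob_space "std_gauss :: 'a measure"
    by (rule prob_space_std_gauss)
  interpret MG: pair_sigma_finite M "std_gauss :: 'a measure" ..
  interpret NG: pair_sigma_finite \<nu>' "std_gauss :: 'a measure" ..
  note [measurable] = smooth_measurable[OF f] dsmooth_measurable[OF f] smooth_symbol_measurable[OF f]
  obtain B where B: "0 \<le> B" "\<And>z. norm (smooth_symbol f \<delta> z) \<le> B"
    using smooth_symbol_bound[OF f \<delta>(1)] by blast
  obtain S where S: "0 \<le> S" "\<And>x. \<bar>smooth f \<delta> x\<bar> \<le> S" "\<And>x v. \<bar>dsmooth f \<delta> x v\<bar> \<le> S * norm v"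
    "\<And>x t. 1 / 2 < t \<Longrightarrow> \<bar>dsmooth f \<delta> (t *\<^sub>R x) x\<bar> \<le> S"
    "\<And>x u. \<bar>smooth f \<delta> (x + u) - smooth f \<delta> x\<bar> \<le> S * min 1 (norm u)"
    using smooth_bounds[OF f] \<delta> by (metis less_imp_le)
  define a where "a = smooth_symbol f \<delta>"
  define \<zeta> where "\<zeta> z = (1 / \<delta>) *\<^sub>R z" for z :: 'a
  have [measurable]: "a \<in> borel_measurable borel" "\<zeta> \<in> borel_measurable borel"
    unfolding a_def \<zeta>_def[abs_def] by measurable
  have [measurable]: "jump \<in> borel_measurable borel"
    unfolding jump_def[abs_def] by measurable
  have a: "norm (a z) \<le> B" for z using B by (simp add: a_def)
  have \<zeta>: "norm (\<zeta> z) = norm z / \<delta>" for z using \<delta> by (simp add: \<zeta>_def)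
  \<comment> \<open>A common pattern for the majorants below; the factors \<open>1 *\<close> and
    summands \<open>0 +\<close> in later bounds make them match it.\<close>
  have int_\<zeta>: "integrable std_gauss (\<lambda>z. c * (d + e * norm (\<zeta> z)))" for c d e
    unfolding \<zeta> using integrable_std_gauss_norm
    by (intro integrable_mult_right Bochner_Integration.integrable_add integrable_divide) auto
  have smooth: "complex_of_real (smooth f \<delta> x) = (CLINT z|std_gauss. a z * iexp (\<zeta> z \<bullet> x))" for x
    unfolding a_def \<zeta>_def by (rule smooth_eq[OF f \<delta>(1)])
  have dsmooth: "complex_of_real (dsmooth f \<delta> x v) =
      (CLINT z|std_gauss. a z * (\<i> * (\<zeta> z \<bullet> v) * iexp (\<zeta> z \<bullet> x)))" for x v
    unfolding a_def \<zeta>_def by (rule dsmooth_eq[OF f \<delta>(1)])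
  have int_a: "integrable std_gauss (\<lambda>z. a z * iexp (\<zeta> z \<bullet> x))" for x
    using a by (intro G.integrable_const_bound[where B = B]) (auto simp: norm_mult)
  have smooth_X: "complex_of_real (LINT \<omega>|M. smooth f \<delta> (t *\<^sub>R X \<omega>)) = (CLINT z|std_gauss. a z * phi (t *\<^sub>R \<zeta> z))" for t
  proof -
    have "complex_of_real (LINT \<omega>|M. smooth f \<delta> (t *\<^sub>R X \<omega>))
        = (CLINT \<omega>|M. CLINT z|std_gauss. a z * iexp ((t *\<^sub>R \<zeta> z) \<bullet> X \<omega>))"
      by (simp add: integral_complex_of_real[symmetric] smooth del: integral_complex_of_real)
    also have "\<dots> = (CLINT z|std_gauss. CLINT \<omega>|M. a z * iexp ((t *\<^sub>R \<zeta> z) \<bullet> X \<omega>))"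
    proof (rule MG.Fubini_product_bound[symmetric])
      show "norm (a z * iexp ((t *\<^sub>R \<zeta> z) \<bullet> X \<omega>)) \<le> B * 1" for z \<omega>
        unfolding norm_mult norm_exp_i_times using a by simp
    qed auto
    finally show ?thesis by (simp only: integral_mult_right_zero phi_def)
  qed
  \<comment> \<open>Dominated by the third bound of \<open>smooth_bounds\<close>. The scalar 1 is
    kept so that the derivative matches the general form at \<open>t = 1\<close>.\<close>
  have deriv1: "((\<lambda>t. complex_of_real (LINT \<omega>|M. smooth f \<delta> (t *\<^sub>R X \<omega>))) has_vector_derivative
      complex_of_real (LINT \<omega>|M. dsmooth f \<delta> (1 *\<^sub>R X \<omega>) (X \<omega>))) (at 1)"
  proof -
    have "((\<lambda>t. LINT \<omega>|M. smooth f \<delta> (t *\<^sub>R X \<omega>)) has_vector_derivative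
        (LINT \<omega>|M. dsmooth f \<delta> (1 *\<^sub>R X \<omega>) (X \<omega>))) (at 1)"
    proof (rule has_vector_derivative_Bochner_integral[where S = "{1 / 2<..}" and w = "\<lambda>_. S"
          and f = "\<lambda>t \<omega>. smooth f \<delta> (t *\<^sub>R X \<omega>)" and f' = "\<lambda>t \<omega>. dsmooth f \<delta> (t *\<^sub>R X \<omega>) (X \<omega>)"])
      show "integrable M (\<lambda>\<omega>. smooth f \<delta> (t *\<^sub>R X \<omega>))" for t
        using S(2) by (intro integrable_M[where C = S]) auto
      show "((\<lambda>t. smooth f \<delta> (t *\<^sub>R X \<omega>)) has_vector_derivative dsmooth f \<delta> (t *\<^sub>R X \<omega>) (X \<omega>)) (at t)" for t \<omega>
        using smooth_has_vector_derivative[OF f, where x = 0 and v = "X \<omega>"] by simp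
    qed (use S(4) in auto)
    then show ?thesis
      by (intro has_vector_derivative_of_real)
         (simp only: has_real_derivative_iff_has_vector_derivative)
  qed
  \<comment> \<open>For \<open>t > 1 / 2\<close> the term \<open>2 / t\<close> in the bound on
    \<open>jump\<close> is at most 4, which explains the constant in \<open>w\<close>.\<close>
  have deriv2: "((\<lambda>t. CLINT z|std_gauss. a z * phi (t *\<^sub>R \<zeta> z)) has_vector_derivative
      (CLINT z|std_gauss. a z * (phi (1 *\<^sub>R \<zeta> z) * (\<i> * (b\<^sub>0 \<bullet> \<zeta> z) + jump (1 *\<^sub>R \<zeta> z) / of_real 1)))) (at 1)"
  proof (rule has_vector_derivative_Bochner_integral[where S = "{1 / 2<..}"
        and f = "\<lambda>t z. a z * phi (t *\<^sub>R \<zeta> z)"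
        and f' = "\<lambda>t z. a z * (phi (t *\<^sub>R \<zeta> z) * (\<i> * (b\<^sub>0 \<bullet> \<zeta> z) + jump (t *\<^sub>R \<zeta> z) / of_real t))"
        and w = "\<lambda>z. B * (4 * K\<^sub>0 + (norm b\<^sub>0 + K\<^sub>0) * norm (\<zeta> z))"])
    have [measurable]: "phi \<in> borel_measurable borel"
      unfolding phi_def[abs_def] by measurable
    show "integrable std_gauss (\<lambda>z. a z * phi (t *\<^sub>R \<zeta> z))" for t
    proof (rule G.integrable_const_bound[where B = B])
      show "AE z in std_gauss. norm (a z * phi (t *\<^sub>R \<zeta> z)) \<le> B"
        unfolding norm_mult using mult_mono[OF a norm_phi_le B(1) norm_ge_zero] by (intro AE_I2) simp
    qed measurable
    show "(\<lambda>z. a z * (phi (1 *\<^sub>R \<zeta> z) * (\<i> * (b\<^sub>0 \<bullet> \<zeta> z) + jump (1 *\<^sub>R \<zeta> z) / of_real 1))) \<in> borel_measurable std_gauss"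
      by measurable
    fix t :: real and z :: 'a assume "t \<in> {1 / 2<..}"
    then have t: "1 / 2 < t" by simp
    have "((\<lambda>t. exp (psi (t *\<^sub>R \<zeta> z))) has_vector_derivative
        (\<i> * (b\<^sub>0 \<bullet> \<zeta> z) + jump (t *\<^sub>R \<zeta> z) / of_real t) * exp (psi (t *\<^sub>R \<zeta> z))) (at t)"
      using field_vector_diff_chain_at[OF psi_has_vector_derivative DERIV_exp] t by (simp add: comp_def)
    then show "((\<lambda>t. a z * phi (t *\<^sub>R \<zeta> z)) has_vector_derivative
        a z * (phi (t *\<^sub>R \<zeta> z) * (\<i> * (b\<^sub>0 \<bullet> \<zeta> z) + jump (t *\<^sub>R \<zeta> z) / of_real t))) (at t)"
      unfolding phi by (intro has_vector_derivative_mult_right) (simp only: mult.commute)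
    have 1: "norm (\<i> * (b\<^sub>0 \<bullet> \<zeta> z)) \<le> norm b\<^sub>0 * norm (\<zeta> z)"
      using Cauchy_Schwarz_ineq2[of b\<^sub>0 "\<zeta> z"] by (simp add: norm_mult)
    have "norm (jump (t *\<^sub>R \<zeta> z) / of_real t) \<le> (2 + norm (t *\<^sub>R \<zeta> z)) * K\<^sub>0 / t"
      using norm_jump_le[of "t *\<^sub>R \<zeta> z"] t by (simp add: norm_divide divide_right_mono)
    also have "\<dots> = (2 / t + norm (\<zeta> z)) * K\<^sub>0"
      using t by (simp add: field_simps)
    also have "\<dots> \<le> (4 + norm (\<zeta> z)) * K\<^sub>0"
      using t K\<^sub>0_nonneg by (intro mult_right_mono add_right_mono) (auto simp: field_simps)
    finally have "norm (\<i> * (b\<^sub>0 \<bullet> \<zeta> z) + jump (t *\<^sub>R \<zeta> z) / of_real t)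
        \<le> norm b\<^sub>0 * norm (\<zeta> z) + (4 + norm (\<zeta> z)) * K\<^sub>0"
      by (rule norm_triangle_mono[OF 1])
    also have "\<dots> = 4 * K\<^sub>0 + (norm b\<^sub>0 + K\<^sub>0) * norm (\<zeta> z)"
      by (simp add: algebra_simps)
    finally have 2: "norm (\<i> * (b\<^sub>0 \<bullet> \<zeta> z) + jump (t *\<^sub>R \<zeta> z) / of_real t) \<le> \<dots>" .
    have "norm (phi (t *\<^sub>R \<zeta> z) * (\<i> * (b\<^sub>0 \<bullet> \<zeta> z) + jump (t *\<^sub>R \<zeta> z) / of_real t))
        \<le> 1 * (4 * K\<^sub>0 + (norm b\<^sub>0 + K\<^sub>0) * norm (\<zeta> z))"
      unfolding norm_mult by (rule mult_mono[OF norm_phi_le 2]) auto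
    then show "norm (a z * (phi (t *\<^sub>R \<zeta> z) * (\<i> * (b\<^sub>0 \<bullet> \<zeta> z) + jump (t *\<^sub>R \<zeta> z) / of_real t)))
        \<le> B * (4 * K\<^sub>0 + (norm b\<^sub>0 + K\<^sub>0) * norm (\<zeta> z))"
      unfolding norm_mult[of "a z"] mult_1_left by (rule mult_mono[OF a _ B(1) norm_ge_zero])
  qed (use int_\<zeta> in auto)
  have eq: "complex_of_real (LINT \<omega>|M. dsmooth f \<delta> (X \<omega>) (X \<omega>))
      = (CLINT z|std_gauss. a z * (phi (\<zeta> z) * (\<i> * (b\<^sub>0 \<bullet> \<zeta> z) + jump (\<zeta> z))))"
    using vector_derivative_unique_at[OF deriv1 deriv2[folded smooth_X]] by simp
  let ?D = "\<lambda>z x. a z * (\<i> * (\<zeta> z \<bullet> b\<^sub>0) * iexp (\<zeta> z \<bullet> x))"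
  let ?J = "\<lambda>z x. a z * (jump (\<zeta> z) * iexp (\<zeta> z \<bullet> x))"
  have norm_D: "norm (?D z x) \<le> 1 * (B * (0 + norm b\<^sub>0 * norm (\<zeta> z)))" for z x
  proof -
    have "\<bar>\<zeta> z \<bullet> b\<^sub>0\<bar> \<le> norm b\<^sub>0 * norm (\<zeta> z)"
      using Cauchy_Schwarz_ineq2[of "\<zeta> z" b\<^sub>0] by (simp add: mult.commute)
    then show ?thesis
      unfolding norm_mult norm_exp_i_times norm_of_real norm_ii mult_1_left mult_1_right add_0_left
      by (intro mult_mono[OF a _ B(1)]) auto
  qed
  have norm_J: "norm (?J z x) \<le> 1 * (B * (2 * K\<^sub>0 + K\<^sub>0 * norm (\<zeta> z)))" for z x
  proof -
    have "norm (jump (\<zeta> z)) \<le> 2 * K\<^sub>0 + K\<^sub>0 * norm (\<zeta> z)"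
      using norm_jump_le[of "\<zeta> z"] by (simp add: algebra_simps)
    then show ?thesis
      unfolding norm_mult norm_exp_i_times mult_1_left mult_1_right
      by (intro mult_mono[OF a _ B(1)]) auto
  qed
  have D: "(CLINT z|std_gauss. CLINT \<omega>|M. ?D z (X \<omega>)) = complex_of_real (LINT \<omega>|M. dsmooth f \<delta> (X \<omega>) b\<^sub>0)"
  proof -
    have "(CLINT z|std_gauss. CLINT \<omega>|M. ?D z (X \<omega>)) = (CLINT \<omega>|M. CLINT z|std_gauss. ?D z (X \<omega>))"
      by (rule MG.Fubini_product_bound[OF _ _ int_\<zeta> norm_D]) auto
    then show ?thesis
      by (simp only: dsmooth[symmetric] integral_complex_of_real)
  qed
  have J: "(CLINT z|std_gauss. CLINT \<omega>|M. ?J z (X \<omega>))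
      = complex_of_real (LINT \<omega>|M. LINT u|\<nu>'. smooth f \<delta> (X \<omega> + u) - smooth f \<delta> (X \<omega>))"
  proof -
    have *: "(CLINT z|std_gauss. ?J z x) = complex_of_real (LINT u|\<nu>'. smooth f \<delta> (x + u) - smooth f \<delta> x)" for x
    proof -
      let ?k = "\<lambda>u z. a z * (iexp (\<zeta> z \<bullet> (x + u)) - iexp (\<zeta> z \<bullet> x))"
      \<comment> \<open>Characters are eigenfunctions of the jump operator, with eigenvalue
        \<open>jump\<close>.\<close>
      have "?J z x = (CLINT u|\<nu>'. ?k u z)" for z
      proof -
        have "?k u z = a z * ((iexp (\<zeta> z \<bullet> u) - 1) * iexp (\<zeta> z \<bullet> x))" for u
          by (simp add: inner_add_right distrib_left exp_add algebra_simps)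
        then show ?thesis
          by (simp only: integral_mult_right_zero integral_mult_left_zero jump_def)
      qed
      then have "(CLINT z|std_gauss. ?J z x) = (CLINT z|std_gauss. CLINT u|\<nu>'. ?k u z)"
        by (simp only:)
      also have "\<dots> = (CLINT u|\<nu>'. CLINT z|std_gauss. ?k u z)"
      proof (rule NG.Fubini_product_bound[OF _ integrable_\<nu>'_min int_\<zeta>])
        have "norm (a z * (iexp (\<zeta> z \<bullet> (x + u)) - iexp (\<zeta> z \<bullet> x))) \<le> B * ((2 + norm (\<zeta> z)) * min 1 (norm u))" for u z
          unfolding norm_mult by (rule mult_mono[OF a norm_iexp_diff_le B(1) norm_ge_zero])
        then show "norm (a z * (iexp (\<zeta> z \<bullet> (x + u)) - iexp (\<zeta> z \<bullet> x))) \<le> min 1 (norm u) * (B * (2 + 1 * norm (\<zeta> z)))" for u z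
          by (simp only: mult_1_left ac_simps)
      qed measurable
      also have "(\<lambda>u. CLINT z|std_gauss. ?k u z) = (\<lambda>u. complex_of_real (smooth f \<delta> (x + u) - smooth f \<delta> x))"
        unfolding right_diff_distrib of_real_diff smooth using int_a by simp
      finally show ?thesis by (simp only: integral_complex_of_real)
    qed
    have "(CLINT z|std_gauss. CLINT \<omega>|M. ?J z (X \<omega>)) = (CLINT \<omega>|M. CLINT z|std_gauss. ?J z (X \<omega>))"
      by (rule MG.Fubini_product_bound[OF _ _ int_\<zeta> norm_J]) auto
    then show ?thesis
      by (simp only: * integral_complex_of_real)
  qed
  have "(CLINT z|std_gauss. a z * (phi (\<zeta> z) * (\<i> * (b\<^sub>0 \<bullet> \<zeta> z) + jump (\<zeta> z))))
      = (CLINT z|std_gauss. (CLINT \<omega>|M. ?D z (X \<omega>)) + (CLINT \<omega>|M. ?J z (X \<omega>)))"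
    by (simp add: phi_def inner_commute algebra_simps)
  also have "\<dots> = (CLINT z|std_gauss. CLINT \<omega>|M. ?D z (X \<omega>)) + (CLINT z|std_gauss. CLINT \<omega>|M. ?J z (X \<omega>))"
  proof (rule Bochner_Integration.integral_add)
    show "integrable std_gauss (\<lambda>z. CLINT \<omega>|M. ?D z (X \<omega>))"
    proof (rule Bochner_Integration.integrable_bound[OF int_\<zeta>])
      show "AE z in std_gauss. norm (CLINT \<omega>|M. ?D z (X \<omega>)) \<le> norm (1 * (0 + (B * norm b\<^sub>0) * norm (\<zeta> z)))"
        using norm_integral_le[of M "\<lambda>_. 1 * (B * (0 + norm b\<^sub>0 * norm (\<zeta> _)))", OF _ norm_D]
        by (intro AE_I2) (simp add: prob_space B(1) mult.assoc)
    qed measurable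
    show "integrable std_gauss (\<lambda>z. CLINT \<omega>|M. ?J z (X \<omega>))"
    proof (rule Bochner_Integration.integrable_bound[OF int_\<zeta>])
      show "AE z in std_gauss. norm (CLINT \<omega>|M. ?J z (X \<omega>)) \<le> norm (B * (2 * K\<^sub>0 + K\<^sub>0 * norm (\<zeta> z)))"
        using norm_integral_le[of M "\<lambda>_. 1 * (B * (2 * K\<^sub>0 + K\<^sub>0 * norm (\<zeta> _)))", OF _ norm_J]
        by (intro AE_I2) (simp add: prob_space B(1) K\<^sub>0_nonneg)
    qed measurable
  qed
  finally show ?thesis
    unfolding eq[symmetric] D J of_real_add[symmetric] of_real_eq_iff .
qed

text \<open>The bounds in \<open>smooth_bounds\<close> do not involve the width, so every term
  passes to the limit by dominated convergence, the jump term in two rounds: in \<open>u\<close>,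
  then in \<open>\<omega>\<close>.\<close>

lemma stein_identity:
  assumes phi: "\<And>\<xi>. phi \<xi> = exp (psi \<xi>)" and f: "schwartz f"
  shows "(LINT \<omega>|M. X \<omega> \<bullet> grad f (X \<omega>)) = (LINT \<omega>|M. b\<^sub>0 \<bullet> grad f (X \<omega>)) +
    (LINT \<omega>|M. LINT u|\<nu>'. f (X \<omega> + u) - f (X \<omega>))"
proof -
  define c where "c = (LINT y::'a|lborel. gauss y)"
  define \<delta> :: "nat \<Rightarrow> real" where "\<delta> n = inverse (Suc n)" for n
  have \<delta>: "0 < \<delta> n" "\<delta> n \<le> 1" for n
    by (auto simp: \<delta>_def inverse_le_1_iff)
  have \<delta>_lim: "\<delta> \<longlonglongrightarrow> 0"
    unfolding \<delta>_def[abs_def] by (rule LIMSEQ_inverse_real_of_nat)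
  note [measurable] = smooth_measurable[OF f] dsmooth_measurable[OF f] schwartz_measurable[OF f]
  obtain S where S: "0 \<le> S" "\<And>x v n. \<bar>dsmooth f (\<delta> n) x v\<bar> \<le> S * norm v"
    "\<And>x n t. 1 / 2 < t \<Longrightarrow> \<bar>dsmooth f (\<delta> n) (t *\<^sub>R x) x\<bar> \<le> S"
    "\<And>x u n. \<bar>smooth f (\<delta> n) (x + u) - smooth f (\<delta> n) x\<bar> \<le> S * min 1 (norm u)"
    using smooth_bounds[OF f] \<delta> by (metis less_imp_le)
  note lim = smooth_tendsto[OF f \<delta>_lim, folded c_def]
  have "(\<lambda>n. LINT \<omega>|M. dsmooth f (\<delta> n) (X \<omega>) (X \<omega>)) \<longlonglongrightarrow> (LINT \<omega>|M. (grad f (X \<omega>) \<bullet> X \<omega>) * c)"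
  proof (rule integral_dominated_convergence[where w = "\<lambda>_. S"])
    show "AE \<omega> in M. norm (dsmooth f (\<delta> n) (X \<omega>) (X \<omega>)) \<le> S" for n
      using S(3)[of 1] by simp
  qed (use lim in auto)
  moreover have "(\<lambda>n. LINT \<omega>|M. dsmooth f (\<delta> n) (X \<omega>) b\<^sub>0) \<longlonglongrightarrow> (LINT \<omega>|M. (grad f (X \<omega>) \<bullet> b\<^sub>0) * c)"
  proof (rule integral_dominated_convergence[where w = "\<lambda>_. S * norm b\<^sub>0"])
    show "AE \<omega> in M. norm (dsmooth f (\<delta> n) (X \<omega>) b\<^sub>0) \<le> S * norm b\<^sub>0" for n
      using S(2) by simp
  qed (use lim in auto)
  moreover have "(\<lambda>n. LINT \<omega>|M. LINT u|\<nu>'. smooth f (\<delta> n) (X \<omega> + u) - smooth f (\<delta> n) (X \<omega>))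
      \<longlonglongrightarrow> (LINT \<omega>|M. LINT u|\<nu>'. (f (X \<omega> + u) - f (X \<omega>)) * c)"
  proof (rule integral_dominated_convergence[where w = "\<lambda>_. S * K\<^sub>0"])
    have "(\<lambda>n. LINT u|\<nu>'. smooth f (\<delta> n) (x + u) - smooth f (\<delta> n) x)
        \<longlonglongrightarrow> (LINT u|\<nu>'. (f (x + u) - f x) * c)" for x
    proof (rule integral_dominated_convergence[where w = "\<lambda>u. S * min 1 (norm u)"])
      show "AE u in \<nu>'. (\<lambda>n. smooth f (\<delta> n) (x + u) - smooth f (\<delta> n) x) \<longlonglongrightarrow> (f (x + u) - f x) * c"
        unfolding left_diff_distrib by (intro AE_I2 tendsto_diff lim)
      show "AE u in \<nu>'. norm (smooth f (\<delta> n) (x + u) - smooth f (\<delta> n) x) \<le> S * min 1 (norm u)" for n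
        using S(4) by simp
    qed (use integrable_\<nu>'_min in auto)
    then show "AE \<omega> in M. (\<lambda>n. LINT u|\<nu>'. smooth f (\<delta> n) (X \<omega> + u) - smooth f (\<delta> n) (X \<omega>))
        \<longlonglongrightarrow> (LINT u|\<nu>'. (f (X \<omega> + u) - f (X \<omega>)) * c)"
      by simp
    show "AE \<omega> in M. norm (LINT u|\<nu>'. smooth f (\<delta> n) (X \<omega> + u) - smooth f (\<delta> n) (X \<omega>)) \<le> S * K\<^sub>0" for n
      using S(4) by (intro AE_I2 integrable_\<nu>'(2)) auto
  qed auto
  ultimately have "(\<lambda>n. LINT \<omega>|M. dsmooth f (\<delta> n) (X \<omega>) (X \<omega>))
      \<longlonglongrightarrow> (LINT \<omega>|M. (grad f (X \<omega>) \<bullet> b\<^sub>0) * c) + (LINT \<omega>|M. LINT u|\<nu>'. (f (X \<omega> + u) - f (X \<omega>)) * c)"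
    and "(\<lambda>n. LINT \<omega>|M. dsmooth f (\<delta> n) (X \<omega>) (X \<omega>)) \<longlonglongrightarrow> (LINT \<omega>|M. (grad f (X \<omega>) \<bullet> X \<omega>) * c)"
    unfolding stein_smooth[OF phi f \<delta>] by (auto intro: tendsto_add)
  from LIMSEQ_unique[OF this]
  have "(LINT \<omega>|M. grad f (X \<omega>) \<bullet> X \<omega>) * c
      = ((LINT \<omega>|M. grad f (X \<omega>) \<bullet> b\<^sub>0) + (LINT \<omega>|M. LINT u|\<nu>'. f (X \<omega> + u) - f (X \<omega>))) * c"
    unfolding integral_mult_left_zero distrib_right by simp
  \<comment> \<open>All three limits carry the mass of the unnormalised Gaussian, cancelled
    here.\<close>
  moreover have "c \<noteq> 0"
    using integral_gauss_pos[where 'a = 'a] by (simp add: c_def)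
  ultimately show ?thesis
    by (simp add: inner_commute)
qed

end

subsection \<open>The equivalence\<close>

text \<open>An integrable function that is positive off a null set: by Markov the sets where it is
  at least \<open>1 / (n + 1)\<close> have finite measure, and with \<open>{0}\<close> they cover
  the space.\<close>

lemma sigma_finite_measure_min_norm:
  fixes \<mu> :: "'a::euclidean_space measure"
  assumes sets: "sets \<mu> = sets borel" and zero: "emeasure \<mu> {0} = 0"
    and fin: "(\<integral>\<^sup>+u. ennreal (min 1 (norm u)) \<partial>\<mu>) < \<infinity>"
  shows "sigma_finite_measure \<mu>"
proof
  note [measurable_cong] = sets
  have space: "space \<mu> = UNIV"
    using sets_eq_imp_space_eq[OF sets] by simp
  let ?A = "\<lambda>n::nat. {u \<in> space \<mu>. 1 \<le> ennreal (Suc n) * ennreal (min 1 (norm u))}"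
  have "emeasure \<mu> (?A n) < \<infinity>" for n
  proof -
    have "emeasure \<mu> (?A n) \<le> ennreal (Suc n) * (\<integral>\<^sup>+u. ennreal (min 1 (norm u)) * indicator (space \<mu>) u \<partial>\<mu>)"
      by (rule nn_integral_Markov_inequality) measurable
    also have "(\<integral>\<^sup>+u. ennreal (min 1 (norm u)) * indicator (space \<mu>) u \<partial>\<mu>) = (\<integral>\<^sup>+u. ennreal (min 1 (norm u)) \<partial>\<mu>)"
      by (intro nn_integral_cong) simp
    also have "ennreal (Suc n) * \<dots> < \<infinity>"
      using fin by (simp add: ennreal_mult_less_top)
    finally show ?thesis .
  qed
  moreover have "u = 0 \<or> (\<exists>n. u \<in> ?A n)" for u :: 'a
  proof (cases "u = 0")
    case False
    define m where "m = min 1 (norm u)"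
    have "0 < m" using False by (simp add: m_def)
    then obtain n where n: "inverse (real (Suc n)) < m"
      using reals_Archimedean by blast
    have "real (Suc n) * inverse (real (Suc n)) < real (Suc n) * m"
      using n by (rule mult_strict_left_mono) simp
    then have "1 \<le> real (Suc n) * min 1 (norm u)"
      by (simp add: m_def[symmetric] del: of_nat_Suc)
    then have "1 \<le> ennreal (real (Suc n) * min 1 (norm u))"
      by simp
    then have "1 \<le> ennreal (Suc n) * ennreal (min 1 (norm u))"
      by (subst ennreal_mult'[symmetric]) auto
    then show ?thesis using space by blast
  qed simp
  then have "\<Union>(insert {0} (range ?A)) = space \<mu>"
    unfolding space by auto
  ultimately show "\<exists>A. countable A \<and> A \<subseteq> sets \<mu> \<and> \<Union>A = space \<mu> \<and> (\<forall>a\<in>A. emeasure \<mu> a \<noteq> \<infinity>)"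
    by (intro exI[of _ "insert {0} (range ?A)"]) (auto simp: zero less_top)
qed

theorem theorem3p3:
  fixes M :: "'w measure" and X :: "'w \<Rightarrow> 'a::euclidean_space"
    and b b\<^sub>0 :: 'a and \<nu> \<nu>' \<sigma> :: "'a measure" and k :: "'a \<Rightarrow> real \<Rightarrow> real"
  assumes "prob_space M" and "X \<in> borel_measurable M"
    and "levy_measure \<nu>"
    and "(\<integral>\<^sup>+u\<in>cball 0 1. ennreal (norm u) \<partial>\<nu>) < \<infinity>"
    and "finite_sphere_measure \<sigma>"
    and "polar_decomposition \<nu> \<sigma> (\<lambda>x. over_r_measure (k x))"
    and "\<And>x r. x \<in> sphere 0 1 \<Longrightarrow> 0 < r \<Longrightarrow> 0 \<le> k x r"
    and "\<And>x. x \<in> sphere 0 1 \<Longrightarrow> continuous_on {0<..} (k x)"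
    and "\<And>x. x \<in> sphere 0 1 \<Longrightarrow> antimono_on {0<..} (k x)"
    and "\<And>r. 0 < r \<Longrightarrow> continuous_on (sphere 0 1) (\<lambda>x. k x r)"
    and "\<And>x. x \<in> sphere 0 1 \<Longrightarrow> ((\<lambda>\<epsilon>. \<epsilon> * k x \<epsilon>) \<longlongrightarrow> 0) (at_right 0)"
    and "\<And>x. x \<in> sphere 0 1 \<Longrightarrow> ((\<lambda>R. k x R) \<longlongrightarrow> 0) at_top"
    and "(\<integral>\<^sup>+r\<in>{0<..}. ennreal (min 1 r * (SUP x\<in>sphere 0 1. k x r) / r) \<partial>lborel) < \<infinity>"
    and "\<And>xs x a. (\<And>n::nat. xs n \<in> sphere 0 1) \<Longrightarrow> x \<in> sphere 0 1 \<Longrightarrow>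
           xs \<longlonglongrightarrow> x \<Longrightarrow> 0 < a \<Longrightarrow>
           (\<lambda>n. Lim at_top (\<lambda>R. variation a R (\<lambda>r. k (xs n) r - k x r))) \<longlonglongrightarrow> 0"
    and "polar_decomposition \<nu>' \<sigma> (\<lambda>x. neg_stieltjes (k x))"
    and "(\<integral>\<^sup>+u. ennreal (min 1 (norm u)) \<partial>\<nu>') < \<infinity>"
    and "b\<^sub>0 = b - (LINT u:cball 0 1|\<nu>. u)"
  shows "(\<forall>f. schwartz f \<longrightarrow>
            (LINT \<omega>|M. X \<omega> \<bullet> grad f (X \<omega>)) =
            (LINT \<omega>|M. b\<^sub>0 \<bullet> grad f (X \<omega>)) +
            (LINT \<omega>|M. LINT u|\<nu>'. f (X \<omega> + u) - f (X \<omega>)))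
         \<longleftrightarrow> self_decomposable M X b \<nu>"
proof -
  note prob = assms(1) and X = assms(2) and levy = assms(3) and small = assms(4)
    and k_nonneg = assms(7) and k_cont = assms(8) and k_anti = assms(9) and k_sphere = assms(10)
    and polar = assms(6) and polar' = assms(15) and fin' = assms(16) and b\<^sub>0 = assms(17)
  interpret prob_space M by (rule prob)
  have sets_\<sigma>: "sets \<sigma> = sets (restrict_space borel (sphere 0 1))"
    using assms(5) by (simp add: finite_sphere_measure_def)
  note space_\<sigma> = space_sphere_measure[OF sets_\<sigma>]
  have sets_\<nu>' [measurable_cong]: "sets \<nu>' = sets borel"
    using polar' by (simp add: polar_decomposition_def)
  have sets_\<nu> [measurable_cong]: "sets \<nu> = sets borel"
    using polar by (simp add: polar_decomposition_def)
  \<comment> \<open>The origin is on no open ray, so it carries no mass;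
    \<open>sigma_finite_measure_min_norm\<close> asks for this.\<close>
  have "emeasure \<nu>' {0} = (\<integral>\<^sup>+x. emeasure (neg_stieltjes (k x)) {r. 0 < r \<and> r *\<^sub>R x \<in> {0}} \<partial>\<sigma>)"
    using polar' unfolding polar_decomposition_def by simp
  also have "\<dots> = (\<integral>\<^sup>+x. 0 \<partial>\<sigma>)"
  proof (rule nn_integral_cong)
    fix x assume "x \<in> space \<sigma>"
    then have "{r. 0 < r \<and> r *\<^sub>R x \<in> {0}} = {}"
      by (auto simp: space_\<sigma>)
    then show "emeasure (neg_stieltjes (k x)) {r. 0 < r \<and> r *\<^sub>R x \<in> {0}} = 0"
      by (simp only: emeasure_empty)
  qed
  finally have zero: "emeasure \<nu>' {0} = 0" by simp
  have int_norm: "integrable \<nu> (\<lambda>u. indicator (cball 0 1) u *\<^sub>R u)"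
  proof (rule integrableI_bounded)
    show "(\<integral>\<^sup>+u. ennreal (norm (indicator (cball 0 1) u *\<^sub>R u)) \<partial>\<nu>) < \<infinity>"
      using small by (simp add: nn_integral_set_ennreal mult.commute)
    show "(\<lambda>u. indicator (cball 0 1) u *\<^sub>R u) \<in> borel_measurable \<nu>"
      by (subst measurable_cong_sets[OF sets_\<nu> refl])
         (intro borel_measurable_scaleR borel_measurable_indicator; simp)
  qed
  have int_sq: "integrable \<nu> (\<lambda>u. min 1 ((norm u)\<^sup>2))"
    using levy by (intro integrableI_bounded) (auto simp: levy_measure_def)
  interpret ou_pair M X b\<^sub>0 \<nu> \<nu>'
  proof (intro ou_pair.intro ou_pair_axioms.intro)
    show "sigma_finite_measure \<nu>'"
      by (rule sigma_finite_measure_min_norm[OF sets_\<nu>' zero fin'])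
    show "integrable \<nu>' (\<lambda>u. min 1 (norm u))"
      using fin' by (intro integrableI_bounded) auto
    show "\<nu> = distr (\<nu>' \<Otimes>\<^sub>M log_unit) borel (\<lambda>(u, s). s *\<^sub>R u)"
      by (rule polar_decomposition_eq_distr[OF sets_\<sigma> k_nonneg k_cont k_anti k_sphere assms(12) polar polar'])
    show "integrable \<nu> (\<lambda>u. min 1 (norm u))"
    proof (rule Bochner_Integration.integrable_bound)
      show "integrable \<nu> (\<lambda>u. norm (indicator (cball 0 1) u *\<^sub>R u) + min 1 ((norm u)\<^sup>2))"
        using int_norm int_sq by (intro Bochner_Integration.integrable_add integrable_norm)
      \<comment> \<open>Inside the unit ball the first summand is \<open>norm u\<close>; outside it
        the second one equals 1.\<close>
      show "AE u in \<nu>. norm (min 1 (norm u)) \<le> norm (norm (indicator (cball 0 1) u *\<^sub>R u) + min 1 ((norm u)\<^sup>2))"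
        by (intro AE_I2) (auto split: split_indicator simp: min_def)
    qed measurable
  qed (use prob X sets_\<nu>' in auto)
  \<comment> \<open>As \<open>u\<close> is integrable over the unit ball, the compensator splits off
    as a linear term in \<xi>, and this is the difference between \<open>b\<close> and
    \<open>b\<^sub>0\<close>.\<close>
  have exponent: "\<i> * complex_of_real (b \<bullet> \<xi>) + (CLINT u|\<nu>. iexp (\<xi> \<bullet> u) - 1
      - \<i> * complex_of_real ((\<xi> \<bullet> u) * indicator (cball 0 1) u)) = psi \<xi>" for \<xi>
  proof -
    have eq: "(\<xi> \<bullet> u) * indicator (cball 0 1) u = \<xi> \<bullet> (indicator (cball 0 1) u *\<^sub>R u)" for u
      by simp
    have int: "integrable \<nu> (\<lambda>u. \<xi> \<bullet> (indicator (cball 0 1) u *\<^sub>R u))"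
      using int_norm by (rule integrable_inner_right)
    have "(CLINT u|\<nu>. iexp (\<xi> \<bullet> u) - 1 - \<i> * complex_of_real ((\<xi> \<bullet> u) * indicator (cball 0 1) u))
        = (CLINT u|\<nu>. iexp (\<xi> \<bullet> u) - 1) - (CLINT u|\<nu>. \<i> * complex_of_real (\<xi> \<bullet> (indicator (cball 0 1) u *\<^sub>R u)))"
      unfolding eq using integrable_\<nu>_iexp int
      by (intro Bochner_Integration.integral_diff integrable_mult_right integrable_of_real)
    also have "(CLINT u|\<nu>. \<i> * complex_of_real (\<xi> \<bullet> (indicator (cball 0 1) u *\<^sub>R u)))
        = \<i> * complex_of_real (\<xi> \<bullet> (LINT u:cball 0 1|\<nu>. u))"
      using int_norm
      by (simp only: integral_mult_right_zero integral_complex_of_real integral_inner_right set_lebesgue_integral_def)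
    finally have split: "(CLINT u|\<nu>. iexp (\<xi> \<bullet> u) - 1
        - \<i> * complex_of_real ((\<xi> \<bullet> u) * indicator (cball 0 1) u))
      = (CLINT u|\<nu>. iexp (\<xi> \<bullet> u) - 1) - \<i> * complex_of_real (\<xi> \<bullet> (LINT u:cball 0 1|\<nu>. u))" .
    have drift: "b \<bullet> \<xi> = b\<^sub>0 \<bullet> \<xi> + \<xi> \<bullet> (LINT u:cball 0 1|\<nu>. u)"
      by (simp add: b\<^sub>0 inner_diff_left inner_diff_right inner_commute)
    have cancel: "x + y + (z - y) = x + z" for x y z :: complex
      by simp
    show ?thesis
      unfolding psi_def split drift of_real_add distrib_left by (rule cancel)
  qed
  \<comment> \<open>The given \<open>\<sigma>\<close> and \<open>k\<close> witness the existential
    in \<open>self_decomposable\<close>, which leaves the equation for the characteristic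
    function.\<close>
  have "self_decomposable M X b \<nu> \<longleftrightarrow> (\<forall>\<xi>. phi \<xi> = exp (psi \<xi>))"
  proof -
    have "(\<lambda>x. k x r) \<in> borel_measurable \<sigma>" if "0 < r" for r
      by (rule borel_measurable_sphere_continuous[OF sets_\<sigma> k_sphere[OF that]])
    with assms(5) k_nonneg k_anti polar have "\<exists>\<sigma> k. finite_sphere_measure \<sigma> \<and>
        (\<forall>x\<in>sphere 0 1. \<forall>r>0. 0 \<le> k x r) \<and>
        (\<forall>x\<in>sphere 0 1. antimono_on {0<..} (k x)) \<and>
        (\<forall>r>0. (\<lambda>x. k x r) \<in> borel_measurable \<sigma>) \<and>
        polar_decomposition \<nu> \<sigma> (\<lambda>x. over_r_measure (k x))"
      by (intro exI[of _ \<sigma>] exI[of _ k] conjI ballI allI impI)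
    with levy show ?thesis
      unfolding self_decomposable_def exponent phi_def by blast
  qed
  then show ?thesis
    using phi_eq_exp_psi stein_identity by blast
qed

end
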